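(* For the Gaussian MIMO cognitive channel with channel matrices $H_{p,p},H_{c,p},H_{p,c},H_{c,c}$ and power constraints $P_p,P_c$, the region $\mathcal{R}_{in}$ is achievable, i.e. $\mathcal{R}_{in}\subseteq \mathcal{C}_{MCC}$.
   Context: Gaussian MIMO cognitive channel (MCC): a primary transmitter with $n_{p,t}$ antennas, a cognitive transmitter with $n_{c,t}$ antennas, a primary receiver with $n_{p,r}$ antennas and a cognitive receiver with $n_{c,r}$ antennas. Fixed (static) complex matrices $H_{p,p}\in\mathbb{C}^{n_{p,r}\times n_{p,t}}$, $H_{c,p}\in\mathbb{C}^{n_{p,r}\times n_{c,t}}$, $H_{p,c}\in\mathbb{C}^{n_{c,r}\times n_{p,t}}$, $H_{c,c}\in\mathbb{C}^{n_{c,r}\times n_{c,t}}$. At time $i$: $Y_p(i)=H_{p,p}X_p(i)+H_{c,p}X_c(i)+Z_p(i)$, $Y_c(i)=H_{p,c}X_p(i)+H_{c,c}X_c(i)+Z_c(i)$, where $Z_p(i)\sim\mathcal{N}(0,I_{n_{p,r}})$, $Z_c(i)\sim\mathcal{N}(0,I_{n_{c,r}})$ are (circularly symmetric complex) Gaussian, i.i.d. over time, with arbitrary mutual correlation. A code of length $n$ and rates $(R_p,R_c)$: messages $m_p\in\{1,\dots,2^{nR_p}\}$, $m_c\in\{1,\dots,2^{nR_c}\}$ (independent, uniform); encoders $X_p^n=E_p^n(m_p)$ and $X_c^n=E_c^n(m_p,m_c)$ (the cognitive transmitter knows both messages) satisfying $\sum_{i=1}^n\mathrm{Tr}(\Sigma_p(i))\le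 nP_p$ and $\sum_{i=1}^n\mathrm{Tr}(\Sigma_c(i))\le nP_c$, where $\Sigma_p(i),\Sigma_c(i)$ are the covariances of $X_p(i),X_c(i)$; decoders $\hat m_p=D_p^n(Y_p^n)$, $\hat m_c=D_c^n(Y_c^n)$. $(R_p,R_c)$ is achievable if for every $\epsilon>0$ there is, for all sufficiently large $n$, a code with $\Pr(\hat m_p\ne m_p)\le\epsilon$ and $\Pr(\hat m_c\ne m_c)\le\epsilon$. $\mathcal{C}_{MCC}$ denotes the set of achievable rate pairs (capacity region). $A^\dagger$ is conjugate transpose, $|\cdot|$ determinant, $\succeq 0$ positive semidefinite. Let $G=[H_{p,p}\ \ H_{c,p}]$. $\mathcal{R}_{ach}$ is the set of tuples $((R_p,R_c),\Sigma_p,\Sigma_{c,p},\Sigma_{c,c},Q)$ with $R_p,R_c\ge0$, $\Sigma_p\in\mathbb{C}^{n_{p,t}\times n_{p,t}}$, $\Sigma_{c,p},\Sigma_{c,c}\in\mathbb{C}^{n_{c,t}\times n_{c,t}}$ all $\succeq0$, $Q\in\mathbb{C}^{n_{p,t}\times n_{c,t}}$, such that $\Sigma_{p,net}=\begin{pmatrix}\Sigma_p&Q\\Q^\dagger&\Sigma_{c,p}\end{pmatrix}\succeq 0$, $\mathrm{Tr}(\Sigma_p)\le P_p$, $\mathrm{Tr}(\Sigma_{c,p}+\Sigma_{c,c})\le P_c$, and $R_p\le \log|I+G\Sigma_{p,net}G^\dagger+H_{c,p}\Sigma_{c,c}H_{c,p}^\dagger|-\log|I+H_{c,p}\Sigma_{c,c}H_{c,p}^\dagger|$,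 $R_c\le\log|I+H_{c,c}\Sigma_{c,c}H_{c,c}^\dagger|$. $\mathcal{R}_{in}$ is the closure of the convex hull of the set of $(R_p,R_c)$ for which some $\Sigma_p,\Sigma_{c,p},\Sigma_{c,c},Q$ give a tuple in $\mathcal{R}_{ach}$. *)

theory Defs
  imports "HOL-Analysis.Analysis" "HOL-Probability.Probability"
begin

definition cadj :: "complex^'n^'m \<Rightarrow> complex^'m^'n" where
  "cadj A = (\<chi> i j. cnj (A $ j $ i))"

definition ctrace :: "complex^'n^'n \<Rightarrow> complex" where
  "ctrace A = (\<Sum>i\<in>UNIV. A $ i $ i)"

definition psd :: "complex^'n^'n \<Rightarrow> bool" where
  "psd A \<longleftrightarrow> cadj A = A \<and>
     (\<forall>x::complex^'n. Im (\<Sum>i\<in>UNIV. cnj (x $ i) * (A *v x) $ i) = 0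
                     \<and> Re (\<Sum>i\<in>UNIV. cnj (x $ i) * (A *v x) $ i) \<ge> 0)"

definition hcat :: "complex^'a^'r \<Rightarrow> complex^'b^'r \<Rightarrow> complex^('a + 'b)^'r" where
  "hcat A B = (\<chi> i j. case j of Inl k \<Rightarrow> A $ i $ k | Inr k \<Rightarrow> B $ i $ k)"

definition block2 :: "complex^'c^'a \<Rightarrow> complex^'d^'a \<Rightarrow> complex^'c^'b \<Rightarrow> complex^'d^'b
    \<Rightarrow> complex^('c + 'd)^('a + 'b)" where
  "block2 A B C D = (\<chi> i j. case i of
       Inl a \<Rightarrow> (case j of Inl c \<Rightarrow> A $ a $ c | Inr d \<Rightarrow> B $ a $ d)
     | Inr b \<Rightarrow> (case j of Inl c \<Rightarrow> C $ b $ c | Inr d \<Rightarrow> D $ b $ d))"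

definition outer :: "complex^'n \<Rightarrow> complex^'n \<Rightarrow> complex^'n^'n" where
  "outer x y = (\<chi> i j. x $ i * cnj (y $ j))"

definition cov_unif :: "'m set \<Rightarrow> ('m \<Rightarrow> complex^'n) \<Rightarrow> complex^'n^'n" where
  "cov_unif S f =
     (let mu = (1 / real (card S)) *\<^sub>R (\<Sum>m\<in>S. f m)
      in (1 / real (card S)) *\<^sub>R (\<Sum>m\<in>S. outer (f m - mu) (f m - mu)))"

definition cgauss :: "(complex^'n) measure" where
  "cgauss = density lborel
     (\<lambda>z. ennreal (exp (- (norm z)\<^sup>2) / pi ^ CARD('n)))"

definition noise :: "nat \<Rightarrow> (nat \<Rightarrow> complex^'n) measure" where
  "noise n = PiM {..<n} (\<lambda>_. cgauss)"

definition msgs :: "nat \<Rightarrow> real \<Rightarrow> nat set" where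
  "msgs n R = {1 .. nat \<lceil>2 powr (real n * R)\<rceil>}"

definition err_prob ::
  "nat \<Rightarrow> complex^'a^'r \<Rightarrow> complex^'b^'r \<Rightarrow> (nat \<Rightarrow> complex^'a) \<Rightarrow> (nat \<Rightarrow> complex^'b)
   \<Rightarrow> ((nat \<Rightarrow> complex^'r) \<Rightarrow> nat) \<Rightarrow> nat \<Rightarrow> real" where
  "err_prob n A B x x' D m =
     measure (noise n) {z \<in> space (noise n).
        D (restrict (\<lambda>i. A *v x i + B *v x' i + z i) {..<n}) \<noteq> m}"

definition MCC_code ::
  "complex^'pt^'pr \<Rightarrow> complex^'ct^'pr \<Rightarrow> complex^'pt^'cr \<Rightarrow> complex^'ct^'cr \<Rightarrow> real \<Rightarrow> real
   \<Rightarrow> nat \<Rightarrow> real \<Rightarrow> real \<Rightarrow> real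
   \<Rightarrow> (nat \<Rightarrow> nat \<Rightarrow> complex^'pt) \<Rightarrow> (nat \<Rightarrow> nat \<Rightarrow> nat \<Rightarrow> complex^'ct)
   \<Rightarrow> ((nat \<Rightarrow> complex^'pr) \<Rightarrow> nat) \<Rightarrow> ((nat \<Rightarrow> complex^'cr) \<Rightarrow> nat) \<Rightarrow> bool" where
  "MCC_code Hpp Hcp Hpc Hcc Pp Pc n Rp Rc eps Ep Ec Dp Dc \<longleftrightarrow>
     (let Mp = msgs n Rp; Mc = msgs n Rc in
       Dp \<in> measurable (PiM {..<n} (\<lambda>_. borel)) (count_space UNIV) \<and>
       Dc \<in> measurable (PiM {..<n} (\<lambda>_. borel)) (count_space UNIV) \<and>
       (\<Sum>i<n. Re (ctrace (cov_unif Mp (\<lambda>mp. Ep mp i)))) \<le> real n * Pp \<and>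
       (\<Sum>i<n. Re (ctrace (cov_unif (Mp \<times> Mc) (\<lambda>(mp, mc). Ec mp mc i)))) \<le> real n * Pc \<and>
       (1 / real (card Mp * card Mc)) *
         (\<Sum>mp\<in>Mp. \<Sum>mc\<in>Mc. err_prob n Hpp Hcp (Ep mp) (Ec mp mc) Dp mp) \<le> eps \<and>
       (1 / real (card Mp * card Mc)) *
         (\<Sum>mp\<in>Mp. \<Sum>mc\<in>Mc. err_prob n Hpc Hcc (Ep mp) (Ec mp mc) Dc mc) \<le> eps)"

definition C_MCC ::
  "complex^'pt^'pr \<Rightarrow> complex^'ct^'pr \<Rightarrow> complex^'pt^'cr \<Rightarrow> complex^'ct^'cr \<Rightarrow> real \<Rightarrow> real
   \<Rightarrow> (real \<times> real) set" where
  "C_MCC Hpp Hcp Hpc Hcc Pp Pc = {(Rp, Rc). \<forall>eps>0. \<exists>N. \<forall>n\<ge>N.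
      \<exists>Ep Ec Dp Dc. MCC_code Hpp Hcp Hpc Hcc Pp Pc n Rp Rc eps Ep Ec Dp Dc}"

definition R_ach ::
  "complex^'pt^'pr \<Rightarrow> complex^'ct^'pr \<Rightarrow> complex^'pt^'cr \<Rightarrow> complex^'ct^'cr \<Rightarrow> real \<Rightarrow> real
   \<Rightarrow> ((real \<times> real) \<times> (complex^'pt^'pt) \<times> (complex^'ct^'ct) \<times> (complex^'ct^'ct) \<times> (complex^'ct^'pt)) set" where
  "R_ach Hpp Hcp Hpc Hcc Pp Pc = {((Rp, Rc), Sp, Scp, Scc, Q).
      Rp \<ge> 0 \<and> Rc \<ge> 0 \<and> psd Sp \<and> psd Scp \<and> psd Scc \<and>
      psd (block2 Sp Q (cadj Q) Scp) \<and>
      Re (ctrace Sp) \<le> Pp \<and> Re (ctrace (Scp + Scc)) \<le> Pc \<and>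
      Rp \<le> log 2 (Re (det (mat 1 + hcat Hpp Hcp ** block2 Sp Q (cadj Q) Scp ** cadj (hcat Hpp Hcp)
                           + Hcp ** Scc ** cadj Hcp)))
           - log 2 (Re (det (mat 1 + Hcp ** Scc ** cadj Hcp))) \<and>
      Rc \<le> log 2 (Re (det (mat 1 + Hcc ** Scc ** cadj Hcc)))}"

definition R_in ::
  "complex^'pt^'pr \<Rightarrow> complex^'ct^'pr \<Rightarrow> complex^'pt^'cr \<Rightarrow> complex^'ct^'cr \<Rightarrow> real \<Rightarrow> real
   \<Rightarrow> (real \<times> real) set" where
  "R_in Hpp Hcp Hpc Hcc Pp Pc =
     closure (convex hull {R. \<exists>Sp Scp Scc Q. (R, Sp, Scp, Scc, Q) \<in> R_ach Hpp Hcp Hpc Hcc Pp Pc})"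

end

theory Submission
  imports Defs
begin

text \<open>
  Write the covariances of a point of \<open>R_ach\<close> as \<open>K K\<^sup>\<dagger>\<close> and \<open>T T\<^sup>\<dagger>\<close>. The primary message is carried by a Gaussian
  codeword \<open>s\<close> and sent jointly by both transmitters as \<open>K s\<close>; the cognitive transmitter adds \<open>T v\<close>. Costa's choice
  \<open>u = v + W B s\<close>, with \<open>B s\<close> the interference and \<open>W\<close> the MMSE filter at the cognitive receiver, makes the rate
  \<open>I(u; y) - I(u; s)\<close> equal to the interference-free rate. The coding theorem is one-shot: the codewords \<open>u\<close> are
  binned at random, and one member of the bin is picked with probability proportional to the likelihood ratio of
  \<open>u\<close> given \<open>s\<close>. Each receiver compares a metric \<open>l\<close> with a threshold; since \<open>exp l\<close> integrates to at most 1 over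
  an independent codeword, a union bound controls false alarms. The remaining bad events are of the form
  \<open>0 \<le> \<Sum>\<^sub>i X\<^sub>i\<close> with \<open>X\<^sub>i\<close> of negative mean and finite exponential moments, hence exponentially unlikely by Chernoff's
  bound. Convex combinations are obtained by averaging over the assignment of time slots to operating points.

  Boundary rates need no limit: the power constraint only involves an average over the messages, so silencing a
  small fraction of the messages permits a power larger by a factor \<open>\<kappa> > 1\<close>, which strictly increases every positive rate.
  The set of rates is compact because it is parametrised by bounded \<open>K\<close> and \<open>T\<close>, so its convex hull is already closed.
\<close>

text \<open>The auxiliary codewords are drawn from the standard Gaussian law, not from the marginal
  law of \<open>u\<close>. The price of binning, the mean of \<open>ll1\<close>, then is the squared
  norm of \<open>C\<close> instead of I(u; s), and the mean of \<open>ll2\<close> exceeds I(u; y) by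
  just as much as this price exceeds I(u; s). The difference of the two means is exactly
  \<open>ln (gdet H)\<close>, so no mutual information has to be computed, and every bad event is
  judged by the sign of an explicit mean. Encoders are deterministic and power is constrained only
  on average. Exceeding a slightly larger budget is therefore treated as one more bad event of the
  random code, and the offending codewords are sent as zero. The primary encoder sees only
  \<open>mp\<close>, so its silencing must not depend on \<open>mc\<close>. Time sharing involves no
  rounding of slot counts: averaging a product over all schedules with product weights gives the
  n-th power of a weighted sum, so some fixed schedule does as well as the average, and only the
  mean averaged over the operating points has to be negative.\<close>

section \<open>Random binning\<close>

text \<open>Jensen's inequality for \<open>x \<mapsto> 1 / x\<close>, from its tangent at \<open>a + m\<close>.\<close>

lemma nn_integral_inverse_ge:
  fixes X :: "'a \<Rightarrow> real"
  assumes "prob_space M" and [measurable]: "X \<in> borel_measurable M" and X: "\<And>x. 0 \<le> X x"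
    and m: "(\<integral>\<^sup>+x. ennreal (X x) \<partial>M) = ennreal m" "0 \<le> m" and a: "0 < a"
  shows "ennreal (1 / (a + m)) \<le> (\<integral>\<^sup>+x. ennreal (1 / (a + X x)) \<partial>M)"
proof -
  interpret prob_space M by fact
  let ?b = "a + m"
  have b: "?b > 0" using m a by simp
  have tangent: "2 / ?b \<le> 1 / (a + X x) + (a + X x) / ?b\<^sup>2" for x
  proof -
    have *: "2 / b \<le> 1 / y + y / b\<^sup>2" if "y > 0" "b > 0" for y b :: real
    proof -
      have "0 \<le> (y - b)\<^sup>2 / (y * b\<^sup>2)" using that by simp
      also have "\<dots> = 1 / y + y / b\<^sup>2 - 2 / b"
        using that by (simp add: field_simps power2_eq_square)
      finally show ?thesis by simp
    qed
    show ?thesis using X[of x] a b by (intro *) linarith+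
  qed
  \<comment> \<open>The linear part of the tangent integrates to exactly \<open>1 / ?b\<close>, so
    splitting the constant \<open>2 / ?b\<close> into two halves lets one of them cancel at the
    end.\<close>
  have "ennreal (1 / ?b) + ennreal (1 / ?b) = ennreal (2 / ?b)"
    using b by (simp flip: ennreal_plus)
  also have "\<dots> = (\<integral>\<^sup>+x. ennreal (2 / ?b) \<partial>M)" by (simp add: emeasure_space_1)
  also have "\<dots> \<le> (\<integral>\<^sup>+x. ennreal (1 / (a + X x)) + ennreal ((a + X x) / ?b\<^sup>2) \<partial>M)"
    using tangent X a by (intro nn_integral_mono) (simp flip: ennreal_plus add: add_nonneg_nonneg less_imp_le ennreal_leI)
  also have "\<dots> = (\<integral>\<^sup>+x. ennreal (1 / (a + X x)) \<partial>M) + (\<integral>\<^sup>+x. ennreal ((a + X x) / ?b\<^sup>2) \<partial>M)"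
    by (intro nn_integral_add) auto
  also have "(\<integral>\<^sup>+x. ennreal ((a + X x) / ?b\<^sup>2) \<partial>M) = ennreal (1 / ?b)"
  proof -
    have "(\<integral>\<^sup>+x. ennreal ((a + X x) / ?b\<^sup>2) \<partial>M)
        = (\<integral>\<^sup>+x. ennreal (1 / ?b\<^sup>2) * (ennreal a + ennreal (X x)) \<partial>M)"
      using X a by (intro nn_integral_cong) (simp flip: ennreal_plus ennreal_mult)
    also have "\<dots> = ennreal (1 / ?b\<^sup>2) * (ennreal a + ennreal m)"
      using m by (simp add: nn_integral_cmult nn_integral_add emeasure_space_1)
    also have "\<dots> = ennreal (1 / ?b)"
      using a m b by (simp flip: ennreal_plus ennreal_mult add: power2_eq_square)
    finally show ?thesis .
  qed
  finally have "ennreal (1 / ?b) + ennreal (1 / ?b) \<le> ennreal (1 / ?b) + (\<integral>\<^sup>+x. ennreal (1 / (a + X x)) \<partial>M)"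
    by (simp only: add.commute)
  then show ?thesis unfolding ennreal_add_left_cancel_le by simp
qed

lemma nn_integral_PiM_component:
  assumes "finite I" "i \<in> I" and M: "\<And>i. prob_space (M i)" and [measurable]: "f \<in> borel_measurable (M i)"
  shows "(\<integral>\<^sup>+x. f (x i) \<partial>PiM I M) = (\<integral>\<^sup>+y. f y \<partial>M i)"
proof -
  have "(\<integral>\<^sup>+y. f y \<partial>M i) = (\<integral>\<^sup>+y. f y \<partial>distr (PiM I M) (M i) (\<lambda>x. x i))"
    using assms by (subst distr_PiM_component) auto
  also have "\<dots> = (\<integral>\<^sup>+x. f (x i) \<partial>PiM I M)"
    using \<open>i \<in> I\<close> by (intro nn_integral_distr) auto
  finally show ?thesis by simp
qed

lemma nn_integral_PiM_extract:
  assumes "finite I" "i \<in> I" and M: "\<And>i. prob_space (M i)" and [measurable]: "f \<in> borel_measurable (PiM I M)"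
  shows "(\<integral>\<^sup>+x. f x \<partial>PiM I M) = (\<integral>\<^sup>+y. (\<integral>\<^sup>+x. f (x(i := y)) \<partial>PiM (I - {i}) M) \<partial>M i)"
proof -
  interpret product_sigma_finite M
    using M by (simp add: product_sigma_finite_def prob_space_imp_sigma_finite)
  have I: "insert i (I - {i}) = I" using assms by auto
  show ?thesis
    using product_nn_integral_insert_rev[of "I - {i}" i f] assms(1,4) unfolding I by blast
qed

lemma nn_integral_PiM_two_components:
  assumes "finite I" "i \<in> I" "j \<in> I" "i \<noteq> j" and M: "\<And>i. prob_space (M i)"
    and [measurable]: "(\<lambda>(y, y'). f y y') \<in> borel_measurable (M i \<Otimes>\<^sub>M M j)"
  shows "(\<integral>\<^sup>+x. f (x i) (x j) \<partial>PiM I M) = (\<integral>\<^sup>+y. (\<integral>\<^sup>+y'. f y y' \<partial>M j) \<partial>M i)"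
proof -
  have [measurable]: "(\<lambda>x. x i) \<in> measurable (PiM I M) (M i)" "(\<lambda>x. x j) \<in> measurable (PiM I M) (M j)"
    using assms by auto
  have "(\<integral>\<^sup>+x. f (x i) (x j) \<partial>PiM I M)
      = (\<integral>\<^sup>+y. (\<integral>\<^sup>+x. f ((x(i := y)) i) ((x(i := y)) j) \<partial>PiM (I - {i}) M) \<partial>M i)"
    by (rule nn_integral_PiM_extract) (use assms in auto)
  also have "\<dots> = (\<integral>\<^sup>+y. (\<integral>\<^sup>+x. f y (x j) \<partial>PiM (I - {i}) M) \<partial>M i)"
    using assms by auto
  also have "\<dots> = (\<integral>\<^sup>+y. (\<integral>\<^sup>+y'. f y y' \<partial>M j) \<partial>M i)"
    by (intro nn_integral_cong nn_integral_PiM_component) (use assms in auto)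
  finally show ?thesis .
qed

text \<open>
  The expected cost of a random selection is bounded through the complementary cost \<open>B - c\<close>: conditioning on the
  selected entry, Jensen's inequality bounds the normalising sum from below by its mean.
\<close>

lemma likelihood_selection_cost_le:
  fixes g c :: "'a \<Rightarrow> real" and J :: nat
  assumes M: "prob_space M" and [measurable]: "g \<in> borel_measurable M" "c \<in> borel_measurable M"
    and g: "\<And>x. 0 < g x" and g1: "(\<integral>\<^sup>+x. ennreal (g x) \<partial>M) = 1"
    and c: "\<And>x. 0 \<le> c x" "\<And>x. c x \<le> B" and J: "0 < J"
  shows "(\<integral>\<^sup>+x. (\<Sum>j<J. ennreal (g (x j) / (\<Sum>i<J. g (x i)) * c (x j))) \<partial>PiM {..<J} (\<lambda>_. M))
    \<le> (\<integral>\<^sup>+u. ennreal (g u * c u) \<partial>M) + ennreal B * (\<integral>\<^sup>+u. ennreal (g u * min 1 (g u / J)) \<partial>M)"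
proof -
  interpret prob_space M by fact
  let ?P = "PiM {..<J} (\<lambda>_. M)"
  interpret P: prob_space ?P by (intro prob_space_PiM M)
  have B: "0 \<le> B" using c order_trans by blast
  have cmp[measurable]: "(\<lambda>x. x i) \<in> measurable (PiM I (\<lambda>_. M)) M" if "i \<in> I" for i and I :: "nat set"
    using that by simp
  have Spos: "0 < (\<Sum>i<J. g (x i))" for x
    using J g by (intro sum_pos) auto
  let ?A = "\<integral>\<^sup>+x. (\<Sum>j<J. ennreal (g (x j) / (\<Sum>i<J. g (x i)) * c (x j))) \<partial>?P"
  let ?L' = "\<integral>\<^sup>+x. (\<Sum>j<J. ennreal (g (x j) / (\<Sum>i<J. g (x i)) * (B - c (x j)))) \<partial>?P"
  let ?L = "\<integral>\<^sup>+u. ennreal (g u * (B - c u) * (J / (g u + J))) \<partial>M"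
  let ?R = "(\<integral>\<^sup>+u. ennreal (g u * c u) \<partial>M) + (\<integral>\<^sup>+u. ennreal (B * (g u * min 1 (g u / J))) \<partial>M)"
  have AL': "?A + ?L' = ennreal B"
  proof -
    have "?A + ?L' = (\<integral>\<^sup>+x. (\<Sum>j<J. ennreal (g (x j) / (\<Sum>i<J. g (x i)) * c (x j)))
        + (\<Sum>j<J. ennreal (g (x j) / (\<Sum>i<J. g (x i)) * (B - c (x j)))) \<partial>?P)"
      by (intro nn_integral_add[symmetric]) measurable
    also have "\<dots> = (\<integral>\<^sup>+x. ennreal B \<partial>?P)"
    proof (intro nn_integral_cong)
      fix x
      let ?S = "\<Sum>i<J. g (x i)"
      have "(\<Sum>j<J. ennreal (g (x j) / ?S * c (x j))) + (\<Sum>j<J. ennreal (g (x j) / ?S * (B - c (x j))))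
          = (\<Sum>j<J. ennreal (g (x j) / ?S * B))"
        unfolding sum.distrib[symmetric] using g c Spos[of x]
        by (intro sum.cong refl) (simp flip: ennreal_plus add: less_imp_le add_divide_distrib[symmetric] distrib_left[symmetric])
      also have "\<dots> = ennreal (\<Sum>j<J. g (x j) / ?S * B)"
        using g Spos[of x] B by (intro sum_ennreal) (simp add: less_imp_le)
      also have "(\<Sum>j<J. g (x j) / ?S * B) = B"
        using Spos[of x] by (simp flip: sum_distrib_right sum_divide_distrib)
      finally show "(\<Sum>j<J. ennreal (g (x j) / ?S * c (x j))) + (\<Sum>j<J. ennreal (g (x j) / ?S * (B - c (x j)))) = ennreal B" .
    qed
    finally show ?thesis by (simp add: P.emeasure_space_1)
  qed
  \<comment> \<open>The entry \<open>x j\<close> is split off and fixed to \<open>u\<close>. The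
    other weights have mean 1 each, so the normalising sum has conditional mean
    \<open>g u + (J - 1)\<close>, and inversion is convex. Then \<open>J - 1\<close> is enlarged to
    \<open>J\<close> for a simpler bound.\<close>
  have single: "(\<integral>\<^sup>+x. ennreal (g (x j) / (\<Sum>i<J. g (x i)) * (B - c (x j))) \<partial>?P)
      \<ge> (\<integral>\<^sup>+u. ennreal (g u * (B - c u) * (1 / (g u + J))) \<partial>M)" if j: "j < J" for j
  proof -
    have "(\<integral>\<^sup>+x. ennreal (g (x j) / (\<Sum>i<J. g (x i)) * (B - c (x j))) \<partial>?P)
      = (\<integral>\<^sup>+u. (\<integral>\<^sup>+x. ennreal (g ((x(j := u)) j) / (\<Sum>i<J. g ((x(j := u)) i)) * (B - c ((x(j := u)) j))) \<partial>PiM ({..<J} - {j}) (\<lambda>_. M)) \<partial>M)"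
      using j M by (intro nn_integral_PiM_extract) (auto intro!: borel_measurable_times borel_measurable_divide borel_measurable_sum)
    also have "\<dots> = (\<integral>\<^sup>+u. ennreal (g u * (B - c u)) * (\<integral>\<^sup>+x. ennreal (1 / (g u + (\<Sum>i\<in>{..<J} - {j}. g (x i)))) \<partial>PiM ({..<J} - {j}) (\<lambda>_. M)) \<partial>M)"
    proof (intro nn_integral_cong)
      fix u
      have S: "(\<Sum>i<J. g ((x(j := u)) i)) = g u + (\<Sum>i\<in>{..<J} - {j}. g (x i))" for x
        using j by (subst sum.remove[of _ j]) auto
      show "(\<integral>\<^sup>+x. ennreal (g ((x(j := u)) j) / (\<Sum>i<J. g ((x(j := u)) i)) * (B - c ((x(j := u)) j))) \<partial>PiM ({..<J} - {j}) (\<lambda>_. M))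
        = ennreal (g u * (B - c u)) * (\<integral>\<^sup>+x. ennreal (1 / (g u + (\<Sum>i\<in>{..<J} - {j}. g (x i)))) \<partial>PiM ({..<J} - {j}) (\<lambda>_. M))"
        unfolding S using g c
        by (subst nn_integral_cmult[symmetric])
           (auto intro!: nn_integral_cong borel_measurable_divide borel_measurable_sum simp: less_imp_le sum_nonneg add_nonneg_nonneg simp flip: ennreal_mult)
    qed
    also have "\<dots> \<ge> (\<integral>\<^sup>+u. ennreal (g u * (B - c u)) * ennreal (1 / (g u + (real J - 1))) \<partial>M)"
    proof (intro nn_integral_mono mult_left_mono)
      fix u
      have "(\<integral>\<^sup>+x. ennreal (\<Sum>i\<in>{..<J} - {j}. g (x i)) \<partial>PiM ({..<J} - {j}) (\<lambda>_. M))
        = (\<integral>\<^sup>+x. (\<Sum>i\<in>{..<J} - {j}. ennreal (g (x i))) \<partial>PiM ({..<J} - {j}) (\<lambda>_. M))"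
        using g by (intro nn_integral_cong) (simp add: less_imp_le)
      also have "\<dots> = (\<Sum>i\<in>{..<J} - {j}. \<integral>\<^sup>+x. ennreal (g (x i)) \<partial>PiM ({..<J} - {j}) (\<lambda>_. M))"
        by (intro nn_integral_sum) measurable
      also have "\<dots> = (\<Sum>i\<in>{..<J} - {j}. 1)"
        by (intro sum.cong refl, subst nn_integral_PiM_component[where M="\<lambda>_. M"]) (auto simp: M g1)
      also have "\<dots> = ennreal (real J - 1)"
        using j by (simp add: ennreal_of_nat_eq_real_of_nat of_nat_diff)
      finally show "ennreal (1 / (g u + (real J - 1))) \<le> (\<integral>\<^sup>+x. ennreal (1 / (g u + (\<Sum>i\<in>{..<J} - {j}. g (x i)))) \<partial>PiM ({..<J} - {j}) (\<lambda>_. M))"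
        using g j by (intro nn_integral_inverse_ge prob_space_PiM M) (auto simp: sum_nonneg less_imp_le)
    qed auto
    also (xtrans) have "(\<integral>\<^sup>+u. ennreal (g u * (B - c u)) * ennreal (1 / (g u + (real J - 1))) \<partial>M)
        \<ge> (\<integral>\<^sup>+u. ennreal (g u * (B - c u) * (1 / (g u + J))) \<partial>M)"
    proof (intro nn_integral_mono)
      fix u
      have "0 < g u + (real J - 1)" using g[of u] J by (simp add: add_pos_nonneg)
      then have "1 / (g u + J) \<le> 1 / (g u + (real J - 1))" by (intro divide_left_mono) auto
      moreover have "0 \<le> g u * (B - c u)" using g[of u] c by (simp add: less_imp_le)
      ultimately have "g u * (B - c u) * (1 / (g u + J)) \<le> g u * (B - c u) * (1 / (g u + (real J - 1)))"
        by (rule mult_left_mono)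
      then have "ennreal (g u * (B - c u) * (1 / (g u + J))) \<le> ennreal (g u * (B - c u) * (1 / (g u + (real J - 1))))"
        by (rule ennreal_leI)
      also have "\<dots> = ennreal (g u * (B - c u)) * ennreal (1 / (g u + (real J - 1)))"
        using \<open>0 < g u + (real J - 1)\<close> \<open>0 \<le> g u * (B - c u)\<close> by (intro ennreal_mult) auto
      finally show "ennreal (g u * (B - c u) * (1 / (g u + J))) \<le> ennreal (g u * (B - c u)) * ennreal (1 / (g u + (real J - 1)))" .
    qed
    finally (xtrans) show ?thesis .
  qed
  have LL': "?L \<le> ?L'"
  proof -
    have "?L = of_nat J * (\<integral>\<^sup>+u. ennreal (g u * (B - c u) * (1 / (g u + J))) \<partial>M)"
    proof -
      have "ennreal (g u * (B - c u) * (J / (g u + J))) = of_nat J * ennreal (g u * (B - c u) * (1 / (g u + J)))" for u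
      proof -
        have "0 \<le> g u * (B - c u) * (1 / (g u + J))" using g[of u] c by (simp add: less_imp_le)
        then show ?thesis
          by (subst ennreal_of_nat_eq_real_of_nat, subst ennreal_mult[symmetric]) (auto simp: mult_ac)
      qed
      then show ?thesis by (simp only:) (rule nn_integral_cmult, measurable)
    qed
    also have "\<dots> = (\<Sum>j<J. \<integral>\<^sup>+u. ennreal (g u * (B - c u) * (1 / (g u + J))) \<partial>M)"
      by simp
    also have "\<dots> \<le> (\<Sum>j<J. \<integral>\<^sup>+x. ennreal (g (x j) / (\<Sum>i<J. g (x i)) * (B - c (x j))) \<partial>?P)"
      by (intro sum_mono single) auto
    also have "\<dots> = ?L'" by (intro nn_integral_sum[symmetric]) measurable
    finally show ?thesis .
  qed
  have BLR: "ennreal B \<le> ?L + ?R"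
  proof -
    have "ennreal B = (\<integral>\<^sup>+u. ennreal (B * g u) \<partial>M)"
      using B g g1 by (simp add: ennreal_mult less_imp_le nn_integral_cmult)
    also have "\<dots> \<le> (\<integral>\<^sup>+u. ennreal (g u * (B - c u) * (J / (g u + J))) + (ennreal (g u * c u) + ennreal (B * (g u * min 1 (g u / J)))) \<partial>M)"
    proof (intro nn_integral_mono)
      fix u
      let ?k = "J / (g u + J)"
      have gu: "0 < g u" "0 \<le> c u" "c u \<le> B" using g c by auto
      \<comment> \<open>With \<open>x = g u / J\<close> this is
        \<open>(1 - x) * (1 + x) \<le> 1\<close>: the loss against ideal selection is at most
        \<open>min 1 x\<close>.\<close>
      have k: "1 - min 1 (g u / J) \<le> ?k" "?k \<le> 1" "0 \<le> ?k"
      proof -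
        have "1 - g u / J \<le> ?k"
        proof -
          have "(1 - g u / J) * (g u + J) = J - (g u)\<^sup>2 / J"
            using J by (simp add: algebra_simps power2_eq_square add_divide_distrib)
          also have "\<dots> \<le> J" by simp
          finally have "(1 - g u / J) * (g u + J) \<le> J" .
          then show ?thesis using gu J by (simp add: pos_le_divide_eq)
        qed
        then show "1 - min 1 (g u / J) \<le> ?k" using gu by (auto simp: min_def)
      qed (use gu in auto)
      have "B * g u - g u * c u - B * (g u * min 1 (g u / J)) \<le> g u * (B * (1 - min 1 (g u / J)) - c u)"
        by (simp add: algebra_simps)
      also have "\<dots> \<le> g u * (B * ?k - c u * ?k)"
        using gu k B mult_left_mono[OF k(1) B] mult_left_mono[OF k(2), of "c u"] by (intro mult_left_mono diff_mono) auto
      also have "\<dots> = g u * (B - c u) * ?k" by (simp add: algebra_simps)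
      finally show "ennreal (B * g u) \<le> ennreal (g u * (B - c u) * ?k) + (ennreal (g u * c u) + ennreal (B * (g u * min 1 (g u / J))))"
        using gu B J k by (simp flip: ennreal_plus add: ennreal_leI)
    qed
    also have "\<dots> = ?L + ?R"
      by (simp add: nn_integral_add)
    finally show ?thesis .
  qed
  \<comment> \<open>The argument is \<open>?A = B - ?L' \<le> B - ?L \<le> ?R\<close>. In
    \<open>ennreal\<close> the subtraction is replaced by adding the finite \<open>?L\<close> on
    both sides and cancelling it.\<close>
  have "?L \<le> ?A + ?L'" using LL' by (rule order_trans) simp
  then have "?L \<le> ennreal B" unfolding AL' .
  then have Lfin: "?L \<noteq> \<top>" by (auto simp: top_unique)
  have "?L + ?A \<le> ?A + ?L'" using LL' by (subst add.commute) (rule add_left_mono)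
  also have "\<dots> \<le> ?L + ?R" unfolding AL' by (rule BLR)
  finally have "?L + ?A \<le> ?L + ?R" .
  then have "?A \<le> ?R" using Lfin by (simp add: ennreal_add_left_cancel_le)
  also have "(\<integral>\<^sup>+u. ennreal (B * (g u * min 1 (g u / J))) \<partial>M) = ennreal B * (\<integral>\<^sup>+u. ennreal (g u * min 1 (g u / J)) \<partial>M)"
    using B g by (subst nn_integral_cmult[symmetric]) (auto simp: ennreal_mult less_imp_le)
  finally show ?thesis .
qed

text \<open>Turns measurability of an uncurried function into a composition rule that the
  \<open>measurable\<close> method can apply to curried arguments.\<close>

lemma measurable_case_prod2:
  "(\<lambda>(u, s). f u s) \<in> borel_measurable (A \<Otimes>\<^sub>M B) \<Longrightarrow> a \<in> measurable N A \<Longrightarrow> b \<in> measurable N B \<Longrightarrow>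
    (\<lambda>x. f (a x) (b x)) \<in> borel_measurable N"
  by (drule measurable_compose[OF measurable_Pair, rotated 2]) auto

lemma measurable_case_prod3:
  "(\<lambda>(u, s, z). f u s z) \<in> borel_measurable (A \<Otimes>\<^sub>M B \<Otimes>\<^sub>M C) \<Longrightarrow> a \<in> measurable N A \<Longrightarrow> b \<in> measurable N B \<Longrightarrow>
    c \<in> measurable N C \<Longrightarrow> (\<lambda>x. f (a x) (b x) (c x)) \<in> borel_measurable N"
  by (drule measurable_compose[OF measurable_Pair[OF _ measurable_Pair], rotated 3]) auto

text \<open>The probabilistic method: were the cost above the bound everywhere, the strict
  inequality would survive integration. It extracts fixed codebooks from random ones.\<close>

lemma (in prob_space) exists_le_nn_integral_bound:
  assumes "(\<integral>\<^sup>+x. f x \<partial>M) \<le> C" and [measurable]: "f \<in> borel_measurable M"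
  shows "\<exists>x\<in>space M. f x \<le> C"
proof (rule ccontr)
  assume "\<not> (\<exists>x\<in>space M. f x \<le> C)"
  then have *: "\<And>x. x \<in> space M \<Longrightarrow> C < f x" by auto
  then have "C \<noteq> \<top>" using not_empty by fastforce
  moreover have "\<not> (AE x in M. f x \<le> C)"
  proof
    assume "AE x in M. f x \<le> C"
    moreover have "AE x in M. C < f x" using * by (intro AE_I2)
    ultimately have "AE x in M. False" by eventually_elim auto
    then show False by simp
  qed
  ultimately have "(\<integral>\<^sup>+x. C \<partial>M) < (\<integral>\<^sup>+x. f x \<partial>M)"
    using * by (intro nn_integral_less) (auto simp: emeasure_space_1 less_imp_le)
  then show False using assms(1) by (simp add: emeasure_space_1)
qed

text \<open>
  \<open>S\<close> is the primary codebook, \<open>U m\<close> the bin of the cognitive message \<open>m\<close>, and \<open>w\<close> the likelihood ratio of \<open>u\<close> given \<open>s\<close>.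
  The costs \<open>c1\<close> and \<open>c2\<close> account for confusion with another primary codeword and with an entry of another bin.
\<close>

theorem random_binning_code_exists:
  fixes MU :: "'u measure" and MS :: "'s measure" and w c0 :: "'u \<Rightarrow> 's \<Rightarrow> real"
    and c1 :: "'u \<Rightarrow> 's \<Rightarrow> 's \<Rightarrow> ennreal" and c2 :: "'u \<Rightarrow> 's \<Rightarrow> 'u \<Rightarrow> ennreal"
    and Mp Mc :: "nat set" and J :: nat
  assumes MU: "prob_space MU" and MS: "prob_space MS"
    and w_meas: "(\<lambda>(u, s). w u s) \<in> borel_measurable (MU \<Otimes>\<^sub>M MS)"
    and c0_meas: "(\<lambda>(u, s). c0 u s) \<in> borel_measurable (MU \<Otimes>\<^sub>M MS)"
    and c1_meas: "(\<lambda>(u, s, s'). c1 u s s') \<in> borel_measurable (MU \<Otimes>\<^sub>M MS \<Otimes>\<^sub>M MS)"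
    and c2_meas: "(\<lambda>(u, s, u'). c2 u s u') \<in> borel_measurable (MU \<Otimes>\<^sub>M MS \<Otimes>\<^sub>M MU)"
    and w: "\<And>u s. 0 < w u s" and w1: "\<And>s. s \<in> space MS \<Longrightarrow> (\<integral>\<^sup>+u. ennreal (w u s) \<partial>MU) = 1"
    and c0: "\<And>u s. 0 \<le> c0 u s" "\<And>u s. c0 u s \<le> B"
    and c1: "\<And>u s. u \<in> space MU \<Longrightarrow> s \<in> space MS \<Longrightarrow> (\<integral>\<^sup>+s'. c1 u s s' \<partial>MS) \<le> e1"
    and c2: "\<And>u s. u \<in> space MU \<Longrightarrow> s \<in> space MS \<Longrightarrow> (\<integral>\<^sup>+u'. c2 u s u' \<partial>MU) \<le> e2"
    and fin: "finite Mp" "finite Mc" and J: "0 < J"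
  obtains S U sel where "\<And>m. m \<in> Mp \<Longrightarrow> S m \<in> space MS"
    "\<And>m j. m \<in> Mc \<Longrightarrow> j < J \<Longrightarrow> U m j \<in> space MU" "\<And>mp mc. sel mp mc < J"
    "(\<Sum>mp\<in>Mp. \<Sum>mc\<in>Mc. ennreal (c0 (U mc (sel mp mc)) (S mp))
        + (\<Sum>m\<in>Mp - {mp}. c1 (U mc (sel mp mc)) (S mp) (S m))
        + (\<Sum>m\<in>Mc - {mc}. \<Sum>j<J. c2 (U mc (sel mp mc)) (S mp) (U m j)))
      \<le> of_nat (card Mp * card Mc) *
        ((\<integral>\<^sup>+s. (\<integral>\<^sup>+u. ennreal (w u s * c0 u s) \<partial>MU) \<partial>MS)
         + ennreal B * (\<integral>\<^sup>+s. (\<integral>\<^sup>+u. ennreal (w u s * min 1 (w u s / J)) \<partial>MU) \<partial>MS)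
         + of_nat (card Mp - 1) * e1 + of_nat ((card Mc - 1) * J) * e2)"
proof -
  interpret MU: prob_space MU by fact
  interpret MS: prob_space MS by fact
  define CB where "CB = PiM {..<J} (\<lambda>_. MU)"
  define SS where "SS = PiM Mp (\<lambda>_. MS)"
  define UU where "UU = PiM Mc (\<lambda>_. CB)"
  have CB: "prob_space CB" unfolding CB_def by (intro prob_space_PiM MU)
  interpret CB: prob_space CB by fact
  interpret SS: prob_space SS unfolding SS_def by (intro prob_space_PiM MS)
  interpret UU: prob_space UU unfolding UU_def by (intro prob_space_PiM CB)
  note w_m[measurable] = measurable_case_prod2[OF w_meas] and c0_m[measurable] = measurable_case_prod2[OF c0_meas]
    and c1_m[measurable] = measurable_case_prod3[OF c1_meas] and c2_m[measurable] = measurable_case_prod3[OF c2_meas]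
  have cmp1: "(\<lambda>x. f x j) \<in> measurable N MU" if "j < J" "f \<in> measurable N CB" for f j and N :: "'n measure"
    using measurable_compose[OF that(2)[unfolded CB_def] measurable_component_singleton] that(1) by simp
  have cmp2: "(\<lambda>x. f x m) \<in> measurable N MS" if "m \<in> Mp" "f \<in> measurable N SS" for f m and N :: "'n measure"
    using measurable_compose[OF that(2)[unfolded SS_def] measurable_component_singleton] that(1) by simp
  have cmp3: "(\<lambda>x. f x m) \<in> measurable N CB" if "m \<in> Mc" "f \<in> measurable N UU" for f m and N :: "'n measure"
    using measurable_compose[OF that(2)[unfolded UU_def] measurable_component_singleton] that(1) by simp

  \<comment> \<open>The probability of selecting member \<open>j\<close> of the bin \<open>x\<close>
    given \<open>s\<close>; \<open>F0\<close>, \<open>F1\<close> and \<open>F2\<close> are the costs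
    averaged over this choice.\<close>
  define wt where "wt x s j = ennreal (w (x j) s / (\<Sum>i<J. w (x i) s))" for x s j
  have wt_meas[measurable]: "(\<lambda>x. wt (f x) (g x) j) \<in> borel_measurable N"
    if [measurable]: "f \<in> measurable N CB" "g \<in> measurable N MS" and [simp]: "j < J" for f g j and N :: "'n measure"
    unfolding wt_def
    by (intro measurable_compose[OF _ measurable_ennreal] borel_measurable_divide borel_measurable_sum) (auto intro!: cmp1 w_m c0_m c1_m c2_m)
  have wt_sum: "(\<Sum>j<J. wt x s j) = 1" for x s
  proof -
    have pos: "0 < (\<Sum>i<J. w (x i) s)" using J w by (intro sum_pos) auto
    have "(\<Sum>j<J. wt x s j) = ennreal (\<Sum>j<J. w (x j) s / (\<Sum>i<J. w (x i) s))"
      unfolding wt_def using w pos by (intro sum_ennreal) (simp add: less_imp_le)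
    also have "(\<Sum>j<J. w (x j) s / (\<Sum>i<J. w (x i) s)) = 1"
      using pos by (simp flip: sum_divide_distrib)
    finally show ?thesis by simp
  qed

  define F0 where "F0 x s = (\<Sum>j<J. wt x s j * ennreal (c0 (x j) s))" for x s
  define F1 where "F1 x s s' = (\<Sum>j<J. wt x s j * c1 (x j) s s')" for x s s'
  define F2 where "F2 x s x' = (\<Sum>j<J. wt x s j * (\<Sum>j'<J. c2 (x j) s (x' j')))" for x s x'
  have F0_m[measurable]: "(\<lambda>x. F0 (f x) (g x)) \<in> borel_measurable N"
    if [measurable]: "f \<in> measurable N CB" "g \<in> measurable N MS" for f g and N :: "'n measure"
    unfolding F0_def
    proof (intro borel_measurable_sum)
      fix j assume "j \<in> {..<J}"
      then have j: "j < J" by simp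
      note [measurable] = wt_meas[OF _ _ j] cmp1[OF j]
      show "(\<lambda>x. wt (f x) (g x) j * ennreal (c0 (f x j) (g x))) \<in> borel_measurable N" by measurable
    qed
  have F1_m[measurable]: "(\<lambda>x. F1 (f x) (g x) (h x)) \<in> borel_measurable N"
    if [measurable]: "f \<in> measurable N CB" "g \<in> measurable N MS" "h \<in> measurable N MS" for f g h and N :: "'n measure"
    unfolding F1_def
    proof (intro borel_measurable_sum)
      fix j assume "j \<in> {..<J}"
      then have j: "j < J" by simp
      note [measurable] = wt_meas[OF _ _ j] cmp1[OF j]
      show "(\<lambda>x. wt (f x) (g x) j * c1 (f x j) (g x) (h x)) \<in> borel_measurable N" by measurable
    qed
  have F2_m[measurable]: "(\<lambda>x. F2 (f x) (g x) (h x)) \<in> borel_measurable N"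
    if [measurable]: "f \<in> measurable N CB" "g \<in> measurable N MS" "h \<in> measurable N CB" for f g h and N :: "'n measure"
    unfolding F2_def
    proof (intro borel_measurable_sum)
      fix j assume "j \<in> {..<J}"
      then have j: "j < J" by simp
      note [measurable] = wt_meas[OF _ _ j] cmp1[OF j]
      have [measurable]: "(\<lambda>x. \<Sum>j'<J. c2 (f x j) (g x) (h x j')) \<in> borel_measurable N"
        using j by (intro borel_measurable_sum c2_m cmp1) auto
      show "(\<lambda>x. wt (f x) (g x) j * (\<Sum>j'<J. c2 (f x j) (g x) (h x j'))) \<in> borel_measurable N" by measurable
    qed
  define E0 where "E0 = (\<integral>\<^sup>+s. (\<integral>\<^sup>+u. ennreal (w u s * c0 u s) \<partial>MU) \<partial>MS)
         + ennreal B * (\<integral>\<^sup>+s. (\<integral>\<^sup>+u. ennreal (w u s * min 1 (w u s / J)) \<partial>MU) \<partial>MS)"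

  have T0: "(\<integral>\<^sup>+S. (\<integral>\<^sup>+U. F0 (U mc) (S mp) \<partial>UU) \<partial>SS) \<le> E0" if m: "mp \<in> Mp" "mc \<in> Mc" for mp mc
  proof -
    have "(\<integral>\<^sup>+S. (\<integral>\<^sup>+U. F0 (U mc) (S mp) \<partial>UU) \<partial>SS) = (\<integral>\<^sup>+S. (\<integral>\<^sup>+x. F0 x (S mp) \<partial>CB) \<partial>SS)"
    proof (intro nn_integral_cong)
      fix S assume "S \<in> space SS"
      then have [measurable]: "S mp \<in> space MS" using m by (auto simp: SS_def space_PiM)
      show "(\<integral>\<^sup>+U. F0 (U mc) (S mp) \<partial>UU) = (\<integral>\<^sup>+x. F0 x (S mp) \<partial>CB)"
        unfolding UU_def using m fin CB by (intro nn_integral_PiM_component[where M="\<lambda>_. CB"]) auto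
    qed
    also have "\<dots> = (\<integral>\<^sup>+s. (\<integral>\<^sup>+x. F0 x s \<partial>CB) \<partial>MS)"
      unfolding SS_def using m fin MS
      by (intro nn_integral_PiM_component[where M="\<lambda>_. MS" and f="\<lambda>s. \<integral>\<^sup>+x. F0 x s \<partial>CB"]) auto
    also have "\<dots> \<le> (\<integral>\<^sup>+s. (\<integral>\<^sup>+u. ennreal (w u s * c0 u s) \<partial>MU) + ennreal B * (\<integral>\<^sup>+u. ennreal (w u s * min 1 (w u s / J)) \<partial>MU) \<partial>MS)"
    proof (intro nn_integral_mono)
      fix s assume s[measurable]: "s \<in> space MS"
      have "F0 x s = (\<Sum>j<J. ennreal (w (x j) s / (\<Sum>i<J. w (x i) s) * c0 (x j) s))" for x
        unfolding F0_def wt_def using w c0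
        by (intro sum.cong refl ennreal_mult[symmetric] divide_nonneg_nonneg sum_nonneg) (auto simp: less_imp_le)
      then show "(\<integral>\<^sup>+x. F0 x s \<partial>CB) \<le> (\<integral>\<^sup>+u. ennreal (w u s * c0 u s) \<partial>MU) + ennreal B * (\<integral>\<^sup>+u. ennreal (w u s * min 1 (w u s / J)) \<partial>MU)"
        unfolding CB_def using likelihood_selection_cost_le[OF MU, of "\<lambda>u. w u s" "\<lambda>u. c0 u s" B J] w c0 w1[OF s] J
        by simp
    qed
    also have "\<dots> = E0" unfolding E0_def by (simp add: nn_integral_add nn_integral_cmult)
    finally show ?thesis .
  qed
  \<comment> \<open>The selection involves only \<open>S mp\<close>, so \<open>S m\<close> is
    independent of the selected entry. Exchanging integrals makes the one over \<open>s'\<close>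
    innermost, where the hypothesis on \<open>c1\<close> applies to each entry of the bin.\<close>
  have T1: "(\<integral>\<^sup>+S. (\<integral>\<^sup>+U. F1 (U mc) (S mp) (S m) \<partial>UU) \<partial>SS) \<le> e1"
    if m: "mp \<in> Mp" "mc \<in> Mc" "m \<in> Mp" "m \<noteq> mp" for mp mc m
  proof -
    have "(\<integral>\<^sup>+S. (\<integral>\<^sup>+U. F1 (U mc) (S mp) (S m) \<partial>UU) \<partial>SS) = (\<integral>\<^sup>+S. (\<integral>\<^sup>+x. F1 x (S mp) (S m) \<partial>CB) \<partial>SS)"
    proof (intro nn_integral_cong)
      fix S assume "S \<in> space SS"
      then have [measurable]: "S mp \<in> space MS" "S m \<in> space MS" using m by (auto simp: SS_def space_PiM)
      show "(\<integral>\<^sup>+U. F1 (U mc) (S mp) (S m) \<partial>UU) = (\<integral>\<^sup>+x. F1 x (S mp) (S m) \<partial>CB)"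
        unfolding UU_def using m fin CB by (intro nn_integral_PiM_component[where M="\<lambda>_. CB"]) auto
    qed
    also have "\<dots> = (\<integral>\<^sup>+s. (\<integral>\<^sup>+s'. (\<integral>\<^sup>+x. F1 x s s' \<partial>CB) \<partial>MS) \<partial>MS)"
      unfolding SS_def using m fin MS
      by (intro nn_integral_PiM_two_components[where M="\<lambda>_. MS" and f="\<lambda>s s'. \<integral>\<^sup>+x. F1 x s s' \<partial>CB"]) auto
    also have "\<dots> \<le> (\<integral>\<^sup>+s. e1 \<partial>MS)"
    proof (intro nn_integral_mono)
      fix s assume s[measurable]: "s \<in> space MS"
      interpret pair_sigma_finite MS CB ..
      have "(\<integral>\<^sup>+s'. (\<integral>\<^sup>+x. F1 x s s' \<partial>CB) \<partial>MS) = (\<integral>\<^sup>+x. (\<integral>\<^sup>+s'. F1 x s s' \<partial>MS) \<partial>CB)"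
        by (rule Fubini'[symmetric]) measurable
      also have "\<dots> \<le> (\<integral>\<^sup>+x. e1 \<partial>CB)"
      proof (intro nn_integral_mono)
        fix x assume x: "x \<in> space CB"
        then have xj[measurable]: "x j \<in> space MU" if "j < J" for j using that by (auto simp: CB_def space_PiM)
        have "(\<integral>\<^sup>+s'. F1 x s s' \<partial>MS) = (\<Sum>j<J. wt x s j * (\<integral>\<^sup>+s'. c1 (x j) s s' \<partial>MS))"
          unfolding F1_def using xj by (subst nn_integral_sum) (auto intro!: sum.cong nn_integral_cmult)
        also have "\<dots> \<le> (\<Sum>j<J. wt x s j * e1)"
          using xj s by (intro sum_mono mult_left_mono c1) auto
        also have "\<dots> = e1" by (simp add: wt_sum flip: sum_distrib_right)
        finally show "(\<integral>\<^sup>+s'. F1 x s s' \<partial>MS) \<le> e1" .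
      qed
      finally show "(\<integral>\<^sup>+s'. (\<integral>\<^sup>+x. F1 x s s' \<partial>CB) \<partial>MS) \<le> e1" by (simp add: CB.emeasure_space_1)
    qed
    finally show ?thesis by (simp add: MS.emeasure_space_1)
  qed
  \<comment> \<open>The other bins are independent of the selected entry, but all \<open>J\<close>
    members of such a bin can be confused with it, hence the factor \<open>J\<close>.\<close>
  have T2: "(\<integral>\<^sup>+S. (\<integral>\<^sup>+U. F2 (U mc) (S mp) (U m) \<partial>UU) \<partial>SS) \<le> of_nat J * e2"
    if m: "mp \<in> Mp" "mc \<in> Mc" "m \<in> Mc" "m \<noteq> mc" for mp mc m
  proof -
    have "(\<integral>\<^sup>+S. (\<integral>\<^sup>+U. F2 (U mc) (S mp) (U m) \<partial>UU) \<partial>SS) \<le> (\<integral>\<^sup>+S. of_nat J * e2 \<partial>SS)"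
    proof (intro nn_integral_mono)
      fix S assume "S \<in> space SS"
      then have s[measurable]: "S mp \<in> space MS" using m by (auto simp: SS_def space_PiM)
      have "(\<integral>\<^sup>+U. F2 (U mc) (S mp) (U m) \<partial>UU) = (\<integral>\<^sup>+x. (\<integral>\<^sup>+x'. F2 x (S mp) x' \<partial>CB) \<partial>CB)"
        unfolding UU_def using m fin CB
        by (intro nn_integral_PiM_two_components[where M="\<lambda>_. CB" and f="\<lambda>x x'. F2 x (S mp) x'"]) auto
      also have "\<dots> \<le> (\<integral>\<^sup>+x. of_nat J * e2 \<partial>CB)"
      proof (intro nn_integral_mono)
        fix x assume x: "x \<in> space CB"
        then have xj[measurable]: "x j \<in> space MU" if "j < J" for j using that by (auto simp: CB_def space_PiM)
        have c2j: "(\<integral>\<^sup>+x'. c2 (x j) (S mp) (x' j') \<partial>CB) \<le> e2" if j: "j < J" "j' < J" for j j'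
        proof -
          have "(\<integral>\<^sup>+x'. c2 (x j) (S mp) (x' j') \<partial>CB) = (\<integral>\<^sup>+u'. c2 (x j) (S mp) u' \<partial>MU)"
            unfolding CB_def using j MU xj by (intro nn_integral_PiM_component[where M="\<lambda>_. MU"]) auto
          then show ?thesis using c2 xj s j by simp
        qed
        have m1[measurable]: "(\<lambda>x'. c2 (x j) (S mp) (x' j')) \<in> borel_measurable CB" if "j < J" "j' < J" for j j'
          using that xj s cmp1[of j' "\<lambda>x'. x'" CB] by (intro c2_m) auto
        have m2: "(\<lambda>x'. \<Sum>j'<J. c2 (x j) (S mp) (x' j')) \<in> borel_measurable CB" if "j < J" for j
          using that by (intro borel_measurable_sum m1) auto
        have "(\<integral>\<^sup>+x'. F2 x (S mp) x' \<partial>CB) = (\<Sum>j<J. \<integral>\<^sup>+x'. wt x (S mp) j * (\<Sum>j'<J. c2 (x j) (S mp) (x' j')) \<partial>CB)"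
          unfolding F2_def using m2 by (intro nn_integral_sum borel_measurable_times_ennreal) auto
        also have "\<dots> = (\<Sum>j<J. wt x (S mp) j * (\<integral>\<^sup>+x'. (\<Sum>j'<J. c2 (x j) (S mp) (x' j')) \<partial>CB))"
          using m2 by (intro sum.cong refl nn_integral_cmult) auto
        also have "\<dots> = (\<Sum>j<J. wt x (S mp) j * (\<Sum>j'<J. \<integral>\<^sup>+x'. c2 (x j) (S mp) (x' j') \<partial>CB))"
          using m1 by (intro sum.cong refl arg_cong2[of _ _ _ _ "(*)"] nn_integral_sum) auto
        also have "\<dots> \<le> (\<Sum>j<J. wt x (S mp) j * (\<Sum>j'<J. e2))"
          by (intro sum_mono mult_left_mono c2j) auto
        also have "\<dots> = of_nat J * e2" by (simp add: wt_sum flip: sum_distrib_right)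
        finally show "(\<integral>\<^sup>+x'. F2 x (S mp) x' \<partial>CB) \<le> of_nat J * e2" .
      qed
      finally show "(\<integral>\<^sup>+U. F2 (U mc) (S mp) (U m) \<partial>UU) \<le> of_nat J * e2" by (simp add: CB.emeasure_space_1)
    qed
    then show ?thesis by (simp add: SS.emeasure_space_1)
  qed

  define cbar where "cbar S U mp mc = F0 (U mc) (S mp) + (\<Sum>m\<in>Mp - {mp}. F1 (U mc) (S mp) (S m))
      + (\<Sum>m\<in>Mc - {mc}. F2 (U mc) (S mp) (U m))" for S U mp mc
  define Bd where "Bd = E0 + of_nat (card Mp - 1) * e1 + of_nat ((card Mc - 1) * J) * e2"
  have cbar_meas: "(\<lambda>x. cbar (f x) (g x) mp mc) \<in> borel_measurable N"
    if "f \<in> measurable N SS" "g \<in> measurable N UU" "mp \<in> Mp" "mc \<in> Mc" for f g mp mc and N :: "'n measure"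
  proof -
    have [measurable]: "(\<lambda>x. f x mp) \<in> measurable N MS" "(\<lambda>x. g x mc) \<in> measurable N CB"
      "\<And>m. m \<in> Mp - {mp} \<Longrightarrow> (\<lambda>x. f x m) \<in> measurable N MS" "\<And>m. m \<in> Mc - {mc} \<Longrightarrow> (\<lambda>x. g x m) \<in> measurable N CB"
      using that by (auto intro: cmp2 cmp3)
    show ?thesis unfolding cbar_def by measurable
  qed
  have cbar_int: "(\<integral>\<^sup>+S. (\<integral>\<^sup>+U. cbar S U mp mc \<partial>UU) \<partial>SS) \<le> Bd" if m: "mp \<in> Mp" "mc \<in> Mc" for mp mc
  proof -
    have [measurable]: "(\<lambda>x. f x m) \<in> measurable N MS" if "m \<in> Mp - {mp}" "f \<in> measurable N SS" for f m and N :: "'n measure"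
      using that cmp2 by auto
    have [measurable]: "(\<lambda>x. f x m) \<in> measurable N CB" if "m \<in> Mc - {mc}" "f \<in> measurable N UU" for f m and N :: "'n measure"
      using that cmp3 by auto
    have [measurable]: "(\<lambda>x. f x mp) \<in> measurable N MS" if "f \<in> measurable N SS" for f and N :: "'n measure"
      using that m cmp2 by auto
    have [measurable]: "(\<lambda>x. f x mc) \<in> measurable N CB" if "f \<in> measurable N UU" for f and N :: "'n measure"
      using that m cmp3 by auto
    have "(\<integral>\<^sup>+S. (\<integral>\<^sup>+U. cbar S U mp mc \<partial>UU) \<partial>SS)
       = (\<integral>\<^sup>+S. ((\<integral>\<^sup>+U. F0 (U mc) (S mp) \<partial>UU) + (\<Sum>m\<in>Mp - {mp}. \<integral>\<^sup>+U. F1 (U mc) (S mp) (S m) \<partial>UU)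
          + (\<Sum>m\<in>Mc - {mc}. \<integral>\<^sup>+U. F2 (U mc) (S mp) (U m) \<partial>UU)) \<partial>SS)"
    proof (intro nn_integral_cong)
      fix S assume S: "S \<in> space SS"
      then have [measurable]: "S mp \<in> space MS" using m by (auto simp: SS_def space_PiM)
      have Sm[measurable]: "S m \<in> space MS" if "m \<in> Mp - {mp}" for m using S that by (auto simp: SS_def space_PiM)
      show "(\<integral>\<^sup>+U. cbar S U mp mc \<partial>UU) = (\<integral>\<^sup>+U. F0 (U mc) (S mp) \<partial>UU) + (\<Sum>m\<in>Mp - {mp}. \<integral>\<^sup>+U. F1 (U mc) (S mp) (S m) \<partial>UU)
          + (\<Sum>m\<in>Mc - {mc}. \<integral>\<^sup>+U. F2 (U mc) (S mp) (U m) \<partial>UU)"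
        unfolding cbar_def by (simp add: nn_integral_add nn_integral_sum)
    qed
    also have "\<dots> = (\<integral>\<^sup>+S. (\<integral>\<^sup>+U. F0 (U mc) (S mp) \<partial>UU) \<partial>SS) + (\<Sum>m\<in>Mp - {mp}. \<integral>\<^sup>+S. (\<integral>\<^sup>+U. F1 (U mc) (S mp) (S m) \<partial>UU) \<partial>SS)
          + (\<Sum>m\<in>Mc - {mc}. \<integral>\<^sup>+S. (\<integral>\<^sup>+U. F2 (U mc) (S mp) (U m) \<partial>UU) \<partial>SS)"
      by (simp add: nn_integral_add nn_integral_sum)
    also have "\<dots> \<le> E0 + (\<Sum>m\<in>Mp - {mp}. e1) + (\<Sum>m\<in>Mc - {mc}. of_nat J * e2)"
      using m by (intro add_mono sum_mono T0 T1 T2) auto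
    also have "\<dots> = Bd" unfolding Bd_def using m fin by (simp add: mult.assoc)
    finally show ?thesis .
  qed
  have tot: "(\<integral>\<^sup>+S. (\<integral>\<^sup>+U. (\<Sum>mp\<in>Mp. \<Sum>mc\<in>Mc. cbar S U mp mc) \<partial>UU) \<partial>SS) \<le> of_nat (card Mp * card Mc) * Bd"
  proof -
    have "(\<integral>\<^sup>+S. (\<integral>\<^sup>+U. (\<Sum>mp\<in>Mp. \<Sum>mc\<in>Mc. cbar S U mp mc) \<partial>UU) \<partial>SS)
       = (\<integral>\<^sup>+S. (\<Sum>mp\<in>Mp. \<Sum>mc\<in>Mc. \<integral>\<^sup>+U. cbar S U mp mc \<partial>UU) \<partial>SS)"
    proof (intro nn_integral_cong)
      fix S assume S: "S \<in> space SS"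
      have "(\<lambda>U. cbar S U mp mc) \<in> borel_measurable UU" if "mp \<in> Mp" "mc \<in> Mc" for mp mc
        using that S by (intro cbar_meas) auto
      then show "(\<integral>\<^sup>+U. (\<Sum>mp\<in>Mp. \<Sum>mc\<in>Mc. cbar S U mp mc) \<partial>UU) = (\<Sum>mp\<in>Mp. \<Sum>mc\<in>Mc. \<integral>\<^sup>+U. cbar S U mp mc \<partial>UU)"
        by (simp add: nn_integral_sum)
    qed
    also have "\<dots> = (\<Sum>mp\<in>Mp. \<Sum>mc\<in>Mc. \<integral>\<^sup>+S. (\<integral>\<^sup>+U. cbar S U mp mc \<partial>UU) \<partial>SS)"
    proof -
      have "(\<lambda>S. \<integral>\<^sup>+U. cbar S U mp mc \<partial>UU) \<in> borel_measurable SS" if "mp \<in> Mp" "mc \<in> Mc" for mp mc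
        using that by (intro UU.borel_measurable_nn_integral) (auto simp: split_def intro!: cbar_meas)
      then show ?thesis by (simp add: nn_integral_sum)
    qed
    also have "\<dots> \<le> (\<Sum>mp\<in>Mp. \<Sum>mc\<in>Mc. Bd)" by (intro sum_mono cbar_int)
    also have "\<dots> = of_nat (card Mp * card Mc) * Bd" by (simp add: mult.assoc)
    finally show ?thesis .
  qed
  have sum_meas: "(\<lambda>x. \<Sum>mp\<in>Mp. \<Sum>mc\<in>Mc. cbar (f x) (g x) mp mc) \<in> borel_measurable N"
    if "f \<in> measurable N SS" "g \<in> measurable N UU" for f g and N :: "'n measure"
    using that by (intro borel_measurable_sum cbar_meas)
  have int_meas: "(\<lambda>S. \<integral>\<^sup>+U. (\<Sum>mp\<in>Mp. \<Sum>mc\<in>Mc. cbar S U mp mc) \<partial>UU) \<in> borel_measurable SS"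
    by (intro UU.borel_measurable_nn_integral) (auto simp: split_def intro!: sum_meas)
  \<comment> \<open>The primary codebook is fixed first and then the bins for it, each time at no
    more than the mean cost.\<close>
  obtain S where S: "S \<in> space SS" "(\<integral>\<^sup>+U. (\<Sum>mp\<in>Mp. \<Sum>mc\<in>Mc. cbar S U mp mc) \<partial>UU) \<le> of_nat (card Mp * card Mc) * Bd"
    using SS.exists_le_nn_integral_bound[OF tot int_meas] by blast
  obtain U where U: "U \<in> space UU" "(\<Sum>mp\<in>Mp. \<Sum>mc\<in>Mc. cbar S U mp mc) \<le> of_nat (card Mp * card Mc) * Bd"
    using UU.exists_le_nn_integral_bound[OF S(2) sum_meas] S(1) by auto
  define cost where "cost mp mc j = ennreal (c0 (U mc j) (S mp))
        + (\<Sum>m\<in>Mp - {mp}. c1 (U mc j) (S mp) (S m))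
        + (\<Sum>m\<in>Mc - {mc}. \<Sum>j'<J. c2 (U mc j) (S mp) (U m j'))" for mp mc j
  have cbar_cost: "cbar S U mp mc = (\<Sum>j<J. wt (U mc) (S mp) j * cost mp mc j)" for mp mc
    unfolding cbar_def F0_def F1_def F2_def cost_def
    by (simp only: distrib_left sum.distrib sum_distrib_left)
       (intro arg_cong2[of _ _ _ _ "(+)"] refl sum.swap)
  \<comment> \<open>With the codebooks fixed, the random selection is replaced by the cheapest
    member of the bin, which costs at most the \<open>wt\<close>-average. This makes the encoder
    deterministic.\<close>
  have ex: "\<exists>j<J. cost mp mc j \<le> cbar S U mp mc" for mp mc
  proof -
    define c where "c = Min (cost mp mc ` {..<J})"
    have "c \<in> cost mp mc ` {..<J}" unfolding c_def using J by (intro Min_in) auto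
    then obtain j where j: "j < J" "c = cost mp mc j" by auto
    have "c = (\<Sum>j<J. wt (U mc) (S mp) j * c)" by (simp add: wt_sum flip: sum_distrib_right)
    also have "\<dots> \<le> cbar S U mp mc"
      unfolding cbar_cost by (intro sum_mono mult_left_mono) (auto simp: c_def)
    finally show ?thesis using j by auto
  qed
  then obtain sel where sel: "\<And>mp mc. sel mp mc < J" "\<And>mp mc. cost mp mc (sel mp mc) \<le> cbar S U mp mc"
    by metis
  have "(\<Sum>mp\<in>Mp. \<Sum>mc\<in>Mc. cost mp mc (sel mp mc)) \<le> of_nat (card Mp * card Mc) * Bd"
    by (intro order_trans[OF _ U(2)] sum_mono sel(2))
  then show ?thesis
    using S(1) U(1) sel(1) unfolding cost_def Bd_def E0_def
    by (intro that[of S U sel]) (auto simp: SS_def UU_def CB_def space_PiM PiE_iff add.assoc)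
qed

section \<open>Positive definite complex matrices\<close>

text \<open>Conjugate-linear in its first argument. \<open>psd\<close> contains
  \<open>cip x (A *v x)\<close> in unfolded form, and the real part is the inner product of the
  underlying real vector space.\<close>

definition cip :: "complex^'n \<Rightarrow> complex^'n \<Rightarrow> complex" where
  "cip x y = (\<Sum>i\<in>UNIV. cnj (x $ i) * y $ i)"

lemma Re_cip: "Re (cip x y) = x \<bullet> y"
  by (simp add: cip_def inner_vec_def inner_complex_def)

lemma cip_commute: "cip y x = cnj (cip x y)"
  by (simp add: cip_def mult.commute)

lemma cip_diff_right: "cip x (y - z) = cip x y - cip x z"
  by (simp add: cip_def right_diff_distrib sum_subtractf)

lemma cip_scale_right: "cip x (c *s y) = c * cip x y"
  by (simp add: cip_def sum_distrib_left mult_ac)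

lemma cip_cadj: "cip x (A *v y) = cip (cadj A *v x) y"
proof -
  have "cip x (A *v y) = (\<Sum>i\<in>UNIV. \<Sum>j\<in>UNIV. cnj (x $ i) * (A $ i $ j * y $ j))"
    by (simp add: cip_def matrix_vector_mult_def sum_distrib_left)
  also have "\<dots> = (\<Sum>j\<in>UNIV. \<Sum>i\<in>UNIV. cnj (x $ i) * (A $ i $ j * y $ j))"
    by (rule sum.swap)
  also have "\<dots> = cip (cadj A *v x) y"
    by (simp add: cip_def matrix_vector_mult_def cadj_def sum_distrib_left sum_distrib_right mult_ac)
  finally show ?thesis .
qed

lemma inner_cadj: "x \<bullet> (A *v y) = (cadj A *v x) \<bullet> (y :: complex^'n)"
  by (metis Re_cip cip_cadj)

lemma cadj_cadj [simp]: "cadj (cadj A) = A"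
  by (simp add: cadj_def vec_eq_iff)

lemma cadj_mult: "cadj (A ** B) = cadj B ** cadj A"
  by (simp add: cadj_def vec_eq_iff matrix_matrix_mult_def mult.commute)

lemma cadj_mat_1 [simp]: "cadj (mat 1) = mat 1"
  by (auto simp: cadj_def vec_eq_iff mat_def)

lemma inner_vector_scalar_mult: "(c *s a) \<bullet> b = Re (cnj c * cip a b)"
  by (simp add: Re_cip[symmetric] cip_def sum_distrib_left mult.assoc)

lemma matrix_vector_mult_scale: "A *v (c *s x) = c *s (A *v x)" for A :: "complex^'n^'m"
  by (simp add: vec_eq_iff matrix_vector_mult_def sum_distrib_left mult_ac)

lemma scaleR_mult_vec: "(c *\<^sub>R A) *v x = c *\<^sub>R (A *v x)" for A :: "complex^'n^'m"
  by (simp add: vec_eq_iff matrix_vector_mult_def scaleR_sum_right)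

lemma outer_mult_vec: "outer a b *v x = cip b x *s a"
  by (simp add: vec_eq_iff outer_def matrix_vector_mult_def cip_def sum_distrib_left sum_distrib_right mult_ac)

lemma matrix_mult_outer: "A ** outer a b = outer (A *v a) b"
  by (simp add: outer_def vec_eq_iff matrix_matrix_mult_def matrix_vector_mult_def sum_distrib_left sum_distrib_right mult_ac)

lemma mult_cadj_eq_sum_outer: "A ** cadj A = (\<Sum>j\<in>UNIV. outer (column j A) (column j A))"
  by (simp add: vec_eq_iff outer_def matrix_matrix_mult_def cadj_def column_def)

text \<open>The matrix determinant lemma. The rows of the identity are changed one at a time into
  rows of \<open>mat 1 + outer b a\<close>; linearity of the determinant in the changed row
  contributes one summand of \<open>cip a b\<close> per step.\<close>

lemma det_mat_1_plus_outer: "det (mat 1 + outer b a) = 1 + cip a b"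
  for a b :: "complex^'n"
proof -
  define w :: "complex^'n" where "w = (\<chi> j. cnj (a $ j))"
  define R where "R F i = (if i \<in> F then axis i 1 + b $ i *s w else axis i 1)" for F i
  have "det (\<chi> i. R F i) = 1 + (\<Sum>i\<in>F. w $ i * b $ i)" if "finite F" for F
    using that
  proof (induction F)
    case empty
    have "(\<chi> i. R {} i) = mat 1" by (simp add: R_def vec_eq_iff mat_def axis_def)
    then show ?case by simp
  next
    case (insert k F)
    have 1: "(\<chi> i. R (insert k F) i) = (\<chi> i. if i = k then axis k 1 + b $ k *s w else R F i)"
      by (auto simp: R_def vec_eq_iff)
    have 2: "(\<chi> i. if i = k then axis k 1 else R F i) = (\<chi> i. R F i)"
      using insert by (auto simp: R_def vec_eq_iff)
    \<comment> \<open>Once row \<open>k\<close> is \<open>w\<close>, the multiples of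
      \<open>w\<close> in the other rows can be removed by row operations, and against rows of the
      identity only entry \<open>k\<close> of \<open>w\<close> survives.\<close>
    have 3: "det (\<chi> i. if i = k then w else R G i) = w $ k" if "finite G" "k \<notin> G" for G
      using that
    proof (induction G)
      case empty
      have "det (\<chi> i. if i = k then w else axis i 1) = w $ k"
      proof -
        have "w = w $ k *s axis k 1 + (\<Sum>j\<in>UNIV - {k}. w $ j *s axis j 1)"
          by (simp add: vec_eq_iff axis_def if_distrib cong: if_cong)
        then have "det (\<chi> i. if i = k then w else axis i 1)
            = det (\<chi> i. if i = k then w $ k *s axis k 1 + (\<Sum>j\<in>UNIV - {k}. w $ j *s axis j 1) else axis i 1)"
          by (rule arg_cong[where f="\<lambda>v. det (\<chi> i. if i = k then v else axis i 1)"])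
        also have "\<dots> = det (\<chi> i. if i = k then row k (\<chi> i. if i = k then w $ k *s axis k 1 else axis i 1)
              + (\<Sum>j\<in>UNIV - {k}. w $ j *s axis j 1) else row i (\<chi> i. if i = k then w $ k *s axis k 1 else axis i 1))"
          by (intro arg_cong[where f=det]) (simp add: vec_eq_iff row_def)
        also have "\<dots> = det (\<chi> i. if i = k then w $ k *s axis k 1 else (axis i 1 :: complex^'n))"
          by (intro det_row_span vec.span_sum vec.span_scale vec.span_base) (auto simp: row_def vec_eq_iff)
        also have "\<dots> = w $ k * det (\<chi> i. if i = k then axis k 1 else (axis i 1 :: complex^'n))"
          by (rule det_row_mul)
        also have "(\<chi> i. if i = k then axis k 1 else (axis i 1 :: complex^'n)) = mat 1"
          by (auto simp: vec_eq_iff mat_def axis_def)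
        finally show ?thesis by simp
      qed
      then show ?case by (simp add: R_def cong: if_cong)
    next
      case (insert l G)
      then have lk: "l \<noteq> k" by auto
      let ?A = "\<chi> i. if i = k then w else R G i"
      have "(\<chi> i. if i = k then w else R (insert l G) i) = (\<chi> i. if i = l then row l ?A + b $ l *s row k ?A else row i ?A)"
        using insert lk by (auto simp: R_def vec_eq_iff row_def)
      then show ?case using det_row_operation[OF lk, of ?A "b $ l"] insert by simp
    qed
    show ?case
      unfolding 1 det_row_add det_row_mul 2 using insert 3[of F] by (simp add: algebra_simps)
  qed
  from this[of UNIV] have "det (\<chi> i. R UNIV i) = 1 + (\<Sum>i\<in>UNIV. w $ i * b $ i)" by simp
  moreover have "(\<chi> i. R UNIV i) = mat 1 + outer b a"
    by (auto simp: R_def vec_eq_iff outer_def w_def mat_def axis_def)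
  ultimately show ?thesis by (simp add: cip_def w_def)
qed

text \<open>\<open>N\<close> is invertible with positive semidefinite inverse \<open>L\<close> and determinant \<open>d > 0\<close>.\<close>

definition posinv :: "complex^'n^'n \<Rightarrow> complex^'n^'n \<Rightarrow> real \<Rightarrow> bool" where
  "posinv N L d \<longleftrightarrow> cadj L = L \<and> (\<forall>x. 0 \<le> x \<bullet> (L *v x)) \<and> N ** L = mat 1
     \<and> det N = complex_of_real d \<and> 0 < d"

lemma posinv_mat_1: "posinv (mat 1) (mat 1) 1"
  by (simp add: posinv_def)

lemma hermitian_cip_real:
  assumes "cadj L = L" shows "cip a (L *v a) = complex_of_real (a \<bullet> (L *v a))"
proof -
  have "cip a (L *v a) = cnj (cip a (L *v a))"
    using assms by (metis cip_cadj cip_commute)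
  then show ?thesis by (metis Re_cip Reals_cnj_iff of_real_Re)
qed

lemma hermitian_form_diff:
  assumes "cadj L = L"
  shows "(y - c *s a) \<bullet> (L *v (y - c *s a))
    = y \<bullet> (L *v y) - 2 * Re (cnj c * cip a (L *v y)) + (cmod c)\<^sup>2 * (a \<bullet> (L *v a))"
proof -
  have "y \<bullet> (L *v (c *s a)) = (c *s a) \<bullet> (L *v y)"
    using inner_cadj[of y L "c *s a"] assms by (simp add: inner_commute)
  moreover have "(c *s a) \<bullet> (L *v (c *s a)) = (cmod c)\<^sup>2 * (a \<bullet> (L *v a))"
  proof -
    have "(c *s a) \<bullet> (L *v (c *s a)) = Re (cnj c * (c * cip a (L *v a)))"
      unfolding matrix_vector_mult_scale inner_vector_scalar_mult
      by (simp add: cip_def sum_distrib_left mult_ac)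
    also have "cnj c * (c * cip a (L *v a)) = complex_of_real ((cmod c)\<^sup>2 * (a \<bullet> (L *v a)))"
      using hermitian_cip_real[OF assms, of a] complex_norm_square[of c] by (simp add: mult_ac)
    finally show ?thesis by simp
  qed
  ultimately show ?thesis
    by (simp add: matrix_vector_mult_diff_distrib inner_diff_left inner_diff_right inner_vector_scalar_mult)
qed

text \<open>The Sherman--Morrison formula.\<close>

definition rank_one_inv :: "complex^'n^'n \<Rightarrow> complex^'n \<Rightarrow> complex^'n^'n" where
  "rank_one_inv L a = L - (1 / (1 + a \<bullet> (L *v a))) *\<^sub>R outer (L *v a) (L *v a)"

lemma rank_one_inv_form:
  assumes "cadj L = L"
  shows "y \<bullet> (rank_one_inv L a *v y) = y \<bullet> (L *v y) - (cmod (cip a (L *v y)))\<^sup>2 / (1 + a \<bullet> (L *v a))"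
proof -
  have 1: "cip (L *v a) y = cip a (L *v y)" using assms by (metis cip_cadj)
  have "y \<bullet> (outer (L *v a) (L *v a) *v y) = Re (cnj (cip (L *v a) y) * cip (L *v a) y)"
    unfolding outer_mult_vec by (subst inner_commute) (simp add: inner_vector_scalar_mult)
  also have "\<dots> = (cmod (cip a (L *v y)))\<^sup>2"
    unfolding 1 using complex_norm_square[of "cip a (L *v y)"]
    by (metis Re_complex_of_real mult.commute of_real_power)
  finally show ?thesis
    by (simp add: rank_one_inv_def matrix_vector_mult_diff_rdistrib inner_diff_right scaleR_mult_vec)
qed

lemma posinv_rank_one:
  assumes "posinv N L d"
  shows "posinv (N + outer a a) (rank_one_inv L a) (d * (1 + a \<bullet> (L *v a)))"
proof -
  let ?l = "a \<bullet> (L *v a)"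
  have L: "cadj L = L" "\<And>x. 0 \<le> x \<bullet> (L *v x)" "N ** L = mat 1" "det N = complex_of_real d" "0 < d"
    using assms by (auto simp: posinv_def)
  have l: "0 \<le> ?l" by (rule L)
  have 1: "cadj (rank_one_inv L a) = rank_one_inv L a"
    using L(1) by (simp add: rank_one_inv_def vec_eq_iff cadj_def outer_def mult_ac)
  have 2: "0 \<le> y \<bullet> (rank_one_inv L a *v y)" for y
  proof -
    let ?b = "cip a (L *v y)"
    \<comment> \<open>The old form is evaluated at \<open>y - ?c *s a\<close>. Instead of the
      minimiser, which would divide by \<open>?l\<close>, this choice gives the denominator
      \<open>1 + ?l\<close> directly, and \<open>?l / (1 + ?l) \<le> 1\<close> absorbs the square
      term.\<close>
    let ?c = "?b / complex_of_real (1 + ?l)"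
    have c: "cnj ?c * ?b = complex_of_real ((cmod ?b)\<^sup>2 / (1 + ?l))"
      using complex_norm_square[of ?b] by (simp add: mult.commute)
    have "0 \<le> (y - ?c *s a) \<bullet> (L *v (y - ?c *s a))" by (rule L)
    also have "\<dots> = y \<bullet> (L *v y) - 2 * ((cmod ?b)\<^sup>2 / (1 + ?l)) + (cmod ?c)\<^sup>2 * ?l"
      unfolding hermitian_form_diff[OF L(1)] c by simp
    also have "(cmod ?c)\<^sup>2 * ?l = (cmod ?b)\<^sup>2 / (1 + ?l) * (?l / (1 + ?l))"
      using l by (simp add: norm_divide power_divide power2_eq_square del: of_real_add)
    also have "\<dots> \<le> (cmod ?b)\<^sup>2 / (1 + ?l) * 1"
      using l by (intro mult_left_mono) auto
    finally show ?thesis unfolding rank_one_inv_form[OF L(1)] by simp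
  qed
  have 3: "(N + outer a a) ** rank_one_inv L a = mat 1"
  proof -
    have "((N + outer a a) ** rank_one_inv L a) *v x = mat 1 *v x" for x
    proof -
      let ?k = "1 / (1 + ?l)"
      have NL: "N *v (L *v z) = z" for z using L(3) by (simp add: matrix_vector_mul_assoc)
      define b where "b = cip a (L *v x)"
      have R: "rank_one_inv L a *v x = L *v x - ?k *\<^sub>R (b *s (L *v a))"
        unfolding rank_one_inv_def b_def using cip_cadj[of a L x] L(1)
        by (simp add: matrix_vector_mult_diff_rdistrib scaleR_mult_vec outer_mult_vec)
      have kk: "?k *\<^sub>R (c *s z) = (?k * c) *s z" for c :: complex and z :: "complex^'a"
        by (simp add: vec_eq_iff scaleR_conv_of_real[where 'a=complex])
      have cipR: "cip a (rank_one_inv L a *v x) = ?k * b"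
      proof -
        have "cip a (rank_one_inv L a *v x) = b - ?k * b * cip a (L *v a)"
          unfolding R kk cip_diff_right cip_scale_right b_def ..
        also have "\<dots> = ?k * b"
        proof -
          have "complex_of_real (1 + ?l) \<noteq> 0" using l by (metis add_nonneg_eq_0_iff of_real_eq_0_iff zero_le_one zero_neq_one)
          then show ?thesis unfolding hermitian_cip_real[OF L(1)] by (simp add: field_simps)
        qed
        finally show ?thesis .
      qed
      have "((N + outer a a) ** rank_one_inv L a) *v x = N *v (rank_one_inv L a *v x) + outer a a *v (rank_one_inv L a *v x)"
        by (simp add: matrix_vector_mul_assoc[symmetric] matrix_vector_mult_add_rdistrib)
      also have "\<dots> = x - (?k * b) *s a + (?k * b) *s a"
        unfolding outer_mult_vec cipR unfolding R kk
        by (simp add: matrix_vector_mult_diff_distrib matrix_vector_mult_scale NL)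
      finally show ?thesis by simp
    qed
    then show ?thesis unfolding matrix_eq by blast
  qed
  \<comment> \<open>Factoring out \<open>N\<close> leaves a rank-one perturbation of the
    identity.\<close>
  have 4: "det (N + outer a a) = complex_of_real (d * (1 + ?l))"
  proof -
    have "N + outer a a = N ** (mat 1 + outer (L *v a) a)"
      by (simp add: matrix_add_ldistrib matrix_mult_outer matrix_vector_mul_assoc L(3))
    then show ?thesis
      by (simp add: det_mul det_mat_1_plus_outer hermitian_cip_real[OF L(1)] L(4))
  qed
  show ?thesis using 1 2 3 4 L(5) l by (simp add: posinv_def add_pos_nonneg)
qed

section \<open>Square roots of positive semidefinite matrices\<close>

lemma psd_iff_inner: "psd A \<longleftrightarrow> cadj A = A \<and> (\<forall>x. 0 \<le> x \<bullet> (A *v x))"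
proof -
  have "Im (cip x (A *v x)) = 0 \<and> Re (cip x (A *v x)) = x \<bullet> (A *v x)" if "cadj A = A" for x
    using hermitian_cip_real[OF that] by simp
  then show ?thesis unfolding psd_def cip_def[symmetric] by auto
qed

lemma outer_axis_form: "cip (axis i 1) (A *v axis j 1) = A $ i $ j"
  by (simp add: cip_def matrix_vector_mult_def axis_def if_distrib if_distribR cong: if_cong)

text \<open>If \<open>A $ k $ k\<close> vanishes, the form at
  \<open>axis j 1 - c *s axis k 1\<close> is real-affine in \<open>c\<close>, so a nonzero entry
  \<open>A $ k $ j\<close> would let it become negative.\<close>

lemma psd_zero_diag:
  assumes "psd A" "A $ k $ k = 0" shows "A $ k $ j = 0"
proof (rule ccontr)
  assume nz: "A $ k $ j \<noteq> 0"
  have A: "cadj A = A" "\<And>x. 0 \<le> x \<bullet> (A *v x)" using assms by (auto simp: psd_iff_inner)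
  define r where "r = axis j 1 \<bullet> (A *v axis j 1)"
  \<comment> \<open>Chosen so that the form takes the value \<open>r - 2 * (r + 1)\<close>, which is
    negative because \<open>r \<ge> 0\<close>.\<close>
  define t where "t = (r + 1) / (cmod (A $ k $ j))\<^sup>2"
  define c where "c = complex_of_real t * A $ k $ j"
  have "0 \<le> (axis j 1 - c *s axis k 1) \<bullet> (A *v (axis j 1 - c *s axis k 1))" by (rule A)
  also have "\<dots> = r - 2 * Re (cnj c * A $ k $ j)"
  proof -
    have "axis k 1 \<bullet> (A *v axis k 1) = 0"
      unfolding Re_cip[symmetric] outer_axis_form using assms(2) by simp
    then show ?thesis
      unfolding hermitian_form_diff[OF A(1)] outer_axis_form r_def by simp
  qed
  also have "cnj c * A $ k $ j = complex_of_real (t * (cmod (A $ k $ j))\<^sup>2)"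
    unfolding c_def using complex_norm_square[of "A $ k $ j"] by (simp add: mult_ac)
  also have "r - 2 * Re (complex_of_real (t * (cmod (A $ k $ j))\<^sup>2)) = - r - 2"
    using nz by (simp add: t_def)
  finally have "0 \<le> - r - 2" .
  moreover have "0 \<le> r" unfolding r_def by (rule A)
  ultimately show False by simp
qed

text \<open>One step of a Cholesky factorisation. The form of \<open>A - outer a a\<close> at
  \<open>y\<close> is the minimum of the form of \<open>A\<close> over \<open>y\<close> plus
  multiples of \<open>axis k 1\<close>, hence nonnegative. The last claim ensures that diagonal
  entries cleared earlier stay cleared.\<close>

lemma psd_deflate:
  assumes A: "psd A" and d: "A $ k $ k \<noteq> 0"
  defines "a \<equiv> (1 / sqrt (Re (A $ k $ k))) *\<^sub>R column k A"
  shows "psd (A - outer a a)" "\<And>j. (A - outer a a) $ k $ j = 0"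
    "\<And>i. A $ i $ i = 0 \<Longrightarrow> (A - outer a a) $ i $ i = 0"
proof -
  have h: "cadj A = A" "\<And>x. 0 \<le> x \<bullet> (A *v x)" using A by (auto simp: psd_iff_inner)
  define r where "r = Re (A $ k $ k)"
  have rr: "A $ k $ k = complex_of_real r" "0 \<le> r"
    using hermitian_cip_real[OF h(1), of "axis k 1"] h(2)[of "axis k 1"] unfolding outer_axis_form r_def
    by auto
  with d have r: "0 < r" by (cases "r = 0") auto
  have herm: "cnj (A $ i $ j) = A $ j $ i" for i j
    using h(1) by (simp add: cadj_def vec_eq_iff)
  have aa: "outer a a = (1 / r) *\<^sub>R outer (column k A) (column k A)"
    unfolding a_def using r by (simp add: outer_def vec_eq_iff r_def[symmetric] scaleR_conv_of_real[where 'a=complex] field_simps flip: of_real_mult)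
  have form: "y \<bullet> (outer a a *v y) = (cmod ((A *v y) $ k))\<^sup>2 / r" for y
  proof -
    have "cip (column k A) y = (A *v y) $ k"
      using herm by (simp add: cip_def column_def matrix_vector_mult_def)
    then have "y \<bullet> (outer (column k A) (column k A) *v y) = Re (cnj ((A *v y) $ k) * (A *v y) $ k)"
      unfolding outer_mult_vec by (subst inner_commute) (simp add: inner_vector_scalar_mult)
    also have "\<dots> = (cmod ((A *v y) $ k))\<^sup>2"
      using complex_norm_square[of "(A *v y) $ k"] by (metis Re_complex_of_real mult.commute of_real_power)
    finally show ?thesis unfolding aa by (simp add: scaleR_mult_vec)
  qed
  show "psd (A - outer a a)"
    unfolding psd_iff_inner
  proof (intro conjI allI)
    show "cadj (A - outer a a) = A - outer a a"
      using herm by (simp add: cadj_def outer_def vec_eq_iff mult.commute)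
    fix y
    let ?b = "(A *v y) $ k"
    have cipk: "cip (axis k 1) (A *v y) = ?b"
      by (simp add: cip_def axis_def if_distrib if_distribR cong: if_cong)
    have akk: "axis k 1 \<bullet> (A *v axis k 1) = r"
      unfolding Re_cip[symmetric] outer_axis_form r_def ..
    let ?c = "?b / complex_of_real r"
    have c: "cnj ?c * ?b = complex_of_real ((cmod ?b)\<^sup>2 / r)"
      using complex_norm_square[of ?b] by (simp add: mult.commute)
    have "0 \<le> (y - ?c *s axis k 1) \<bullet> (A *v (y - ?c *s axis k 1))" by (rule h)
    also have "\<dots> = y \<bullet> (A *v y) - 2 * ((cmod ?b)\<^sup>2 / r) + (cmod ?c)\<^sup>2 * r"
      unfolding hermitian_form_diff[OF h(1)] cipk c akk by simp
    also have "(cmod ?c)\<^sup>2 * r = (cmod ?b)\<^sup>2 / r"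
      using r by (simp add: norm_divide power_divide power2_eq_square)
    finally show "0 \<le> y \<bullet> ((A - outer a a) *v y)"
      by (simp add: matrix_vector_mult_diff_rdistrib inner_diff_right form)
  qed
  show "(A - outer a a) $ k $ j = 0" for j
    unfolding aa using r rr herm[of j k] by (simp add: outer_def column_def scaleR_conv_of_real[where 'a=complex])
  show "(A - outer a a) $ i $ i = 0" if "A $ i $ i = 0" for i
    unfolding aa using psd_zero_diag[OF A that] that by (simp add: outer_def column_def)
qed

text \<open>Induction on the number of nonzero diagonal entries, of which each deflation removes at
  least one. The rank-one terms are indexed by diagonal positions, so they fit as columns into a
  square matrix.\<close>

lemma psd_factor:
  fixes A :: "complex^'n^'n"
  assumes "psd A"
  obtains T :: "complex^'n^'n" where "A = T ** cadj T"
proof -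
  have "\<exists>f. A = (\<Sum>i\<in>{i. A $ i $ i \<noteq> 0}. outer (f i) (f i))" using assms
  proof (induction "card {i. A $ i $ i \<noteq> 0}" arbitrary: A rule: less_induct)
    case less
    show ?case
    proof (cases "\<exists>k. A $ k $ k \<noteq> 0")
      case False
      then have "A = 0" using psd_zero_diag[OF less(2)] by (simp add: vec_eq_iff)
      then show ?thesis by simp
    next
      case True
      then obtain k where k: "A $ k $ k \<noteq> 0" by blast
      define a where "a = (1 / sqrt (Re (A $ k $ k))) *\<^sub>R column k A"
      let ?B = "A - outer a a"
      note B = psd_deflate[OF less(2) k, folded a_def]
      let ?S = "{i. A $ i $ i \<noteq> 0}" and ?S' = "{i. ?B $ i $ i \<noteq> 0}"
      have S': "?S' \<subseteq> ?S - {k}" using B(2)[of k] B(3) by auto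
      then have "card ?S' < card ?S" using k by (intro psubset_card_mono) auto
      then obtain f where f: "?B = (\<Sum>i\<in>?S'. outer (f i) (f i))" using less(1) B(1) by blast
      define g where "g i = (if i = k then a else if i \<in> ?S' then f i else 0)" for i
      have o0: "outer 0 0 = (0 :: complex^'n^'n)" by (simp add: outer_def vec_eq_iff)
      have "(\<Sum>i\<in>?S. outer (g i) (g i)) = outer a a + (\<Sum>i\<in>?S - {k}. outer (g i) (g i))"
        using k by (subst sum.remove[of _ k]) (auto simp: g_def)
      also have "(\<Sum>i\<in>?S - {k}. outer (g i) (g i)) = (\<Sum>i\<in>?S'. outer (f i) (f i))"
        using S' by (intro sum.mono_neutral_cong_right) (auto simp: g_def o0)
      also note f[symmetric]
      also have "outer a a + (A - outer a a) = A" by simp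
      finally have "A = (\<Sum>i\<in>?S. outer (g i) (g i))" ..
      then show ?thesis by blast
    qed
  qed
  then obtain f where f: "A = (\<Sum>i\<in>{i. A $ i $ i \<noteq> 0}. outer (f i) (f i))" by blast
  define T where "T = (\<chi> i j. if A $ j $ j \<noteq> 0 then f j $ i else 0)"
  have "T ** cadj T = (\<Sum>j\<in>UNIV. outer (column j T) (column j T))" by (rule mult_cadj_eq_sum_outer)
  also have "\<dots> = (\<Sum>j\<in>{i. A $ i $ i \<noteq> 0}. outer (f j) (f j))"
    by (intro sum.mono_neutral_cong_right) (auto simp: T_def outer_def column_def vec_eq_iff)
  also note f[symmetric]
  finally show ?thesis by (intro that[of T]) (rule sym)
qed

section \<open>Complex Gaussian integrals\<close>

lemma nn_integral_lborel_translate: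
  fixes f :: "'a::euclidean_space \<Rightarrow> ennreal"
  assumes [measurable]: "f \<in> borel_measurable borel"
  shows "(\<integral>\<^sup>+x. f (c + x) \<partial>lborel) = (\<integral>\<^sup>+x. f x \<partial>lborel)"
proof -
  have "(\<integral>\<^sup>+x. f x \<partial>lborel) = (\<integral>\<^sup>+x. f x \<partial>distr lborel borel ((+) c))"
    by (simp add: lborel_distr_plus)
  then show ?thesis by (simp add: nn_integral_distr)
qed

lemma nn_integral_lborel_uminus:
  fixes f :: "'a::euclidean_space \<Rightarrow> ennreal"
  assumes [measurable]: "f \<in> borel_measurable borel"
  shows "(\<integral>\<^sup>+x. f (- x) \<partial>lborel) = (\<integral>\<^sup>+x. f x \<partial>lborel)"
proof -
  have "lborel = distr lborel borel (\<lambda>x::'a. - x)"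
    using lborel_affine[of "-1" "0::'a"] by (simp add: density_1)
  then have "(\<integral>\<^sup>+x. f x \<partial>lborel) = (\<integral>\<^sup>+x. f x \<partial>distr lborel borel (\<lambda>x::'a. - x))" by simp
  then show ?thesis by (simp add: nn_integral_distr)
qed

lemma nn_integral_exp_square_real:
  assumes "0 < c"
  shows "(\<integral>\<^sup>+x. ennreal (exp (- c * x\<^sup>2)) \<partial>lborel) = ennreal (sqrt (pi / c))"
proof -
  \<comment> \<open>The variance \<open>1 / (2 * c)\<close> makes
    \<open>exp (- c * x\<^sup>2)\<close> a multiple of a normal density.\<close>
  define s where "s = sqrt (1 / (2 * c))"
  have s: "0 < s" "s\<^sup>2 = 1 / (2 * c)" using assms by (auto simp: s_def)
  interpret prob_space "density lborel (normal_density 0 s)" using s by (intro prob_space_normal_density)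
  have "exp (- c * x\<^sup>2) = sqrt (pi / c) * normal_density 0 s x" for x
  proof -
    have "2 * s\<^sup>2 = 1 / c" "2 * pi * s\<^sup>2 = pi / c" using s assms by auto
    then show ?thesis using assms by (simp add: normal_density_def mult.commute)
  qed
  then have "(\<integral>\<^sup>+x. ennreal (exp (- c * x\<^sup>2)) \<partial>lborel) = (\<integral>\<^sup>+x. ennreal (sqrt (pi / c)) * ennreal (normal_density 0 s x) \<partial>lborel)"
    using assms by (intro nn_integral_cong) (simp add: ennreal_mult)
  also have "\<dots> = ennreal (sqrt (pi / c)) * emeasure (density lborel (normal_density 0 s)) (space lborel)"
    by (subst emeasure_density) (auto simp: nn_integral_cmult)
  finally show ?thesis using emeasure_space_1 by simp
qed

lemma nn_integral_exp_norm_square: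
  assumes "0 < c"
  shows "(\<integral>\<^sup>+x. ennreal (exp (- c * (norm x)\<^sup>2)) \<partial>(lborel :: 'a::euclidean_space measure)) = ennreal (sqrt (pi / c) ^ DIM('a))"
proof -
  have "ennreal (exp (- c * (norm x)\<^sup>2)) = (\<Prod>b\<in>Basis. ennreal (exp (- c * (x \<bullet> b)\<^sup>2)))" for x :: 'a
  proof -
    have "(norm x)\<^sup>2 = (\<Sum>b\<in>Basis. (x \<bullet> b)\<^sup>2)"
      by (subst power2_norm_eq_inner, subst euclidean_inner) (simp add: power2_eq_square)
    then show ?thesis by (simp add: sum_distrib_left exp_sum prod_ennreal sum_negf[symmetric])
  qed
  then have "(\<integral>\<^sup>+x. ennreal (exp (- c * (norm x)\<^sup>2)) \<partial>(lborel :: 'a measure))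
      = (\<Prod>b\<in>(Basis :: 'a set). \<integral>\<^sup>+x. ennreal (exp (- c * x\<^sup>2)) \<partial>lborel)"
    by (simp only:) (rule nn_integral_lborel_prod, auto)
  also have "\<dots> = ennreal (sqrt (pi / c) ^ DIM('a))"
    unfolding nn_integral_exp_square_real[OF assms] using assms by (simp add: ennreal_power)
  finally show ?thesis .
qed

section \<open>Complex Gaussian vectors, one coordinate at a time\<close>

definition cgauss1 :: "complex measure" where
  "cgauss1 = density lborel (\<lambda>z. ennreal (exp (- (norm z)\<^sup>2) / pi))"

lemma sets_cgauss1 [measurable_cong, simp]: "sets cgauss1 = sets borel"
  and space_cgauss1 [simp]: "space cgauss1 = UNIV"
  by (auto simp: cgauss1_def)

lemma sets_cgauss [measurable_cong, simp]: "sets cgauss = sets borel"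
  and space_cgauss [simp]: "space cgauss = UNIV"
  by (auto simp: cgauss_def)

lemma nn_integral_cgauss1:
  assumes [measurable]: "f \<in> borel_measurable borel"
  shows "(\<integral>\<^sup>+z. f z \<partial>cgauss1) = (\<integral>\<^sup>+z. ennreal (exp (- (norm z)\<^sup>2) / pi) * f z \<partial>lborel)"
  by (simp add: cgauss1_def nn_integral_density)

lemma nn_integral_cgauss:
  fixes f :: "complex^'n \<Rightarrow> ennreal"
  assumes [measurable]: "f \<in> borel_measurable borel"
  shows "(\<integral>\<^sup>+z. f z \<partial>cgauss) = (\<integral>\<^sup>+z. ennreal (exp (- (norm z)\<^sup>2) / pi ^ CARD('n)) * f z \<partial>lborel)"
  by (simp add: cgauss_def nn_integral_density)

lemma prob_space_cgauss: "prob_space (cgauss :: (complex^'n) measure)"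
proof
  have "emeasure (cgauss :: (complex^'n) measure) (space cgauss) = (\<integral>\<^sup>+z. 1 \<partial>(cgauss :: (complex^'n) measure))" by simp
  also have "\<dots> = (\<integral>\<^sup>+z. ennreal (1 / pi ^ CARD('n)) * ennreal (exp (- 1 * (norm z)\<^sup>2)) \<partial>(lborel :: (complex^'n) measure))"
    by (subst nn_integral_cgauss) (auto intro!: nn_integral_cong simp flip: ennreal_mult)
  also have "\<dots> = ennreal (1 / pi ^ CARD('n)) * ennreal (sqrt pi ^ (2 * CARD('n)))"
    using nn_integral_exp_norm_square[of 1, where 'a="complex^'n"] by (simp add: nn_integral_cmult mult.commute)
  also have "\<dots> = 1" by (simp add: power_mult flip: ennreal_mult)
  finally show "emeasure (cgauss :: (complex^'n) measure) (space cgauss) = 1" .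
qed

lemma prob_space_cgauss1: "prob_space cgauss1"
proof
  have "emeasure cgauss1 (space cgauss1) = (\<integral>\<^sup>+z. 1 \<partial>cgauss1)" by simp
  also have "\<dots> = (\<integral>\<^sup>+z. ennreal (1 / pi) * ennreal (exp (- 1 * (norm z)\<^sup>2)) \<partial>(lborel :: complex measure))"
    by (subst nn_integral_cgauss1) (auto intro!: nn_integral_cong simp flip: ennreal_mult)
  also have "\<dots> = ennreal (1 / pi) * ennreal (sqrt pi ^ 2)"
    using nn_integral_exp_norm_square[of 1, where 'a=complex] by (simp add: nn_integral_cmult)
  also have "\<dots> = 1" by (simp flip: ennreal_mult)
  finally show "emeasure cgauss1 (space cgauss1) = 1" .
qed

lemma measurable_vec_lambda_PiM [measurable]:
  "(\<lambda>x. \<chi> i. x i) \<in> measurable (PiM UNIV (\<lambda>_::'n::finite. borel :: complex measure)) borel"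
proof (subst borel_measurable_euclidean_space, rule ballI)
  fix b :: "complex^'n" assume "b \<in> Basis"
  then obtain i c where b: "b = axis i c" by (auto simp: Basis_vec_def)
  have "(\<lambda>x. x i \<bullet> c) \<in> borel_measurable (PiM UNIV (\<lambda>_::'n. borel :: complex measure))"
    by measurable
  then show "(\<lambda>x. (\<chi> i. x i) \<bullet> b) \<in> borel_measurable (PiM UNIV (\<lambda>_::'n. borel :: complex measure))"
    by (simp add: b inner_axis)
qed

text \<open>Lebesgue measure is determined by its values on boxes, and a box in
  \<open>complex^'n\<close> is a product of rectangles because the basis consists of the vectors
  \<open>axis i c\<close> with \<open>c\<close> in the basis of \<open>complex\<close>. This permits
  integrating Gaussian vectors coordinate by coordinate.\<close>

lemma lborel_vec_eq_PiM:
  "(lborel :: (complex^'n::finite) measure) = distr (PiM UNIV (\<lambda>_. lborel)) borel (\<lambda>x. \<chi> i. x i)"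
proof (rule lborel_eqI)
  fix l u :: "complex^'n" assume le: "\<And>b. b \<in> Basis \<Longrightarrow> l \<bullet> b \<le> u \<bullet> b"
  interpret product_sigma_finite "\<lambda>_::'n. lborel::complex measure" ..
  have le': "l $ i \<bullet> c \<le> u $ i \<bullet> c" if "c \<in> Basis" for i c
    using le[of "axis i c"] that by (auto simp: Basis_vec_def inner_axis)
  have [measurable]: "(\<lambda>x. \<chi> i. x i) \<in> measurable (PiM UNIV (\<lambda>_::'n. lborel :: complex measure)) borel"
    by (simp add: measurable_vec_lambda_PiM cong: measurable_cong_sets sets_PiM_cong)
  have pre: "(\<lambda>x. \<chi> i. x i) -` box l u \<inter> space (PiM UNIV (\<lambda>_::'n. lborel :: complex measure)) = PiE UNIV (\<lambda>i. box (l $ i) (u $ i))"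
    by (auto simp: box_def Basis_vec_def inner_axis space_PiM PiE_iff)
  have "emeasure (distr (PiM UNIV (\<lambda>_. lborel)) borel (\<lambda>x. \<chi> i. x i)) (box l u)
      = (\<Prod>i\<in>UNIV. emeasure lborel (box (l $ i) (u $ i)))"
    by (simp add: emeasure_distr pre emeasure_PiM)
  also have "\<dots> = (\<Prod>i\<in>UNIV. \<Prod>c\<in>Basis. ennreal ((u $ i - l $ i) \<bullet> c))"
    using le' by (simp add: prod_ennreal inner_diff_left)
  also have "\<dots> = (\<Prod>(i, c)\<in>UNIV \<times> Basis. ennreal ((u $ i - l $ i) \<bullet> c))"
    by (simp add: prod.cartesian_product)
  also have "\<dots> = (\<Prod>b\<in>(\<lambda>(i, c). axis i c) ` (UNIV \<times> Basis). ennreal ((u - l) \<bullet> b))"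
    by (subst prod.reindex) (auto simp: inj_on_def axis_eq_axis inner_axis nonzero_Basis intro!: prod.cong)
  also have "(\<lambda>(i, c). axis i c) ` (UNIV \<times> Basis) = (Basis :: (complex^'n) set)"
    by (auto simp: Basis_vec_def)
  also have "(\<Prod>b\<in>Basis. ennreal ((u - l) \<bullet> b)) = ennreal (\<Prod>b\<in>Basis. (u - l) \<bullet> b)"
    using le by (intro prod_ennreal) (simp add: inner_diff_left)
  finally show "emeasure (distr (PiM UNIV (\<lambda>_. lborel)) borel (\<lambda>x. \<chi> i. x i)) (box l u) = ennreal (\<Prod>b\<in>Basis. (u - l) \<bullet> b)" .
qed simp

lemma PiM_cgauss1: 
  "PiM (UNIV :: 'n::finite set) (\<lambda>_. cgauss1) = density (PiM UNIV (\<lambda>_. lborel)) (\<lambda>x. \<Prod>i\<in>UNIV. ennreal (exp (- (norm (x i))\<^sup>2) / pi))"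
proof -
  interpret G: product_sigma_finite "\<lambda>_::'n. cgauss1"
    using prob_space_cgauss1 by (simp add: product_sigma_finite_def prob_space_imp_sigma_finite)
  interpret product_sigma_finite "\<lambda>_::'n. lborel::complex measure" ..
  show ?thesis
  proof (rule G.PiM_eqI[symmetric])
    show "sets (density (PiM UNIV (\<lambda>_. lborel)) (\<lambda>x. \<Prod>i\<in>UNIV. ennreal (exp (- (norm (x i))\<^sup>2) / pi))) = sets (PiM (UNIV :: 'n set) (\<lambda>_. cgauss1))"
      by (auto intro!: sets_PiM_cong)
    fix A :: "'n \<Rightarrow> complex set" assume "\<And>i. i \<in> UNIV \<Longrightarrow> A i \<in> sets cgauss1"
    then have A[measurable]: "\<And>i. A i \<in> sets borel" by simp
    have PA: "PiE UNIV A \<in> sets (PiM UNIV (\<lambda>_::'n. lborel :: complex measure))"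
      by (intro sets_PiM_I_finite) auto
    have "emeasure (density (PiM UNIV (\<lambda>_. lborel)) (\<lambda>x. \<Prod>i\<in>UNIV. ennreal (exp (- (norm (x i))\<^sup>2) / pi))) (PiE UNIV A)
      = (\<integral>\<^sup>+x. (\<Prod>i\<in>UNIV. ennreal (exp (- (norm (x i))\<^sup>2) / pi)) * indicator (PiE UNIV A) x \<partial>PiM UNIV (\<lambda>_. lborel))"
      using PA by (subst emeasure_density) auto
    also have "\<dots> = (\<integral>\<^sup>+x. (\<Prod>i\<in>UNIV. ennreal (exp (- (norm (x i))\<^sup>2) / pi) * indicator (A i) (x i)) \<partial>PiM UNIV (\<lambda>_. lborel))"
    proof (intro nn_integral_cong)
      fix x :: "'n \<Rightarrow> complex"
      have "indicator (PiE UNIV A) x = (\<Prod>i\<in>UNIV. indicator (A i) (x i) :: ennreal)"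
        by (auto simp: indicator_def PiE_iff prod.neutral) 
      then show "(\<Prod>i\<in>UNIV. ennreal (exp (- (norm (x i))\<^sup>2) / pi)) * indicator (PiE UNIV A) x
          = (\<Prod>i\<in>UNIV. ennreal (exp (- (norm (x i))\<^sup>2) / pi) * indicator (A i) (x i))"
        by (simp add: prod.distrib)
    qed
    also have "\<dots> = (\<Prod>i\<in>UNIV. \<integral>\<^sup>+z. ennreal (exp (- (norm z)\<^sup>2) / pi) * indicator (A i) z \<partial>lborel)"
      by (intro product_nn_integral_prod) auto
    also have "\<dots> = (\<Prod>i\<in>UNIV. emeasure cgauss1 (A i))"
      unfolding cgauss1_def by (intro prod.cong refl) (auto simp: emeasure_density)
    finally show "emeasure (density (PiM UNIV (\<lambda>_. lborel)) (\<lambda>x. \<Prod>i\<in>UNIV. ennreal (exp (- (norm (x i))\<^sup>2) / pi))) (PiE UNIV A) = (\<Prod>i\<in>UNIV. emeasure cgauss1 (A i))" .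
  qed simp
qed

lemma nn_integral_cgauss_coords:
  fixes f :: "complex^'n \<Rightarrow> ennreal"
  assumes [measurable]: "f \<in> borel_measurable borel"
  shows "(\<integral>\<^sup>+x. f x \<partial>cgauss) = (\<integral>\<^sup>+x. f (\<chi> i. x i) \<partial>PiM UNIV (\<lambda>_. cgauss1))"
proof -
  have [measurable]: "(\<lambda>x. \<chi> i. x i) \<in> measurable (PiM UNIV (\<lambda>_::'n. lborel :: complex measure)) borel"
    by (simp add: measurable_vec_lambda_PiM cong: measurable_cong_sets sets_PiM_cong)
  have dens: "ennreal (exp (- (norm (\<chi> i::'n. x i))\<^sup>2) / pi ^ CARD('n)) = (\<Prod>i\<in>UNIV. ennreal (exp (- (norm (x i))\<^sup>2) / pi))" for x :: "'n \<Rightarrow> complex"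
  proof -
    have "(norm (\<chi> i::'n. x i))\<^sup>2 = (\<Sum>i\<in>UNIV. (norm (x i))\<^sup>2)"
      by (simp add: norm_vec_def L2_set_def sum_nonneg)
    then show ?thesis by (simp add: prod_ennreal prod_dividef exp_sum flip: sum_negf)
  qed
  have "(\<integral>\<^sup>+x. f x \<partial>cgauss) = (\<integral>\<^sup>+z. ennreal (exp (- (norm z)\<^sup>2) / pi ^ CARD('n)) * f z \<partial>(lborel :: (complex^'n) measure))"
    by (rule nn_integral_cgauss) fact
  also have "\<dots> = (\<integral>\<^sup>+x. ennreal (exp (- (norm (\<chi> i::'n. x i))\<^sup>2) / pi ^ CARD('n)) * f (\<chi> i. x i) \<partial>PiM UNIV (\<lambda>_. lborel))"
    by (subst lborel_vec_eq_PiM) (simp add: nn_integral_distr)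
  also have "\<dots> = (\<integral>\<^sup>+x. f (\<chi> i. x i) \<partial>PiM UNIV (\<lambda>_. cgauss1))"
    unfolding PiM_cgauss1 dens by (subst nn_integral_density) auto
  finally show ?thesis .
qed

lemma nn_integral_cgauss1_exp:
  assumes "0 \<le> l"
  shows "(\<integral>\<^sup>+z. ennreal (exp (2 * Re (cnj z * b) - (cmod z)\<^sup>2 * l)) \<partial>cgauss1) = ennreal (exp ((cmod b)\<^sup>2 / (1 + l)) / (1 + l))"
proof -
  \<comment> \<open>The centre that results from completing the square; after translating by it, a
    centred Gaussian integral with coefficient \<open>1 + l\<close> remains.\<close>
  define m where "m = b / complex_of_real (1 + l)"
  have l: "0 < 1 + l" using assms by simp
  have sq: "exp (- (cmod (m + z))\<^sup>2) / pi * exp (2 * Re (cnj (m + z) * b) - (cmod (m + z))\<^sup>2 * l)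
      = exp ((cmod b)\<^sup>2 / (1 + l)) / pi * exp (- (1 + l) * (cmod z)\<^sup>2)" for z
  proof -
    have b: "b = complex_of_real (1 + l) * m" using l by (simp add: m_def del: of_real_add)
    have 1: "2 * Re (cnj (m + z) * b) = (1 + l) * (2 * Re (cnj (m + z) * m))"
      unfolding b by (simp add: algebra_simps)
    have 2: "2 * Re (cnj (m + z) * m) = (cmod (m + z))\<^sup>2 + (cmod m)\<^sup>2 - (cmod z)\<^sup>2"
      unfolding cmod_power2 by (simp add: power2_eq_square algebra_simps)
    have 3: "(cmod b)\<^sup>2 / (1 + l) = (1 + l) * (cmod m)\<^sup>2"
      unfolding b using l by (simp add: norm_mult power_mult_distrib power2_eq_square del: of_real_add)
    have "- (cmod (m + z))\<^sup>2 + (2 * Re (cnj (m + z) * b) - (cmod (m + z))\<^sup>2 * l)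
        = (cmod b)\<^sup>2 / (1 + l) + (- (1 + l) * (cmod z)\<^sup>2)"
      unfolding 3 1 2 by (simp add: algebra_simps)
    then show ?thesis by (simp add: mult_exp_exp)
  qed
  have "(\<integral>\<^sup>+z. ennreal (exp (2 * Re (cnj z * b) - (cmod z)\<^sup>2 * l)) \<partial>cgauss1)
      = (\<integral>\<^sup>+z. ennreal (exp (- (cmod z)\<^sup>2) / pi * exp (2 * Re (cnj z * b) - (cmod z)\<^sup>2 * l)) \<partial>lborel)"
    by (subst nn_integral_cgauss1) (auto simp flip: ennreal_mult)
  also have "\<dots> = (\<integral>\<^sup>+z. ennreal (exp (- (cmod (m + z))\<^sup>2) / pi * exp (2 * Re (cnj (m + z) * b) - (cmod (m + z))\<^sup>2 * l)) \<partial>lborel)"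
    by (rule nn_integral_lborel_translate[symmetric]) simp
  also have "\<dots> = (\<integral>\<^sup>+z. ennreal (exp ((cmod b)\<^sup>2 / (1 + l)) / pi) * ennreal (exp (- (1 + l) * (cmod z)\<^sup>2)) \<partial>lborel)"
    unfolding sq by (intro nn_integral_cong) (simp flip: ennreal_mult)
  also have "\<dots> = ennreal (exp ((cmod b)\<^sup>2 / (1 + l)) / pi) * ennreal (sqrt (pi / (1 + l)) ^ 2)"
    using nn_integral_exp_norm_square[OF l, where 'a=complex] by (simp add: nn_integral_cmult)
  also have "\<dots> = ennreal (exp ((cmod b)\<^sup>2 / (1 + l)) / (1 + l))"
    using l by (simp flip: ennreal_mult)
  finally show ?thesis .
qed

lemma posinv_unique:
  assumes "posinv N L d" "posinv N L' d'" shows "L = L'" "d = d'"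
proof -
  have "L ** N = mat 1" "N ** L' = mat 1"
    using assms by (auto simp: posinv_def matrix_left_right_inverse)
  then show "L = L'" by (metis matrix_mul_assoc matrix_mul_lid matrix_mul_rid)
  show "d = d'" using assms by (auto simp: posinv_def)
qed

lemma product_sigma_finite_cgauss1: "product_sigma_finite (\<lambda>_. cgauss1)"
  using prob_space_cgauss1 by (simp add: product_sigma_finite_def prob_space_imp_sigma_finite)

lemma borel_measurable_matrix_vector [measurable (raw)]:
  fixes A :: "complex^'n^'m"
  assumes "f \<in> borel_measurable M" shows "(\<lambda>x. A *v f x) \<in> borel_measurable M"
  using assms by (rule measurable_compose)
    (intro borel_measurable_continuous_onI linear_continuous_on matrix_vector_mul_bounded_linear)

lemma borel_measurable_vector_scalar [measurable (raw)]:
  fixes a :: "complex^'n"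
  assumes "f \<in> borel_measurable M" shows "(\<lambda>x. f x *s a) \<in> borel_measurable M"
proof -
  have "bounded_linear (\<lambda>c. c *s a)"
    by (auto intro!: linear_conv_bounded_linear[THEN iffD1] linearI simp: vec_eq_iff distrib_right)
  then show ?thesis using assms
    by (intro measurable_compose[OF assms borel_measurable_continuous_onI] linear_continuous_on)
qed

text \<open>Each coordinate enters the exponent quadratically, and integrating it out changes
  \<open>L\<close> exactly by the Sherman--Morrison update and \<open>d\<close> by the factor
  \<open>1 + l\<close>. The induction thus avoids diagonalisation and linear changes of
  variables.\<close>

lemma gaussian_integral_PiM:
  fixes a :: "'i \<Rightarrow> complex^'r"
  assumes "posinv N L d" "finite F"
  shows "\<exists>L' d'. posinv (N + (\<Sum>j\<in>F. outer (a j) (a j))) L' d' \<and> d \<le> d' \<and>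
    (\<forall>y. (\<integral>\<^sup>+x. ennreal (exp (- ((y - (\<Sum>j\<in>F. x j *s a j)) \<bullet> (L *v (y - (\<Sum>j\<in>F. x j *s a j)))))) \<partial>PiM F (\<lambda>_. cgauss1))
        = ennreal (d / d' * exp (- (y \<bullet> (L' *v y)))))"
  using assms(2)
proof (induction F)
  case empty
  show ?case using assms(1)
    by (intro exI[of _ L] exI[of _ d] conjI allI, simp, simp)
       (subst product_sigma_finite.nn_integral_empty[OF product_sigma_finite_cgauss1], auto simp: posinv_def)
next
  case (insert k F)
  interpret product_sigma_finite "\<lambda>_::'i. cgauss1" by (rule product_sigma_finite_cgauss1)
  obtain L' d' where L': "posinv (N + (\<Sum>j\<in>F. outer (a j) (a j))) L' d'" "d \<le> d'"
    and int: "\<And>y. (\<integral>\<^sup>+x. ennreal (exp (- ((y - (\<Sum>j\<in>F. x j *s a j)) \<bullet> (L *v (y - (\<Sum>j\<in>F. x j *s a j)))))) \<partial>PiM F (\<lambda>_. cgauss1))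
        = ennreal (d / d' * exp (- (y \<bullet> (L' *v y))))"
    using insert.IH by blast
  define l where "l = a k \<bullet> (L' *v a k)"
  have l: "0 \<le> l" using L' by (simp add: l_def posinv_def)
  have d: "0 < d" "0 < d'" using L' assms(1) by (auto simp: posinv_def)
  have herm: "cadj L' = L'" using L' by (simp add: posinv_def)
  show ?case
  proof (intro exI conjI allI)
    have "N + (\<Sum>j\<in>insert k F. outer (a j) (a j)) = (N + (\<Sum>j\<in>F. outer (a j) (a j))) + outer (a k) (a k)"
      using insert by simp
    then show "posinv (N + (\<Sum>j\<in>insert k F. outer (a j) (a j))) (rank_one_inv L' (a k)) (d' * (1 + l))"
      using posinv_rank_one[OF L'(1), of "a k"] by (simp only: l_def)
    have "d' * 1 \<le> d' * (1 + l)" using d l by (intro mult_left_mono) auto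
    then show "d \<le> d' * (1 + l)" using L'(2) by simp
    fix y
    let ?f = "\<lambda>G x. ennreal (exp (- ((y - (\<Sum>j\<in>G. x j *s a j)) \<bullet> (L *v (y - (\<Sum>j\<in>G. x j *s a j))))))"
    have "(\<integral>\<^sup>+x. ?f (insert k F) x \<partial>PiM (insert k F) (\<lambda>_. cgauss1))
        = (\<integral>\<^sup>+z. (\<integral>\<^sup>+x. ?f (insert k F) (x(k := z)) \<partial>PiM F (\<lambda>_. cgauss1)) \<partial>cgauss1)"
      by (rule product_nn_integral_insert_rev) (use insert in measurable)
    also have "\<dots> = (\<integral>\<^sup>+z. ennreal (d / d' * exp (- ((y - z *s a k) \<bullet> (L' *v (y - z *s a k))))) \<partial>cgauss1)"
    proof (intro nn_integral_cong)
      fix z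
      have "y - (\<Sum>j\<in>insert k F. (x(k := z)) j *s a j) = (y - z *s a k) - (\<Sum>j\<in>F. x j *s a j)" for x
      proof -
        have "(\<Sum>j\<in>F. (x(k := z)) j *s a j) = (\<Sum>j\<in>F. x j *s a j)"
          using insert by (intro sum.cong) auto
        then show ?thesis using insert by simp
      qed
      then show "(\<integral>\<^sup>+x. ?f (insert k F) (x(k := z)) \<partial>PiM F (\<lambda>_. cgauss1)) = ennreal (d / d' * exp (- ((y - z *s a k) \<bullet> (L' *v (y - z *s a k)))))"
        using int[of "y - z *s a k"] by (simp only:)
    qed
    also have "\<dots> = (\<integral>\<^sup>+z. ennreal (d / d' * exp (- (y \<bullet> (L' *v y)))) * ennreal (exp (2 * Re (cnj z * cip (a k) (L' *v y)) - (cmod z)\<^sup>2 * l)) \<partial>cgauss1)"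
    proof (intro nn_integral_cong)
      fix z
      have "- ((y - z *s a k) \<bullet> (L' *v (y - z *s a k))) = - (y \<bullet> (L' *v y)) + (2 * Re (cnj z * cip (a k) (L' *v y)) - (cmod z)\<^sup>2 * l)"
        unfolding hermitian_form_diff[OF herm] l_def by simp
      then show "ennreal (d / d' * exp (- ((y - z *s a k) \<bullet> (L' *v (y - z *s a k))))) = ennreal (d / d' * exp (- (y \<bullet> (L' *v y)))) * ennreal (exp (2 * Re (cnj z * cip (a k) (L' *v y)) - (cmod z)\<^sup>2 * l))"
        using d by (simp only: exp_add) (subst ennreal_mult[symmetric], auto simp: mult.assoc)
    qed
    also have "\<dots> = ennreal (d / d' * exp (- (y \<bullet> (L' *v y)))) * ennreal (exp ((cmod (cip (a k) (L' *v y)))\<^sup>2 / (1 + l)) / (1 + l))"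
      unfolding nn_integral_cgauss1_exp[OF l, symmetric] by (rule nn_integral_cmult) auto
    also have "\<dots> = ennreal (d / (d' * (1 + l)) * exp (- (y \<bullet> (rank_one_inv L' (a k) *v y))))"
    proof -
      have "exp (- (y \<bullet> (rank_one_inv L' (a k) *v y))) = exp (- (y \<bullet> (L' *v y))) * exp ((cmod (cip (a k) (L' *v y)))\<^sup>2 / (1 + l))"
        unfolding rank_one_inv_form[OF herm] l_def by (simp flip: exp_add)
      then show ?thesis using d l by (subst ennreal_mult[symmetric]) (auto simp: field_simps)
    qed
    finally show "(\<integral>\<^sup>+x. ?f (insert k F) x \<partial>PiM (insert k F) (\<lambda>_. cgauss1)) = ennreal (d / (d' * (1 + l)) * exp (- (y \<bullet> (rank_one_inv L' (a k) *v y))))" .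
  qed
qed

lemma matrix_vector_mult_sum_columns: "A *v (\<chi> i. x i) = (\<Sum>j\<in>UNIV. x j *s column j A)" for A :: "complex^'n^'m"
  by (simp add: vec_eq_iff matrix_vector_mult_def column_def mult.commute)

text \<open>After division by \<open>pi ^ CARD('r) * d\<close> this is the density at
  \<open>y\<close> of \<open>A *v x\<close> plus independent Gaussian noise of covariance
  \<open>N\<close>: the covariances add.\<close>

lemma gaussian_integral:
  fixes A :: "complex^'n^'r"
  assumes "posinv N L d"
  obtains L' d' where "posinv (N + A ** cadj A) L' d'" "d \<le> d'"
    "\<And>y. (\<integral>\<^sup>+x. ennreal (exp (- ((y - A *v x) \<bullet> (L *v (y - A *v x))))) \<partial>cgauss) = ennreal (d / d' * exp (- (y \<bullet> (L' *v y))))"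
proof -
  obtain L' d' where *: "posinv (N + (\<Sum>j\<in>UNIV. outer (column j A) (column j A))) L' d'" "d \<le> d'"
    "\<And>y. (\<integral>\<^sup>+x. ennreal (exp (- ((y - (\<Sum>j\<in>UNIV. x j *s column j A)) \<bullet> (L *v (y - (\<Sum>j\<in>UNIV. x j *s column j A)))))) \<partial>PiM UNIV (\<lambda>_. cgauss1))
        = ennreal (d / d' * exp (- (y \<bullet> (L' *v y))))"
    using gaussian_integral_PiM[OF assms, of UNIV "\<lambda>j. column j A"] by auto
  show ?thesis
  proof (rule that)
    show "posinv (N + A ** cadj A) L' d'" "d \<le> d'" using * by (simp_all add: mult_cadj_eq_sum_outer)
    show "(\<integral>\<^sup>+x. ennreal (exp (- ((y - A *v x) \<bullet> (L *v (y - A *v x))))) \<partial>cgauss) = ennreal (d / d' * exp (- (y \<bullet> (L' *v y))))" for y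
      by (subst nn_integral_cgauss_coords) (simp_all add: *(3) matrix_vector_mult_sum_columns)
  qed
qed

section \<open>Second moments, exponential moments and shifts\<close>

lemma nn_integral_cgauss1_norm_square: "(\<integral>\<^sup>+z. ennreal ((cmod z)\<^sup>2) \<partial>cgauss1) = 1"
proof -
  have m2: "(\<integral>\<^sup>+x. ennreal (x\<^sup>2 * exp (- x\<^sup>2)) \<partial>lborel) = ennreal (sqrt pi / 2)"
  proof -
    \<comment> \<open>\<open>exp (- x\<^sup>2) / sqrt pi\<close> is the normal density of variance
      1/2, which is the share of each of the two real coordinates.\<close>
    define s where "s = sqrt (1 / 2)"
    have s: "0 < s" "s\<^sup>2 = 1 / 2" by (auto simp: s_def real_sqrt_divide power_divide)
    have "has_bochner_integral lborel (\<lambda>x. normal_density 0 s x * (x - 0) ^ (2 * 1)) (fact (2 * 1) / ((2 / s\<^sup>2) ^ 1 * fact 1))"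
      by (rule normal_moment_even) fact
    then have "has_bochner_integral lborel (\<lambda>x. normal_density 0 s x * x\<^sup>2) (1 / 2)"
      by (simp add: s)
    then have h: "integrable lborel (\<lambda>x. normal_density 0 s x * x\<^sup>2)" "(LBINT x. normal_density 0 s x * x\<^sup>2) = 1 / 2"
      unfolding has_bochner_integral_iff by blast+
    then have "(\<integral>\<^sup>+x. ennreal (normal_density 0 s x * x\<^sup>2) \<partial>lborel) = ennreal (1 / 2)"
      unfolding h(2)[symmetric] by (intro nn_integral_eq_integral) auto
    moreover have "(\<integral>\<^sup>+x. ennreal (x\<^sup>2 * exp (- x\<^sup>2)) \<partial>lborel) = (\<integral>\<^sup>+x. ennreal (sqrt pi) * ennreal (normal_density 0 s x * x\<^sup>2) \<partial>lborel)"
    proof (intro nn_integral_cong)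
      fix x :: real
      have "normal_density 0 s x = exp (- x\<^sup>2) / sqrt pi" 
      proof -
        have "2 * s\<^sup>2 = 1" "2 * pi * s\<^sup>2 = pi" using s by auto
        then show ?thesis by (simp add: normal_density_def)
      qed
      then show "ennreal (x\<^sup>2 * exp (- x\<^sup>2)) = ennreal (sqrt pi) * ennreal (normal_density 0 s x * x\<^sup>2)"
        by (simp flip: ennreal_mult)
    qed
    ultimately have "(\<integral>\<^sup>+x. ennreal (x\<^sup>2 * exp (- x\<^sup>2)) \<partial>lborel) = ennreal (sqrt pi) * ennreal (1 / 2)"
      by (simp only: nn_integral_cmult) (subst nn_integral_cmult, auto)
    then show ?thesis by (simp only: ennreal_mult[symmetric] real_sqrt_ge_zero pi_ge_zero) (simp flip: ennreal_mult)
  qed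
  have m0: "(\<integral>\<^sup>+x. ennreal (exp (- x\<^sup>2)) \<partial>lborel) = ennreal (sqrt pi)"
    using nn_integral_exp_square_real[of 1] by simp
  have half: "(\<integral>\<^sup>+z. ennreal ((z \<bullet> b)\<^sup>2 * exp (- (cmod z)\<^sup>2)) \<partial>lborel) = ennreal (pi / 2)" if b: "b \<in> Basis" for b :: complex
  proof -
    let ?f = "\<lambda>c x. ennreal ((if c = b then x\<^sup>2 else 1) * exp (- x\<^sup>2))"
    have "ennreal ((z \<bullet> b)\<^sup>2 * exp (- (cmod z)\<^sup>2)) = (\<Prod>c\<in>Basis. ?f c (z \<bullet> c))" for z :: complex
      using b by (auto simp: Basis_complex_def cmod_power2 inner_complex_def exp_diff exp_minus field_simps simp flip: ennreal_mult exp_add)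
    then have "(\<integral>\<^sup>+z. ennreal ((z \<bullet> b)\<^sup>2 * exp (- (cmod z)\<^sup>2)) \<partial>lborel) = (\<Prod>c\<in>Basis. \<integral>\<^sup>+x. ?f c x \<partial>lborel)"
      by (simp only:) (rule nn_integral_lborel_prod, auto)
    also have "\<dots> = ennreal (sqrt pi / 2) * ennreal (sqrt pi)"
      using b by (auto simp: Basis_complex_def m0 m2 mult.commute)
    also have "\<dots> = ennreal (pi / 2)" by (simp flip: ennreal_mult)
    finally show ?thesis .
  qed
  have "(\<integral>\<^sup>+z. ennreal ((cmod z)\<^sup>2) \<partial>cgauss1) = (\<integral>\<^sup>+z. ennreal (1 / pi) * (ennreal ((z \<bullet> 1)\<^sup>2 * exp (- (cmod z)\<^sup>2)) + ennreal ((z \<bullet> \<i>)\<^sup>2 * exp (- (cmod z)\<^sup>2))) \<partial>lborel)"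
    by (subst nn_integral_cgauss1) (auto intro!: nn_integral_cong simp: cmod_power2 inner_complex_def field_simps simp flip: ennreal_mult ennreal_plus)
  also have "\<dots> = ennreal (1 / pi) * (ennreal (pi / 2) + ennreal (pi / 2))"
    using half[of 1] half[of "\<i>"] by (simp add: nn_integral_cmult nn_integral_add Basis_complex_def)
  also have "\<dots> = 1" by (simp flip: ennreal_plus ennreal_mult)
  finally show ?thesis .
qed

text \<open>The integrands at \<open>z\<close> and \<open>- z\<close> have the same integral; adding
  them, the parallelogram law removes the cross term without any signed integral.\<close>

lemma nn_integral_cgauss1_norm_affine:
  "(\<integral>\<^sup>+z. ennreal ((norm (y + z *s a))\<^sup>2) \<partial>cgauss1) = ennreal ((norm y)\<^sup>2 + (norm a)\<^sup>2)"
  for a y :: "complex^'n"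
proof -
  let ?f = "\<lambda>z. ennreal ((norm (y + z *s a))\<^sup>2)"
  interpret prob_space cgauss1 by (rule prob_space_cgauss1)
  have sym: "(\<integral>\<^sup>+z. ?f (- z) \<partial>cgauss1) = (\<integral>\<^sup>+z. ?f z \<partial>cgauss1)"
    using nn_integral_lborel_uminus[of "\<lambda>z. ennreal (exp (- (norm z)\<^sup>2) / pi) * ?f z"]
    by (simp add: nn_integral_cgauss1)
  have nsc: "norm (z *s a) = cmod z * norm a" for z
    by (simp add: norm_vec_def L2_set_def norm_mult power_mult_distrib real_sqrt_mult flip: sum_distrib_left)
  have "2 * (\<integral>\<^sup>+z. ?f z \<partial>cgauss1) = (\<integral>\<^sup>+z. ?f z \<partial>cgauss1) + (\<integral>\<^sup>+z. ?f (- z) \<partial>cgauss1)"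
    unfolding sym by (simp add: mult_2)
  also have "\<dots> = (\<integral>\<^sup>+z. ?f z + ?f (- z) \<partial>cgauss1)"
    by (rule nn_integral_add[symmetric]) auto
  also have "\<dots> = (\<integral>\<^sup>+z. 2 * (ennreal ((norm y)\<^sup>2) + ennreal ((norm a)\<^sup>2) * ennreal ((cmod z)\<^sup>2)) \<partial>cgauss1)"
  proof (intro nn_integral_cong)
    fix z
    have "(- z) *s a = - (z *s a)" by (simp add: vec_eq_iff)
    then have "(norm (y + z *s a))\<^sup>2 + (norm (y + (- z) *s a))\<^sup>2 = 2 * ((norm y)\<^sup>2 + (norm a)\<^sup>2 * (cmod z)\<^sup>2)"
      using nsc[of z] by (simp add: power2_norm_eq_inner inner_diff inner_add inner_commute power_mult_distrib)
       (metis nsc power2_norm_eq_inner power_mult_distrib mult.commute)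
    then have "?f z + ?f (- z) = ennreal (2 * ((norm y)\<^sup>2 + (norm a)\<^sup>2 * (cmod z)\<^sup>2))"
      by (simp flip: ennreal_plus)
    then show "?f z + ?f (- z) = 2 * (ennreal ((norm y)\<^sup>2) + ennreal ((norm a)\<^sup>2) * ennreal ((cmod z)\<^sup>2))"
      by (simp add: ennreal_mult ennreal_plus)
  qed
  also have "\<dots> = 2 * (ennreal ((norm y)\<^sup>2) + ennreal ((norm a)\<^sup>2))"
    by (simp add: nn_integral_cmult nn_integral_add nn_integral_cgauss1_norm_square emeasure_space_1[unfolded space_cgauss1])
  finally have "2 * (\<integral>\<^sup>+z. ?f z \<partial>cgauss1) = 2 * (ennreal ((norm y)\<^sup>2) + ennreal ((norm a)\<^sup>2))" .
  then have "(\<integral>\<^sup>+z. ?f z \<partial>cgauss1) = ennreal ((norm y)\<^sup>2) + ennreal ((norm a)\<^sup>2)"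
    by (subst (asm) ennreal_mult_cancel_left) auto
  then show ?thesis by simp
qed

lemma nn_integral_PiM_cgauss1_norm_affine:
  fixes a :: "'i \<Rightarrow> complex^'r"
  assumes "finite F"
  shows "(\<integral>\<^sup>+x. ennreal ((norm (y + (\<Sum>j\<in>F. x j *s a j)))\<^sup>2) \<partial>PiM F (\<lambda>_. cgauss1)) = ennreal ((norm y)\<^sup>2 + (\<Sum>j\<in>F. (norm (a j))\<^sup>2))"
  using assms
proof (induction F arbitrary: y)
  case empty
  show ?case by (subst product_sigma_finite.nn_integral_empty[OF product_sigma_finite_cgauss1]) auto
next
  case (insert k F)
  interpret product_sigma_finite "\<lambda>_::'i. cgauss1" by (rule product_sigma_finite_cgauss1)
  let ?f = "\<lambda>G x. ennreal ((norm (y + (\<Sum>j\<in>G. x j *s a j)))\<^sup>2)"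
  interpret prob_space cgauss1 by (rule prob_space_cgauss1)
  have "(\<integral>\<^sup>+x. ?f (insert k F) x \<partial>PiM (insert k F) (\<lambda>_. cgauss1))
      = (\<integral>\<^sup>+z. (\<integral>\<^sup>+x. ?f (insert k F) (x(k := z)) \<partial>PiM F (\<lambda>_. cgauss1)) \<partial>cgauss1)"
    by (rule product_nn_integral_insert_rev) (use insert in measurable)
  also have "\<dots> = (\<integral>\<^sup>+z. ennreal ((norm (y + z *s a k))\<^sup>2 + (\<Sum>j\<in>F. (norm (a j))\<^sup>2)) \<partial>cgauss1)"
  proof (intro nn_integral_cong)
    fix z
    have "y + (\<Sum>j\<in>insert k F. (x(k := z)) j *s a j) = (y + z *s a k) + (\<Sum>j\<in>F. x j *s a j)" for x
    proof -
      have "(\<Sum>j\<in>F. (x(k := z)) j *s a j) = (\<Sum>j\<in>F. x j *s a j)"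
        using insert by (intro sum.cong) auto
      then show ?thesis using insert by (simp add: add.assoc)
    qed
    then show "(\<integral>\<^sup>+x. ?f (insert k F) (x(k := z)) \<partial>PiM F (\<lambda>_. cgauss1)) = ennreal ((norm (y + z *s a k))\<^sup>2 + (\<Sum>j\<in>F. (norm (a j))\<^sup>2))"
      using insert.IH[of "y + z *s a k"] by (simp only:)
  qed
  also have "\<dots> = (\<integral>\<^sup>+z. ennreal ((norm (y + z *s a k))\<^sup>2) + ennreal (\<Sum>j\<in>F. (norm (a j))\<^sup>2) \<partial>cgauss1)"
    by (intro nn_integral_cong ennreal_plus) (auto intro: sum_nonneg)
  also have "\<dots> = ennreal ((norm y)\<^sup>2 + (norm (a k))\<^sup>2) + ennreal (\<Sum>j\<in>F. (norm (a j))\<^sup>2)"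
    by (subst nn_integral_add) (auto simp: nn_integral_cgauss1_norm_affine emeasure_space_1[unfolded space_cgauss1])
  also have "\<dots> = ennreal ((norm y)\<^sup>2 + (\<Sum>j\<in>insert k F. (norm (a j))\<^sup>2))"
    using insert by (subst ennreal_plus[symmetric]) (auto intro: sum_nonneg simp: add.assoc)
  finally show ?case .
qed

lemma norm_matrix_columns: "(norm A)\<^sup>2 = (\<Sum>j\<in>UNIV. (norm (column j A))\<^sup>2)" for A :: "complex^'n^'m"
proof -
  have "(norm A)\<^sup>2 = (\<Sum>i\<in>UNIV. \<Sum>j\<in>UNIV. (cmod (A $ i $ j))\<^sup>2)"
    by (simp add: norm_vec_def L2_set_def sum_nonneg)
  also have "\<dots> = (\<Sum>j\<in>UNIV. \<Sum>i\<in>UNIV. (cmod (A $ i $ j))\<^sup>2)" by (rule sum.swap)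
  also have "\<dots> = (\<Sum>j\<in>UNIV. (norm (column j A))\<^sup>2)"
    by (simp add: norm_vec_def L2_set_def sum_nonneg column_def)
  finally show ?thesis .
qed

lemma nn_integral_cgauss_norm_affine:
  fixes A :: "complex^'n^'m"
  shows "(\<integral>\<^sup>+x. ennreal ((norm (y + A *v x))\<^sup>2) \<partial>cgauss) = ennreal ((norm y)\<^sup>2 + (norm A)\<^sup>2)"
  by (subst nn_integral_cgauss_coords)
    (simp_all add: matrix_vector_mult_sum_columns nn_integral_PiM_cgauss1_norm_affine norm_matrix_columns)

lemma nn_integral_cgauss_exp_norm:
  assumes "t < 1"
  shows "(\<integral>\<^sup>+x. ennreal (exp (t * (norm x)\<^sup>2)) \<partial>(cgauss :: (complex^'n) measure)) < \<infinity>"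
proof -
  have "(\<integral>\<^sup>+x. ennreal (exp (t * (norm x)\<^sup>2)) \<partial>(cgauss :: (complex^'n) measure))
     = (\<integral>\<^sup>+x. ennreal (1 / pi ^ CARD('n)) * ennreal (exp (- (1 - t) * (norm x)\<^sup>2)) \<partial>(lborel :: (complex^'n) measure))"
    by (subst nn_integral_cgauss) (auto intro!: nn_integral_cong simp: algebra_simps simp flip: ennreal_mult exp_add)
  also have "\<dots> = ennreal (1 / pi ^ CARD('n)) * ennreal (sqrt (pi / (1 - t)) ^ DIM(complex^'n))"
    using nn_integral_exp_norm_square[of "1 - t", where 'a="complex^'n"] assms by (simp add: nn_integral_cmult)
  also have "\<dots> < \<infinity>" by (simp add: ennreal_mult_less_top)
  finally show ?thesis .
qed

text \<open>The exponential factor is the density of the Gaussian law centred at \<open>m\<close>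
  with respect to \<open>cgauss\<close>, so weighting by it amounts to a shift.\<close>

lemma nn_integral_cgauss_shift:
  fixes m :: "complex^'n"
  assumes [measurable]: "f \<in> borel_measurable borel"
  shows "(\<integral>\<^sup>+u. ennreal (exp ((norm u)\<^sup>2 - (norm (u - m))\<^sup>2)) * f u \<partial>cgauss) = (\<integral>\<^sup>+v. f (m + v) \<partial>cgauss)"
proof -
  let ?c = "pi ^ CARD('n)"
  have "(\<integral>\<^sup>+u. ennreal (exp ((norm u)\<^sup>2 - (norm (u - m))\<^sup>2)) * f u \<partial>cgauss)
     = (\<integral>\<^sup>+u. ennreal (exp (- (norm (u - m))\<^sup>2) / ?c) * f u \<partial>lborel)"
    by (subst nn_integral_cgauss) (auto intro!: nn_integral_cong simp: mult.assoc[symmetric] simp flip: ennreal_mult exp_add)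
  also have "\<dots> = (\<integral>\<^sup>+v. ennreal (exp (- (norm (m + v - m))\<^sup>2) / ?c) * f (m + v) \<partial>lborel)"
    by (rule nn_integral_lborel_translate[symmetric]) measurable
  also have "\<dots> = (\<integral>\<^sup>+v. f (m + v) \<partial>cgauss)"
    by (subst nn_integral_cgauss) auto
  finally show ?thesis .
qed

section \<open>Exponential moments\<close>

text \<open>By convexity of \<open>exp\<close> the difference quotient at 0 increases with
  \<open>t\<close> and stays above the derivative. The outer bounds do not depend on
  \<open>t\<close>, so they provide a dominating function for \<open>t\<close> tending to 0.\<close>

lemma exp_diff_quotient_bounds:
  fixes x t t0 :: real
  assumes "0 < t" "t \<le> t0"
  shows "x \<le> (exp (t * x) - 1) / t" "(exp (t * x) - 1) / t \<le> (exp (t0 * x) - 1) / t0"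
proof -
  show "x \<le> (exp (t * x) - 1) / t"
    using assms exp_ge_add_one_self[of "t * x"] by (simp add: field_simps)
  have "exp (t * x) \<le> (1 - t / t0) * exp 0 + t / t0 * exp (t0 * x)"
  proof -
    have "exp ((1 - t / t0) *\<^sub>R 0 + (t / t0) *\<^sub>R (t0 * x)) \<le> (1 - t / t0) * exp 0 + t / t0 * exp (t0 * x)"
      using assms convex_on_exp[of "1::real"] by (intro convex_onD[where A=UNIV]) auto
    then show ?thesis using assms by simp
  qed
  then have "exp (t * x) - 1 \<le> t * ((exp (t0 * x) - 1) / t0)"
    by (simp add: algebra_simps diff_divide_distrib)
  then show "(exp (t * x) - 1) / t \<le> (exp (t0 * x) - 1) / t0"
    using assms by (subst pos_divide_le_eq) (auto simp: mult.commute)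
qed

text \<open>Differentiation under the integral at 0 from the right, by dominated convergence.
  Besides integrability of \<open>X\<close>, one finite exponential moment at a positive
  \<open>t0\<close> suffices.\<close>

lemma (in prob_space) exp_moment_derivative:
  fixes X :: "'a \<Rightarrow> real"
  assumes X: "integrable M X" and t0: "0 < t0" and eX: "integrable M (\<lambda>x. exp (t0 * X x))"
  shows "((\<lambda>t. (expectation (\<lambda>x. exp (t * X x)) - 1) / t) \<longlongrightarrow> expectation X) (at_right 0)"
    and "\<And>t. 0 < t \<Longrightarrow> t \<le> t0 \<Longrightarrow> integrable M (\<lambda>x. exp (t * X x))"
proof -
  have [measurable]: "X \<in> borel_measurable M" using X by auto
  define q where "q t x = (exp (t * X x) - 1) / t" for t x
  define w where "w x = \<bar>X x\<bar> + \<bar>(exp (t0 * X x) - 1) / t0\<bar>" for x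
  have w: "integrable M w" unfolding w_def
    using X eX by (intro Bochner_Integration.integrable_add integrable_abs Bochner_Integration.integrable_divide Bochner_Integration.integrable_diff) auto
  have qw: "norm (q t x) \<le> w x" if "0 < t" "t \<le> t0" for t x
    using exp_diff_quotient_bounds[OF that, of "X x"] unfolding q_def w_def real_norm_def by linarith
  have q_meas[measurable]: "q t \<in> borel_measurable M" for t unfolding q_def[abs_def] by measurable
  have qi: "integrable M (q t)" if "0 < t" "t \<le> t0" for t
    by (rule Bochner_Integration.integrable_bound[OF w]) (use qw[OF that] in \<open>auto intro!: AE_I2 order_trans[OF _ abs_ge_self]\<close>)
  show ei: "integrable M (\<lambda>x. exp (t * X x))" if "0 < t" "t \<le> t0" for t
  proof -
    have "integrable M (\<lambda>x. t * q t x + 1)" using qi[OF that] by simp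
    then show ?thesis using that by (simp add: q_def)
  qed
  have lim: "((\<lambda>t. expectation (q t)) \<longlongrightarrow> expectation X) (at_right 0)"
  proof (rule tendsto_at_right_sequentially[where b=t0])
    show "0 < t0" by fact
    fix S :: "nat \<Rightarrow> real"
    assume S: "\<And>n. 0 < S n" "\<And>n. S n < t0" "decseq S" "S \<longlonglongrightarrow> 0"
    show "(\<lambda>n. expectation (q (S n))) \<longlonglongrightarrow> expectation X"
    proof (rule integral_dominated_convergence[where w=w])
      show "AE x in M. (\<lambda>n. q (S n) x) \<longlonglongrightarrow> X x"
      proof (rule AE_I2)
        fix x
        have "((\<lambda>t. exp (t * X x)) has_real_derivative X x) (at 0)"
          by (auto intro!: derivative_eq_intros)
        then have "(\<lambda>t. (exp (t * X x) - 1) / t) \<midarrow>0\<rightarrow> X x"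
          by (simp add: DERIV_def)
        moreover have "filterlim S (at 0) sequentially"
          using S(1,4) by (auto simp: filterlim_at less_imp_neq[THEN not_sym] intro!: always_eventually)
        ultimately show "(\<lambda>n. q (S n) x) \<longlonglongrightarrow> X x"
          unfolding q_def by (rule filterlim_compose)
      qed
      show "AE x in M. norm (q (S n) x) \<le> w x" for n
        using S(1,2)[of n] qw[of "S n"] by (intro AE_I2) simp
    qed (use w in auto)
  qed
  have "\<forall>\<^sub>F t in at_right 0. expectation (q t) = (expectation (\<lambda>x. exp (t * X x)) - 1) / t"
    unfolding eventually_at_right_field
  proof (intro exI[of _ t0] conjI allI impI t0)
    fix t assume "0 < t" "t < t0"
    then show "expectation (q t) = (expectation (\<lambda>x. exp (t * X x)) - 1) / t"
      using ei[of t] by (simp add: q_def[abs_def] prob_space)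
  qed
  then show "((\<lambda>t. (expectation (\<lambda>x. exp (t * X x)) - 1) / t) \<longlongrightarrow> expectation X) (at_right 0)"
    using lim by (rule Lim_transform_eventually[rotated])
qed

text \<open>At \<open>t = 0\<close> the weighted sum is 1 and has the slope
  \<open>\<Sum>i\<in>I. l i * m i\<close>, so for small \<open>t\<close> it is below
  \<open>1 + t * r\<close>, hence below \<open>exp (t * r)\<close>. Only the mixture counts: a
  single \<open>m i\<close> may exceed \<open>r\<close>.\<close>

lemma eventually_exp_moment_lt:
  fixes M :: "'j \<Rightarrow> 'a measure" and X :: "'j \<Rightarrow> 'a \<Rightarrow> real"
  assumes "finite I" and l: "(\<Sum>i\<in>I. l i) = 1" "\<And>i. i \<in> I \<Longrightarrow> 0 \<le> l i"
    and M: "\<And>i. i \<in> I \<Longrightarrow> prob_space (M i)"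
    and X: "\<And>i. i \<in> I \<Longrightarrow> has_bochner_integral (M i) (X i) (m i)"
    and eX: "\<And>i. i \<in> I \<Longrightarrow> \<exists>t0>0. integrable (M i) (\<lambda>x. exp (t0 * X i x))"
    and r: "(\<Sum>i\<in>I. l i * m i) < r"
  shows "\<forall>\<^sub>F t in at_right 0. (\<Sum>i\<in>I. ennreal (l i) * (\<integral>\<^sup>+x. ennreal (exp (t * X i x)) \<partial>M i)) < ennreal (exp (t * r))"
proof -
  define f where "f i t = (LINT x|M i. exp (t * X i x))" for i t
  have lim: "((\<lambda>t. (f i t - 1) / t) \<longlongrightarrow> m i) (at_right 0)" if i: "i \<in> I" for i
  proof -
    interpret prob_space "M i" using M i .
    obtain t0 where "0 < t0" "integrable (M i) (\<lambda>x. exp (t0 * X i x))" using eX[OF i] by blast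
    from exp_moment_derivative(1)[OF _ this] X[OF i] show ?thesis
      by (auto simp: f_def has_bochner_integral_iff)
  qed
  have ev: "\<forall>\<^sub>F t in at_right 0. (\<integral>\<^sup>+x. ennreal (exp (t * X i x)) \<partial>M i) = ennreal (f i t)" if i: "i \<in> I" for i
  proof -
    interpret prob_space "M i" using M i .
    obtain t0 where t0: "0 < t0" "integrable (M i) (\<lambda>x. exp (t0 * X i x))" using eX[OF i] by blast
    have "(\<integral>\<^sup>+x. ennreal (exp (t * X i x)) \<partial>M i) = ennreal (f i t)" if "0 < t" "t < t0" for t
      unfolding f_def using exp_moment_derivative(2)[OF _ t0, of t] X[OF \<open>i \<in> I\<close>] that
      by (intro nn_integral_eq_integral) (auto simp: has_bochner_integral_iff)
    then show ?thesis unfolding eventually_at_right_field using t0 by blast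
  qed
  have "((\<lambda>t. \<Sum>i\<in>I. l i * ((f i t - 1) / t)) \<longlongrightarrow> (\<Sum>i\<in>I. l i * m i)) (at_right 0)"
    using lim by (intro tendsto_sum tendsto_mult tendsto_const)
  then have "\<forall>\<^sub>F t in at_right 0. (\<Sum>i\<in>I. l i * ((f i t - 1) / t)) < r"
    using r by (rule order_tendstoD)
  moreover have "\<forall>\<^sub>F t in at_right 0. \<forall>i\<in>I. (\<integral>\<^sup>+x. ennreal (exp (t * X i x)) \<partial>M i) = ennreal (f i t)"
    using \<open>finite I\<close> ev by (intro eventually_ball_finite) auto
  moreover have "\<forall>\<^sub>F t in at_right (0::real). 0 < t" by (simp add: eventually_at_right_less)
  ultimately show ?thesis
  proof eventually_elim
    case (elim t)
    have f0: "0 \<le> f i t" for i unfolding f_def by (rule integral_nonneg_AE) auto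
    have "(\<Sum>i\<in>I. l i * ((f i t - 1) / t)) = ((\<Sum>i\<in>I. l i * f i t) - 1) / t"
      by (simp add: l right_diff_distrib diff_divide_distrib sum_subtractf flip: sum_divide_distrib)
    then have "((\<Sum>i\<in>I. l i * f i t) - 1) / t < r" using elim(1) by (simp only:)
    then have "(\<Sum>i\<in>I. l i * f i t) < 1 + t * r" using elim(3) by (simp add: pos_divide_less_eq mult.commute)
    also have "\<dots> \<le> exp (t * r)" by (rule exp_ge_add_one_self)
    finally have lt: "(\<Sum>i\<in>I. l i * f i t) < exp (t * r)" .
    have "(\<Sum>i\<in>I. ennreal (l i) * (\<integral>\<^sup>+x. ennreal (exp (t * X i x)) \<partial>M i)) = (\<Sum>i\<in>I. ennreal (l i * f i t))"
      using elim l f0 by (intro sum.cong refl) (simp add: ennreal_mult)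
    also have "\<dots> = ennreal (\<Sum>i\<in>I. l i * f i t)"
      using l f0 by (intro sum_ennreal) auto
    also have "\<dots> < ennreal (exp (t * r))" using lt f0 l by (intro ennreal_lessI) auto
    finally show ?case .
  qed
qed

section \<open>Block codes from single-letter metrics\<close>

lemma sets_noise [measurable_cong, simp]: "sets (noise n) = sets (PiM {..<n} (\<lambda>_. borel))"
  unfolding noise_def by (intro sets_PiM_cong) auto

lemma prob_space_noise: "prob_space (noise n)"
  unfolding noise_def by (intro prob_space_PiM prob_space_cgauss)

lemma nn_integral_noise_prod:
  fixes f :: "nat \<Rightarrow> complex^'a \<Rightarrow> ennreal"
  assumes "\<And>i. i < n \<Longrightarrow> f i \<in> borel_measurable borel"
  shows "(\<integral>\<^sup>+x. (\<Prod>i<n. f i (x i)) \<partial>noise n) = (\<Prod>i<n. \<integral>\<^sup>+x. f i x \<partial>cgauss)"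
proof -
  interpret product_sigma_finite "\<lambda>_::nat. cgauss :: (complex^'a) measure"
    using prob_space_imp_sigma_finite[OF prob_space_cgauss] by (simp add: product_sigma_finite_def)
  show ?thesis unfolding noise_def using assms by (intro product_nn_integral_prod) auto
qed

lemma nn_integral_noise_prod2:
  fixes f :: "nat \<Rightarrow> complex^'a \<Rightarrow> complex^'b \<Rightarrow> ennreal"
  assumes "\<And>i. i < n \<Longrightarrow> (\<lambda>(u, s). f i u s) \<in> borel_measurable (borel \<Otimes>\<^sub>M borel)"
  shows "(\<integral>\<^sup>+s. (\<integral>\<^sup>+u. (\<Prod>i<n. f i (u i) (s i)) \<partial>noise n) \<partial>noise n) = (\<Prod>i<n. \<integral>\<^sup>+s. (\<integral>\<^sup>+u. f i u s \<partial>cgauss) \<partial>cgauss)"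
proof -
  interpret g: prob_space "cgauss :: (complex^'a) measure" by (rule prob_space_cgauss)
  note [measurable] = measurable_case_prod2[OF assms]
  have "(\<integral>\<^sup>+s. (\<integral>\<^sup>+u. (\<Prod>i<n. f i (u i) (s i)) \<partial>noise n) \<partial>noise n) = (\<integral>\<^sup>+s. (\<Prod>i<n. \<integral>\<^sup>+u. f i u (s i) \<partial>cgauss) \<partial>noise n)"
    by (intro nn_integral_cong nn_integral_noise_prod[where f="\<lambda>i u. f i u (s i)" for s]) auto
  also have "\<dots> = (\<Prod>i<n. \<integral>\<^sup>+s. (\<integral>\<^sup>+u. f i u s \<partial>cgauss) \<partial>cgauss)"
    by (intro nn_integral_noise_prod g.borel_measurable_nn_integral) (auto simp: split_def)
  finally show ?thesis .
qed

lemma nn_integral_noise_prod3: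
  fixes f :: "nat \<Rightarrow> complex^'a \<Rightarrow> complex^'b \<Rightarrow> complex^'c \<Rightarrow> ennreal"
  assumes "\<And>i. i < n \<Longrightarrow> (\<lambda>(u, s, z). f i u s z) \<in> borel_measurable (borel \<Otimes>\<^sub>M borel \<Otimes>\<^sub>M borel)"
  shows "(\<integral>\<^sup>+s. (\<integral>\<^sup>+u. (\<integral>\<^sup>+z. (\<Prod>i<n. f i (u i) (s i) (z i)) \<partial>noise n) \<partial>noise n) \<partial>noise n)
    = (\<Prod>i<n. \<integral>\<^sup>+s. (\<integral>\<^sup>+u. (\<integral>\<^sup>+z. f i u s z \<partial>cgauss) \<partial>cgauss) \<partial>cgauss)"
proof -
  interpret g: prob_space "cgauss :: (complex^'c) measure" by (rule prob_space_cgauss)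
  note [measurable] = measurable_case_prod3[OF assms]
  have "(\<integral>\<^sup>+s. (\<integral>\<^sup>+u. (\<integral>\<^sup>+z. (\<Prod>i<n. f i (u i) (s i) (z i)) \<partial>noise n) \<partial>noise n) \<partial>noise n)
      = (\<integral>\<^sup>+s. (\<integral>\<^sup>+u. (\<Prod>i<n. \<integral>\<^sup>+z. f i (u i) (s i) z \<partial>cgauss) \<partial>noise n) \<partial>noise n)"
    by (intro nn_integral_cong nn_integral_noise_prod[where f="\<lambda>i z. f i (u i) (s i) z" for u s]) auto
  also have "\<dots> = (\<Prod>i<n. \<integral>\<^sup>+s. (\<integral>\<^sup>+u. (\<integral>\<^sup>+z. f i u s z \<partial>cgauss) \<partial>cgauss) \<partial>cgauss)"
    by (intro nn_integral_noise_prod2[where f="\<lambda>i u s. \<integral>\<^sup>+z. f i u s z \<partial>cgauss"]) (auto simp: split_def)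
  finally show ?thesis .
qed

lemma prod_ennreal_le_1:
  fixes f :: "'a \<Rightarrow> ennreal"
  assumes "\<And>i. i \<in> A \<Longrightarrow> f i \<le> 1" shows "prod f A \<le> 1"
  using assms
proof (induction A rule: infinite_finite_induct)
  case (insert x F)
  then show ?case using mult_mono[of "f x" 1 "prod f F" 1] by auto
qed auto

lemma emeasure_le_nn_integral:
  assumes "\<And>x. x \<in> A \<Longrightarrow> 1 \<le> f x"
  shows "emeasure M A \<le> (\<integral>\<^sup>+x. f x \<partial>M)"
proof (cases "A \<in> sets M")
  case True
  then have "emeasure M A = (\<integral>\<^sup>+x. indicator A x \<partial>M)" by simp
  also have "\<dots> \<le> (\<integral>\<^sup>+x. f x \<partial>M)" using assms by (intro nn_integral_mono) (auto simp: indicator_def)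
  finally show ?thesis .
qed (simp add: emeasure_notin_sets)

lemma one_le_sum_if:
  assumes "finite A" "k \<in> A" "P k" shows "(1::ennreal) \<le> (\<Sum>m\<in>A. if P m then 1 else 0)"
  using assms member_le_sum[of k A "\<lambda>m. if P m then 1 else 0 :: ennreal"] by auto

text \<open>Covers every way in which a decoder returning the least passing message fails, including
  the unspecified value of \<open>LEAST\<close> when no message passes: then \<open>m\<close> does
  not pass either.\<close>

lemma Least_message_neq:
  fixes m :: nat
  assumes "(LEAST k. k \<in> A \<and> P k) \<noteq> m" "m \<in> A"
  shows "\<not> P m \<or> (\<exists>k\<in>A - {m}. P k)"
proof (rule ccontr)
  assume "\<not> ?thesis"
  then have P: "P m" and uniq: "\<forall>k\<in>A. P k \<longrightarrow> k = m" by auto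
  have "(LEAST k. k \<in> A \<and> P k) = m"
  proof (rule Least_equality)
    show "m \<in> A \<and> P m" using P assms(2) by blast
    fix y assume "y \<in> A \<and> P y"
    with uniq have "y = m" by blast
    then show "m \<le> y" by simp
  qed
  then show False using assms(1) by simp
qed

text \<open>Brings the truncated loss \<open>min 1 (g / J)\<close> of the bin selection into the
  exponential form of Chernoff's bound. For negative \<open>x\<close> this relies on
  \<open>t \<le> 1\<close>.\<close>

lemma min_exp_le_exp_mult:
  fixes x t :: real
  assumes "0 < t" "t \<le> 1"
  shows "min 1 (exp x) \<le> exp (t * x)"
proof (cases "0 \<le> x")
  case True
  then show ?thesis using assms by (simp add: min.coboundedI1)
next
  case False
  then have "x \<le> t * x" using assms mult_right_mono_neg[of t 1 x] by simp
  then show ?thesis by (simp add: min.coboundedI2)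
qed

text \<open>A union bound in which the true message counts as missed as soon as the index
  \<open>j0\<close> that was sent fails, while a wrong message may pass at any of the
  \<open>J\<close> indices.\<close>

lemma threshold_decoder_error:
  fixes L :: "nat \<Rightarrow> nat \<Rightarrow> 'z \<Rightarrow> real"
  assumes fin: "finite M" and m: "m \<in> M" and j0: "j0 < J"
    and L: "\<And>k j. k \<in> M \<Longrightarrow> j < J \<Longrightarrow> L k j \<in> borel_measurable N"
  shows "emeasure N {z \<in> space N. (LEAST k. k \<in> M \<and> (\<exists>j<J. c < L k j z)) \<noteq> m}
    \<le> (\<integral>\<^sup>+z. (if L m j0 z \<le> c then 1 else 0) \<partial>N) + (\<Sum>k\<in>M - {m}. \<Sum>j<J. \<integral>\<^sup>+z. (if c < L k j z then 1 else 0) \<partial>N)"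
proof -
  let ?s = "\<lambda>z. \<Sum>k\<in>M - {m}. \<Sum>j<J. (if c < L k j z then 1 else 0 :: ennreal)"
  have Lm: "(\<lambda>z. if c < L k j z then 1 else 0 :: ennreal) \<in> borel_measurable N" if "k \<in> M" "j < J" for k j
    using L[OF that] by measurable
  have "emeasure N {z \<in> space N. (LEAST k. k \<in> M \<and> (\<exists>j<J. c < L k j z)) \<noteq> m} \<le> (\<integral>\<^sup>+z. (if L m j0 z \<le> c then 1 else 0) + ?s z \<partial>N)"
  proof (rule emeasure_le_nn_integral)
    fix z assume "z \<in> {z \<in> space N. (LEAST k. k \<in> M \<and> (\<exists>j<J. c < L k j z)) \<noteq> m}"
    then have "(LEAST k. k \<in> M \<and> (\<exists>j<J. c < L k j z)) \<noteq> m" by simp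
    from Least_message_neq[OF this m] show "1 \<le> (if L m j0 z \<le> c then 1 else 0) + ?s z"
    proof
      assume "\<not> (\<exists>j<J. c < L m j z)"
      then have "\<not> c < L m j0 z" using j0 by blast
      then show ?thesis by (simp add: not_less)
    next
      assume "\<exists>k\<in>M - {m}. \<exists>j<J. c < L k j z"
      then obtain k j where k: "k \<in> M - {m}" "j < J" "c < L k j z" by blast
      have "1 \<le> (\<Sum>j<J. (if c < L k j z then 1 else 0 :: ennreal))"
        using k by (intro one_le_sum_if[where k=j]) auto
      also have "\<dots> \<le> ?s z" using k fin by (intro member_le_sum) auto
      finally show ?thesis by (rule order_trans) simp
    qed
  qed
  also have "\<dots> = (\<integral>\<^sup>+z. (if L m j0 z \<le> c then 1 else 0) \<partial>N) + (\<integral>\<^sup>+z. ?s z \<partial>N)"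
    using L[OF m j0] by (intro nn_integral_add borel_measurable_sum Lm) auto
  also have "(\<integral>\<^sup>+z. ?s z \<partial>N) = (\<Sum>k\<in>M - {m}. \<Sum>j<J. \<integral>\<^sup>+z. (if c < L k j z then 1 else 0) \<partial>N)"
    by (subst nn_integral_sum) (auto intro!: sum.cong nn_integral_sum borel_measurable_sum Lm)
  finally show ?thesis .
qed

lemma exp_sum_ennreal: "ennreal (exp (\<Sum>i<n. a i)) = (\<Prod>i<n. ennreal (exp (a i)))" for a :: "nat \<Rightarrow> real"
  by (simp add: exp_sum prod_ennreal)

lemma measurable_noise_component:
  "f \<in> measurable N (noise n) \<Longrightarrow> i < n \<Longrightarrow> (\<lambda>x. f x i) \<in> borel_measurable N"
  using measurable_compose[OF _ measurable_component_singleton[of i "{..<n}" "\<lambda>_. borel"], of f N]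
  by (simp cong: measurable_cong_sets)

text \<open>Markov's inequality for \<open>exp\<close> of the block metric. The codeword
  \<open>x\<close> is independent of what is received, so by Fubini it can be integrated first with
  the received word fixed, where \<open>int\<close> applies letter by letter.\<close>

lemma metric_threshold_le:
  fixes q :: "nat \<Rightarrow> complex^'a \<Rightarrow> complex^'b \<Rightarrow> real" and y :: "nat \<Rightarrow> complex^'b"
  assumes q: "\<And>i. (\<lambda>(x, y). q i x y) \<in> borel_measurable (borel \<Otimes>\<^sub>M borel)"
    and int: "\<And>i y. (\<integral>\<^sup>+x. ennreal (exp (q i x y)) \<partial>cgauss) \<le> 1"
  shows "(\<integral>\<^sup>+x. (\<integral>\<^sup>+z. (if n * r < (\<Sum>i<n. q i (x i) (y i + z i)) then 1 else 0) \<partial>noise n) \<partial>noise n) \<le> ennreal (exp (- (n * r)))"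
proof -
  interpret NX: prob_space "noise n :: (nat \<Rightarrow> complex^'a) measure" by (rule prob_space_noise)
  interpret NZ: prob_space "noise n :: (nat \<Rightarrow> complex^'b) measure" by (rule prob_space_noise)
  interpret pair_sigma_finite "noise n :: (nat \<Rightarrow> complex^'a) measure" "noise n :: (nat \<Rightarrow> complex^'b) measure" ..
  define L where "L x z = (\<Sum>i<n. q i (x i) (y i + z i))" for x z
  have L: "(\<lambda>w. L (f w) (g w)) \<in> borel_measurable N" if "f \<in> measurable N (noise n)" "g \<in> measurable N (noise n)" for f g and N :: "'n measure"
    unfolding L_def using that
    by (intro borel_measurable_sum measurable_case_prod2[OF q] borel_measurable_add borel_measurable_const measurable_noise_component) auto
  note [measurable] = L measurable_case_prod2[OF q]
  have "(\<integral>\<^sup>+x. (\<integral>\<^sup>+z. (if n * r < L x z then 1 else 0) \<partial>noise n) \<partial>noise n)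
      \<le> (\<integral>\<^sup>+x. (\<integral>\<^sup>+z. ennreal (exp (- (n * r))) * ennreal (exp (L x z)) \<partial>noise n) \<partial>noise n)"
    by (intro nn_integral_mono) (auto simp flip: ennreal_mult exp_add)
  also have "\<dots> = (\<integral>\<^sup>+z. (\<integral>\<^sup>+x. ennreal (exp (- (n * r))) * ennreal (exp (L x z)) \<partial>noise n) \<partial>noise n)"
    by (rule Fubini'[symmetric]) measurable
  also have "\<dots> \<le> (\<integral>\<^sup>+z. ennreal (exp (- (n * r))) \<partial>(noise n :: (nat \<Rightarrow> complex^'b) measure))"
  proof (intro nn_integral_mono)
    fix z :: "nat \<Rightarrow> complex^'b" assume [measurable]: "z \<in> space (noise n)"
    have "(\<integral>\<^sup>+x. ennreal (exp (L x z)) \<partial>noise n) = (\<Prod>i<n. \<integral>\<^sup>+x. ennreal (exp (q i x (y i + z i))) \<partial>cgauss)"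
      unfolding L_def exp_sum_ennreal
      by (rule nn_integral_noise_prod[where f="\<lambda>i x. ennreal (exp (q i x (y i + z i)))"]) measurable
    also have "\<dots> \<le> 1" by (intro prod_ennreal_le_1 int)
    finally show "(\<integral>\<^sup>+x. ennreal (exp (- (n * r))) * ennreal (exp (L x z)) \<partial>noise n) \<le> ennreal (exp (- (n * r)))"
      by (subst nn_integral_cmult) (auto intro: mult_left_le)
  qed
  finally show ?thesis by (simp add: NZ.emeasure_space_1 L_def)
qed

text \<open>
  The index \<open>j\<close> selects one of several operating points, for time sharing. For a primary letter \<open>s\<close> and an auxiliary
  letter \<open>u\<close>, the noiseless channel outputs are \<open>fp\<close> and \<open>fc\<close> and the energies of the inputs \<open>ep\<close> and \<open>ec\<close>. The metric
  \<open>l1\<close> is the log-likelihood ratio of \<open>u\<close> given \<open>s\<close>; \<open>l2\<close> and \<open>l3\<close> are the decoding metrics.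
\<close>

locale letter_scheme =
  fixes l1 :: "'j \<Rightarrow> complex^'c \<Rightarrow> complex^'k \<Rightarrow> real"
    and l2 :: "'j \<Rightarrow> complex^'c \<Rightarrow> complex^'r \<Rightarrow> real"
    and l3 :: "'j \<Rightarrow> complex^'k \<Rightarrow> complex^'p \<Rightarrow> real"
    and fp :: "'j \<Rightarrow> complex^'c \<Rightarrow> complex^'k \<Rightarrow> complex^'p"
    and fc :: "'j \<Rightarrow> complex^'c \<Rightarrow> complex^'k \<Rightarrow> complex^'r"
    and ep :: "'j \<Rightarrow> complex^'k \<Rightarrow> real"
    and ec :: "'j \<Rightarrow> complex^'c \<Rightarrow> complex^'k \<Rightarrow> real"
  assumes l1_m: "\<And>j. (\<lambda>(u, s). l1 j u s) \<in> borel_measurable (borel \<Otimes>\<^sub>M borel)"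
    and l2_m: "\<And>j. (\<lambda>(u, y). l2 j u y) \<in> borel_measurable (borel \<Otimes>\<^sub>M borel)"
    and l3_m: "\<And>j. (\<lambda>(s, y). l3 j s y) \<in> borel_measurable (borel \<Otimes>\<^sub>M borel)"
    and fp_m: "\<And>j. (\<lambda>(u, s). fp j u s) \<in> borel_measurable (borel \<Otimes>\<^sub>M borel)"
    and fc_m: "\<And>j. (\<lambda>(u, s). fc j u s) \<in> borel_measurable (borel \<Otimes>\<^sub>M borel)"
    and ep_m[measurable]: "\<And>j. ep j \<in> borel_measurable borel"
    and ec_m: "\<And>j. (\<lambda>(u, s). ec j u s) \<in> borel_measurable (borel \<Otimes>\<^sub>M borel)"
    and l1_int: "\<And>j s. (\<integral>\<^sup>+u. ennreal (exp (l1 j u s)) \<partial>cgauss) = 1"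
    and l2_int: "\<And>j y. (\<integral>\<^sup>+u. ennreal (exp (l2 j u y)) \<partial>cgauss) \<le> 1"
    and l3_int: "\<And>j y. (\<integral>\<^sup>+s. ennreal (exp (l3 j s y)) \<partial>cgauss) \<le> 1"
begin

lemmas meas [measurable (raw)] =
  measurable_case_prod2[OF l1_m] measurable_case_prod2[OF l2_m] measurable_case_prod2[OF l3_m] measurable_case_prod2[OF ec_m]

lemma meas_fp [measurable (raw)]: "f \<in> borel_measurable N \<Longrightarrow> g \<in> borel_measurable N \<Longrightarrow> (\<lambda>x. fp j (f x) (g x)) \<in> borel_measurable N"
  using measurable_compose[OF measurable_Pair fp_m] by simp

lemma meas_fc [measurable (raw)]: "f \<in> borel_measurable N \<Longrightarrow> g \<in> borel_measurable N \<Longrightarrow> (\<lambda>x. fc j (f x) (g x)) \<in> borel_measurable N"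
  using measurable_compose[OF measurable_Pair fc_m] by simp

text \<open>The moment generating function of \<open>X j\<close> at \<open>t\<close> when
  \<open>s\<close> and \<open>z\<close> are standard Gaussian and \<open>u\<close> has the
  conditional density \<open>exp (l1 j u s)\<close> given \<open>s\<close>, which is the law that
  ideal likelihood-ratio selection would produce.\<close>

definition tilt :: "real \<Rightarrow> ('j \<Rightarrow> complex^'c \<Rightarrow> complex^'k \<Rightarrow> complex^'z \<Rightarrow> real) \<Rightarrow> 'j \<Rightarrow> ennreal" where
  "tilt t X j = (\<integral>\<^sup>+s. (\<integral>\<^sup>+u. (\<integral>\<^sup>+z. ennreal (exp (l1 j u s + t * X j u s z)) \<partial>cgauss) \<partial>cgauss) \<partial>cgauss)"

text \<open>
  The five letter variables whose block sums are nonnegative in the bad events: the likelihood ratio exceeds the bin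
  size, a true codeword falls below the decoding threshold, or a power budget is violated. The noise letter is
  a dummy argument of \<open>x1\<close>, \<open>x4\<close> and \<open>x5\<close>, so that all five are treated alike.
\<close>

definition x1 :: "real \<Rightarrow> 'j \<Rightarrow> complex^'c \<Rightarrow> complex^'k \<Rightarrow> complex^'c \<Rightarrow> real" where "x1 r j u s z = l1 j u s - r"
definition x2 where "x2 r j u s z = r - l2 j u (fc j u s + z)"
definition x3 where "x3 r j u s z = r - l3 j s (fp j u s + z)"
definition x4 :: "real \<Rightarrow> 'j \<Rightarrow> complex^'c \<Rightarrow> complex^'k \<Rightarrow> complex^'c \<Rightarrow> real" where "x4 P j u s z = ep j s - P"
definition x5 :: "real \<Rightarrow> 'j \<Rightarrow> complex^'c \<Rightarrow> complex^'k \<Rightarrow> complex^'c \<Rightarrow> real" where "x5 P j u s z = ec j u s - P"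

lemma x_meas:
  "(\<lambda>(u, s, z). x1 r j u s z) \<in> borel_measurable (borel \<Otimes>\<^sub>M borel \<Otimes>\<^sub>M borel)"
  "(\<lambda>(u, s, z). x2 r j u s z) \<in> borel_measurable (borel \<Otimes>\<^sub>M borel \<Otimes>\<^sub>M borel)"
  "(\<lambda>(u, s, z). x3 r j u s z) \<in> borel_measurable (borel \<Otimes>\<^sub>M borel \<Otimes>\<^sub>M borel)"
  "(\<lambda>(u, s, z). x4 r j u s z) \<in> borel_measurable (borel \<Otimes>\<^sub>M borel \<Otimes>\<^sub>M borel)"
  "(\<lambda>(u, s, z). x5 r j u s z) \<in> borel_measurable (borel \<Otimes>\<^sub>M borel \<Otimes>\<^sub>M borel)"
  unfolding x1_def x2_def x3_def x4_def x5_def by measurable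

text \<open>Power violation and both error probabilities are added into one cost, so that a single
  averaging argument controls all of them simultaneously.\<close>

definition pair_cost :: "nat \<Rightarrow> (nat \<Rightarrow> 'j) \<Rightarrow> real \<Rightarrow> real \<Rightarrow> (nat \<Rightarrow> nat \<Rightarrow> complex^'k) \<Rightarrow> (nat \<Rightarrow> nat \<Rightarrow> nat \<Rightarrow> complex^'c)
    \<Rightarrow> ((nat \<Rightarrow> complex^'p) \<Rightarrow> nat) \<Rightarrow> ((nat \<Rightarrow> complex^'r) \<Rightarrow> nat) \<Rightarrow> nat \<Rightarrow> nat \<Rightarrow> ennreal" where
  "pair_cost n \<tau> Pp Pc S V Dp Dc mp mc =
    (if n * Pp < (\<Sum>i<n. ep (\<tau> i) (S mp i)) \<or> n * Pc < (\<Sum>i<n. ec (\<tau> i) (V mp mc i) (S mp i)) then 1 else 0)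
    + emeasure (noise n) {z \<in> space (noise n). Dp (restrict (\<lambda>i. fp (\<tau> i) (V mp mc i) (S mp i) + z i) {..<n}) \<noteq> mp}
    + emeasure (noise n) {z \<in> space (noise n). Dc (restrict (\<lambda>i. fc (\<tau> i) (V mp mc i) (S mp i) + z i) {..<n}) \<noteq> mc}"

definition block_prob :: "nat \<Rightarrow> (nat \<Rightarrow> 'j) \<Rightarrow> ('j \<Rightarrow> complex^'c \<Rightarrow> complex^'k \<Rightarrow> complex^'z \<Rightarrow> real) \<Rightarrow> (nat \<Rightarrow> complex^'c) \<Rightarrow> (nat \<Rightarrow> complex^'k) \<Rightarrow> ennreal" where
  "block_prob n \<tau> X u s = (\<integral>\<^sup>+z. (if 0 \<le> (\<Sum>i<n. X (\<tau> i) (u i) (s i) (z i)) then 1 else 0) \<partial>noise n)"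

lemma block_prob_le_1: "block_prob n \<tau> X u s \<le> 1"
  for X :: "'j \<Rightarrow> complex^'c \<Rightarrow> complex^'k \<Rightarrow> complex^'z \<Rightarrow> real"
proof -
  interpret prob_space "noise n :: (nat \<Rightarrow> complex^'z) measure" by (rule prob_space_noise)
  have "block_prob n \<tau> X u s \<le> (\<integral>\<^sup>+z. 1 \<partial>(noise n :: (nat \<Rightarrow> complex^'z) measure))"
    unfolding block_prob_def by (intro nn_integral_mono) auto
  then show ?thesis by (simp add: emeasure_space_1)
qed

context
  fixes n :: nat and \<tau> :: "nat \<Rightarrow> 'j" and X :: "'j \<Rightarrow> complex^'c \<Rightarrow> complex^'k \<Rightarrow> complex^'z \<Rightarrow> real"
  assumes X: "\<And>j. (\<lambda>(u, s, z). X j u s z) \<in> borel_measurable (borel \<Otimes>\<^sub>M borel \<Otimes>\<^sub>M borel)"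
begin

lemma block_sum_measurable [measurable (raw)]:
  "f \<in> measurable N (noise n) \<Longrightarrow> g \<in> measurable N (noise n) \<Longrightarrow> h \<in> measurable N (noise n) \<Longrightarrow>
    (\<lambda>x. \<Sum>i<n. X (\<tau> i) (f x i) (g x i) (h x i)) \<in> borel_measurable N"
  by (intro borel_measurable_sum measurable_case_prod3[OF X] measurable_noise_component) auto

lemma block_prob_measurable:
  assumes [measurable]: "f \<in> measurable N (noise n)" "g \<in> measurable N (noise n)"
  shows "(\<lambda>x. block_prob n \<tau> X (f x) (g x)) \<in> borel_measurable N"
proof -
  interpret prob_space "noise n :: (nat \<Rightarrow> complex^'z) measure" by (rule prob_space_noise)
  show ?thesis unfolding block_prob_def by measurable
qed

text \<open>The indicator of a nonnegative sum is at most \<open>exp\<close> of \<open>t\<close>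
  times the sum; the integrand then is a product over the letters.\<close>

lemma chernoff_block:
  assumes t: "0 < t"
  shows "(\<integral>\<^sup>+s. (\<integral>\<^sup>+u. ennreal (exp (\<Sum>i<n. l1 (\<tau> i) (u i) (s i))) * block_prob n \<tau> X u s \<partial>noise n) \<partial>noise n) \<le> (\<Prod>i<n. tilt t X (\<tau> i))"
proof -
  let ?l = "\<lambda>u s. \<Sum>i<n. l1 (\<tau> i) (u i) (s i)" and ?x = "\<lambda>u s z. \<Sum>i<n. X (\<tau> i) (u i) (s i) (z i)"
  note [measurable] = measurable_case_prod3[OF X]
  let ?p = "\<lambda>u s z. \<Prod>i<n. ennreal (exp (l1 (\<tau> i) (u i) (s i) + t * X (\<tau> i) (u i) (s i) (z i)))"
  have "(\<integral>\<^sup>+s. (\<integral>\<^sup>+u. ennreal (exp (?l u s)) * block_prob n \<tau> X u s \<partial>noise n) \<partial>noise n) \<le> (\<integral>\<^sup>+s. (\<integral>\<^sup>+u. (\<integral>\<^sup>+z. ?p u s z \<partial>noise n) \<partial>noise n) \<partial>noise n)"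
  proof (intro nn_integral_mono)
    fix u :: "nat \<Rightarrow> complex^'c" and s :: "nat \<Rightarrow> complex^'k" assume [measurable]: "u \<in> space (noise n)" "s \<in> space (noise n)"
    have "ennreal (exp (?l u s)) * block_prob n \<tau> X u s = (\<integral>\<^sup>+z. ennreal (exp (?l u s)) * (if 0 \<le> ?x u s z then 1 else 0) \<partial>noise n)"
      unfolding block_prob_def by (rule nn_integral_cmult[symmetric]) measurable
    also have "\<dots> \<le> (\<integral>\<^sup>+z. ?p u s z \<partial>noise n)"
    proof (intro nn_integral_mono)
      fix z
      have "ennreal (exp (?l u s)) * (if 0 \<le> ?x u s z then 1 else 0) \<le> ennreal (exp (?l u s)) * ennreal (exp (t * ?x u s z))"
        using t by (intro mult_left_mono) auto
      also have "\<dots> = ?p u s z"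
        unfolding exp_sum_ennreal[symmetric] by (simp add: sum.distrib sum_distrib_left flip: ennreal_mult exp_add)
      finally show "ennreal (exp (?l u s)) * (if 0 \<le> ?x u s z then 1 else 0) \<le> ?p u s z" .
    qed
    finally show "ennreal (exp (?l u s)) * block_prob n \<tau> X u s \<le> (\<integral>\<^sup>+z. ?p u s z \<partial>noise n)" .
  qed
  also have "\<dots> = (\<Prod>i<n. tilt t X (\<tau> i))"
    unfolding tilt_def
    by (rule nn_integral_noise_prod3[where f="\<lambda>i u s z. ennreal (exp (l1 (\<tau> i) u s + t * X (\<tau> i) u s z))"])
       measurable
  finally show ?thesis .
qed

end

text \<open>Four of the five bad events form the cost \<open>c0\<close>, which is at most 4. The
  fifth, a likelihood ratio exceeding the bin size, is the selection loss, and it is multiplied by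
  this bound 4.\<close>

lemma block_code_exists:
  fixes n J :: nat and \<tau> :: "nat \<Rightarrow> 'j" and t r1 r2 r3 Pp Pc :: real and Mp Mc :: "nat set"
  assumes t: "0 < t" "t \<le> 1" and fin: "finite Mp" "finite Mc" and J: "exp (n * r1) \<le> real J"
  obtains S V Dp Dc where
    "Dp \<in> measurable (PiM {..<n} (\<lambda>_. borel)) (count_space UNIV)"
    "Dc \<in> measurable (PiM {..<n} (\<lambda>_. borel)) (count_space UNIV)"
    "(\<Sum>mp\<in>Mp. \<Sum>mc\<in>Mc. pair_cost n \<tau> Pp Pc S V Dp Dc mp mc)
     \<le> of_nat (card Mp * card Mc) *
        (4 * (\<Prod>i<n. tilt t (x1 r1) (\<tau> i)) + (\<Prod>i<n. tilt t (x2 r2) (\<tau> i)) + (\<Prod>i<n. tilt t (x3 r3) (\<tau> i))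
         + (\<Prod>i<n. tilt t (x4 Pp) (\<tau> i)) + (\<Prod>i<n. tilt t (x5 Pc) (\<tau> i))
         + of_nat (card Mp - 1) * ennreal (exp (- (n * r3))) + of_nat ((card Mc - 1) * J) * ennreal (exp (- (n * r2))))"
proof -
  have Jpos: "0 < J" using J by (metis exp_gt_zero less_le_trans of_nat_0_less_iff)
  define L1 where "L1 u s = (\<Sum>i<n. l1 (\<tau> i) (u i) (s i))" for u s
  define L2 where "L2 u s u' z = (\<Sum>i<n. l2 (\<tau> i) (u' i) (fc (\<tau> i) (u i) (s i) + z i))" for u s u' z
  define L3 where "L3 u s s' z = (\<Sum>i<n. l3 (\<tau> i) (s' i) (fp (\<tau> i) (u i) (s i) + z i))" for u s s' z
  note cmp = measurable_noise_component
  have L1_meas[measurable]: "(\<lambda>x. L1 (f x) (g x)) \<in> borel_measurable N"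
    if "f \<in> measurable N (noise n)" "g \<in> measurable N (noise n)" for f g and N :: "'n measure"
    unfolding L1_def using that by (intro borel_measurable_sum meas cmp) auto
  have L2_meas[measurable]: "(\<lambda>x. L2 (f x) (g x) (f' x) (h x)) \<in> borel_measurable N"
    if "f \<in> measurable N (noise n)" "f' \<in> measurable N (noise n)" "g \<in> measurable N (noise n)" "h \<in> measurable N (noise n)" for f f' g h and N :: "'n measure"
    unfolding L2_def using that by (intro borel_measurable_sum meas borel_measurable_add meas_fc cmp) auto
  have L3_meas[measurable]: "(\<lambda>x. L3 (f x) (g x) (g' x) (h x)) \<in> borel_measurable N"
    if "f \<in> measurable N (noise n)" "g \<in> measurable N (noise n)" "g' \<in> measurable N (noise n)" "h \<in> measurable N (noise n)" for f g g' h and N :: "'n measure"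
    unfolding L3_def using that by (intro borel_measurable_sum meas borel_measurable_add meas_fp cmp) auto
  interpret NP: prob_space "noise n :: (nat \<Rightarrow> complex^'p) measure" by (rule prob_space_noise)
  interpret NR: prob_space "noise n :: (nat \<Rightarrow> complex^'r) measure" by (rule prob_space_noise)
  interpret NU: prob_space "noise n :: (nat \<Rightarrow> complex^'c) measure" by (rule prob_space_noise)
  define k2 where "k2 u s u' = (\<integral>\<^sup>+z. (if n * r2 < L2 u s u' z then 1 else 0) \<partial>noise n)" for u s u'
  define k3 where "k3 u s s' = (\<integral>\<^sup>+z. (if n * r3 < L3 u s s' z then 1 else 0) \<partial>noise n)" for u s s'
  let ?b = "block_prob n \<tau>"
  define w where "w u s = exp (L1 u s)" for u s
  define c0 where "c0 u s = enn2real (?b (x2 r2) u s) + enn2real (?b (x3 r3) u s) + enn2real (?b (x4 Pp) u s) + enn2real (?b (x5 Pc) u s)" for u s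
  have en: "ennreal (enn2real (?b X u s)) = ?b X u s" "enn2real (?b X u s) \<le> 1"
    for u s and X :: "'j \<Rightarrow> complex^'c \<Rightarrow> complex^'k \<Rightarrow> complex^'z \<Rightarrow> real"
    using block_prob_le_1[of n \<tau> X u s] by (auto simp: ennreal_enn2real_if top_unique enn2real_leI)
  have c0_enn: "ennreal (c0 u s) = ?b (x2 r2) u s + ?b (x3 r3) u s + ?b (x4 Pp) u s + ?b (x5 Pc) u s" for u s
    unfolding c0_def by (simp add: ennreal_plus en)
  note b_meas[measurable] = block_prob_measurable[OF x_meas(2)] block_prob_measurable[OF x_meas(3)] block_prob_measurable[OF x_meas(4)] block_prob_measurable[OF x_meas(5)]

  obtain S U sel where SU: "\<And>m. m \<in> Mp \<Longrightarrow> S m \<in> space (noise n)"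
    "\<And>m j. m \<in> Mc \<Longrightarrow> j < J \<Longrightarrow> U m j \<in> space (noise n)" "\<And>mp mc. sel mp mc < J"
    and bound: "(\<Sum>mp\<in>Mp. \<Sum>mc\<in>Mc. ennreal (c0 (U mc (sel mp mc)) (S mp))
        + (\<Sum>m\<in>Mp - {mp}. k3 (U mc (sel mp mc)) (S mp) (S m))
        + (\<Sum>m\<in>Mc - {mc}. \<Sum>j<J. k2 (U mc (sel mp mc)) (S mp) (U m j)))
      \<le> of_nat (card Mp * card Mc) *
        ((\<integral>\<^sup>+s. (\<integral>\<^sup>+u. ennreal (w u s * c0 u s) \<partial>noise n) \<partial>noise n)
         + ennreal 4 * (\<integral>\<^sup>+s. (\<integral>\<^sup>+u. ennreal (w u s * min 1 (w u s / J)) \<partial>noise n) \<partial>noise n)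
         + of_nat (card Mp - 1) * ennreal (exp (- (n * r3))) + of_nat ((card Mc - 1) * J) * ennreal (exp (- (n * r2))))"
  proof (rule random_binning_code_exists[of "noise n" "noise n" w c0 k3 k2 4 "ennreal (exp (- (n * r3)))" "ennreal (exp (- (n * r2)))" Mp Mc J])
    show "(\<lambda>(u, s). w u s) \<in> borel_measurable (noise n \<Otimes>\<^sub>M noise n)"
      unfolding w_def by measurable
    show "(\<lambda>(u, s). c0 u s) \<in> borel_measurable (noise n \<Otimes>\<^sub>M noise n)"
      unfolding c0_def by measurable
    show "(\<lambda>(u, s, s'). k3 u s s') \<in> borel_measurable (noise n \<Otimes>\<^sub>M noise n \<Otimes>\<^sub>M noise n)"
      unfolding k3_def by measurable
    show "(\<lambda>(u, s, u'). k2 u s u') \<in> borel_measurable (noise n \<Otimes>\<^sub>M noise n \<Otimes>\<^sub>M noise n)"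
      unfolding k2_def by measurable
    show "(\<integral>\<^sup>+u. ennreal (w u s) \<partial>noise n) = 1" for s
      unfolding w_def L1_def exp_sum_ennreal
      by (subst nn_integral_noise_prod[where f="\<lambda>i u. ennreal (exp (l1 (\<tau> i) u (s i)))"]) (auto simp: l1_int)
    show "0 \<le> c0 u s" "c0 u s \<le> 4" for u s
      unfolding c0_def using en(2)[of "x2 r2" u s] en(2)[of "x3 r3" u s] en(2)[of "x4 Pp" u s] en(2)[of "x5 Pc" u s] by auto
    show "(\<integral>\<^sup>+s'. k3 u s s' \<partial>noise n) \<le> ennreal (exp (- (n * r3)))" for u s
      unfolding k3_def L3_def by (rule metric_threshold_le[where q="\<lambda>i. l3 (\<tau> i)", OF l3_m l3_int])
    show "(\<integral>\<^sup>+u'. k2 u s u' \<partial>noise n) \<le> ennreal (exp (- (n * r2)))" for u s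
      unfolding k2_def L2_def by (rule metric_threshold_le[where q="\<lambda>i. l2 (\<tau> i)", OF l2_m l2_int])
  qed (use fin Jpos prob_space_noise in \<open>auto simp: w_def\<close>)

  \<comment> \<open>\<open>J \<ge> exp (n * r1)\<close> bounds \<open>w u s / J\<close> by
    \<open>exp (L1 u s - n * r1)\<close>. Integrating additionally over the dummy noise of total
    mass 1 gives this term the shape of a \<open>tilt\<close>.\<close>
  have T1: "ennreal 4 * (\<integral>\<^sup>+s. (\<integral>\<^sup>+u. ennreal (w u s * min 1 (w u s / J)) \<partial>noise n) \<partial>noise n) \<le> 4 * (\<Prod>i<n. tilt t (x1 r1) (\<tau> i))"
  proof -
    let ?p = "\<lambda>u s z. \<Prod>i<n. ennreal (exp (l1 (\<tau> i) (u i) (s i) + t * x1 r1 (\<tau> i) (u i) (s i) (z i)))"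
    have "(\<integral>\<^sup>+s. (\<integral>\<^sup>+u. ennreal (w u s * min 1 (w u s / J)) \<partial>noise n) \<partial>noise n) \<le> (\<integral>\<^sup>+s. (\<integral>\<^sup>+u. (\<integral>\<^sup>+z. ?p u s z \<partial>noise n) \<partial>noise n) \<partial>noise n)"
    proof (intro nn_integral_mono)
      fix u :: "nat \<Rightarrow> complex^'c" and s :: "nat \<Rightarrow> complex^'k"
      have "w u s / J \<le> exp (L1 u s - n * r1)"
        unfolding w_def exp_diff using J Jpos by (intro divide_left_mono) auto
      then have "min 1 (w u s / J) \<le> min 1 (exp (L1 u s - n * r1))" by simp
      also have "\<dots> \<le> exp (t * (L1 u s - n * r1))" by (rule min_exp_le_exp_mult) fact+
      finally have "w u s * min 1 (w u s / J) \<le> w u s * exp (t * (L1 u s - n * r1))"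
        by (simp add: w_def)
      also have "\<dots> = exp (\<Sum>i<n. l1 (\<tau> i) (u i) (s i) + t * (l1 (\<tau> i) (u i) (s i) - r1))"
        unfolding w_def exp_add[symmetric] L1_def
        by (simp add: sum.distrib sum_subtractf right_diff_distrib sum_distrib_left)
      finally show "ennreal (w u s * min 1 (w u s / J)) \<le> (\<integral>\<^sup>+z. ?p u s z \<partial>noise n)"
        unfolding exp_sum_ennreal[symmetric] x1_def by (simp add: ennreal_leI NU.emeasure_space_1)
    qed
    also have "\<dots> = (\<Prod>i<n. tilt t (x1 r1) (\<tau> i))"
      unfolding tilt_def x1_def
      by (rule nn_integral_noise_prod3[where f="\<lambda>i u s z. ennreal (exp (l1 (\<tau> i) u s + t * (l1 (\<tau> i) u s - r1)))"]) measurable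
    finally show ?thesis by (simp add: mult_left_mono)
  qed
  have w_meas[measurable]: "(\<lambda>x. w (f x) (g x)) \<in> borel_measurable N"
    if [measurable]: "f \<in> measurable N (noise n)" "g \<in> measurable N (noise n)" for f g and N :: "'n measure"
    unfolding w_def by measurable
  have add2: "(\<integral>\<^sup>+s. (\<integral>\<^sup>+u. f u s + g u s \<partial>noise n) \<partial>noise n) = (\<integral>\<^sup>+s. (\<integral>\<^sup>+u. f u s \<partial>noise n) \<partial>noise n) + (\<integral>\<^sup>+s. (\<integral>\<^sup>+u. g u s \<partial>noise n) \<partial>noise n)"
    if fm: "(\<lambda>(u, s). f u s) \<in> borel_measurable (noise n \<Otimes>\<^sub>M noise n)" and gm: "(\<lambda>(u, s). g u s) \<in> borel_measurable (noise n \<Otimes>\<^sub>M noise n)"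
    for f g :: "(nat \<Rightarrow> complex^'c) \<Rightarrow> (nat \<Rightarrow> complex^'k) \<Rightarrow> ennreal"
  proof -
    note [measurable] = measurable_case_prod2[OF fm] measurable_case_prod2[OF gm]
    have "(\<integral>\<^sup>+s. (\<integral>\<^sup>+u. f u s + g u s \<partial>noise n) \<partial>noise n) = (\<integral>\<^sup>+s. (\<integral>\<^sup>+u. f u s \<partial>noise n) + (\<integral>\<^sup>+u. g u s \<partial>noise n) \<partial>noise n)"
      by (intro nn_integral_cong nn_integral_add) measurable
    also have "\<dots> = (\<integral>\<^sup>+s. (\<integral>\<^sup>+u. f u s \<partial>noise n) \<partial>noise n) + (\<integral>\<^sup>+s. (\<integral>\<^sup>+u. g u s \<partial>noise n) \<partial>noise n)"
      by (intro nn_integral_add) measurable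
    finally show ?thesis .
  qed
  have T0: "(\<integral>\<^sup>+s. (\<integral>\<^sup>+u. ennreal (w u s * c0 u s) \<partial>noise n) \<partial>noise n)
     \<le> (\<Prod>i<n. tilt t (x2 r2) (\<tau> i)) + (\<Prod>i<n. tilt t (x3 r3) (\<tau> i)) + (\<Prod>i<n. tilt t (x4 Pp) (\<tau> i)) + (\<Prod>i<n. tilt t (x5 Pc) (\<tau> i))"
  proof -
    have "ennreal (w u s * c0 u s) = ennreal (w u s) * ?b (x2 r2) u s + ennreal (w u s) * ?b (x3 r3) u s
        + ennreal (w u s) * ?b (x4 Pp) u s + ennreal (w u s) * ?b (x5 Pc) u s" for u s
    proof -
      have "ennreal (w u s * c0 u s) = ennreal (w u s) * ennreal (c0 u s)"
        by (rule ennreal_mult) (auto simp: w_def c0_def)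
      then show ?thesis unfolding c0_enn by (simp add: distrib_left)
    qed
    then have "(\<integral>\<^sup>+s. (\<integral>\<^sup>+u. ennreal (w u s * c0 u s) \<partial>noise n) \<partial>noise n)
      = (\<integral>\<^sup>+s. (\<integral>\<^sup>+u. ennreal (w u s) * ?b (x2 r2) u s \<partial>noise n) \<partial>noise n) + (\<integral>\<^sup>+s. (\<integral>\<^sup>+u. ennreal (w u s) * ?b (x3 r3) u s \<partial>noise n) \<partial>noise n)
       + (\<integral>\<^sup>+s. (\<integral>\<^sup>+u. ennreal (w u s) * ?b (x4 Pp) u s \<partial>noise n) \<partial>noise n) + (\<integral>\<^sup>+s. (\<integral>\<^sup>+u. ennreal (w u s) * ?b (x5 Pc) u s \<partial>noise n) \<partial>noise n)"
      by (simp only:) (subst add2, measurable)+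
    also have "\<dots> \<le> (\<Prod>i<n. tilt t (x2 r2) (\<tau> i)) + (\<Prod>i<n. tilt t (x3 r3) (\<tau> i)) + (\<Prod>i<n. tilt t (x4 Pp) (\<tau> i)) + (\<Prod>i<n. tilt t (x5 Pc) (\<tau> i))"
      unfolding w_def L1_def by (intro add_mono chernoff_block x_meas t)
    finally show ?thesis .
  qed

  \<comment> \<open>The range \<open>j<1\<close> is a dummy: it lets the primary decoder, with one
    codeword per message, share \<open>threshold_decoder_error\<close> with the cognitive decoder,
    which searches whole bins.\<close>
  define Dp where "Dp y = (LEAST m. m \<in> Mp \<and> (\<exists>j<1::nat. n * r3 < (\<Sum>i<n. l3 (\<tau> i) (S m i) (y i))))" for y
  define Dc where "Dc y = (LEAST m. m \<in> Mc \<and> (\<exists>j<J. n * r2 < (\<Sum>i<n. l2 (\<tau> i) (U m j i) (y i))))" for y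
  have cmpb: "(\<lambda>y. y i) \<in> borel_measurable (PiM {..<n} (\<lambda>_. borel))" if "i < n" for i
    using that by simp
  show ?thesis
  proof (rule that[of Dp Dc S "\<lambda>mp mc. U mc (sel mp mc)"])
    have [measurable]: "(\<lambda>y. \<Sum>i<n. l3 (\<tau> i) (S m i) (y i)) \<in> borel_measurable (PiM {..<n} (\<lambda>_. borel))" for m
      by (intro borel_measurable_sum meas cmpb) auto
    have [measurable]: "(\<lambda>y. \<Sum>i<n. l2 (\<tau> i) (U m j i) (y i)) \<in> borel_measurable (PiM {..<n} (\<lambda>_. borel))" for m j
      by (intro borel_measurable_sum meas cmpb) auto
    show "Dp \<in> measurable (PiM {..<n} (\<lambda>_. borel)) (count_space UNIV)"
      unfolding Dp_def by measurable
    show "Dc \<in> measurable (PiM {..<n} (\<lambda>_. borel)) (count_space UNIV)"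
      unfolding Dc_def by measurable
    let ?c = "pair_cost n \<tau> Pp Pc S (\<lambda>mp mc. U mc (sel mp mc)) Dp Dc"
    have "(\<Sum>mp\<in>Mp. \<Sum>mc\<in>Mc. ?c mp mc)
      \<le> (\<Sum>mp\<in>Mp. \<Sum>mc\<in>Mc. ennreal (c0 (U mc (sel mp mc)) (S mp))
        + (\<Sum>m\<in>Mp - {mp}. k3 (U mc (sel mp mc)) (S mp) (S m))
        + (\<Sum>m\<in>Mc - {mc}. \<Sum>j<J. k2 (U mc (sel mp mc)) (S mp) (U m j)))"
    proof (intro sum_mono)
      fix mp mc assume m: "mp \<in> Mp" "mc \<in> Mc"
      let ?v = "U mc (sel mp mc)" and ?s = "S mp"
      have sp: "?v \<in> space (noise n)" "?s \<in> space (noise n)" using SU m by auto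
      have B: "(if n * Pp < (\<Sum>i<n. ep (\<tau> i) (?s i)) \<or> n * Pc < (\<Sum>i<n. ec (\<tau> i) (?v i) (?s i)) then 1 else 0) \<le> ?b (x4 Pp) ?v ?s + ?b (x5 Pc) ?v ?s"
        unfolding block_prob_def x4_def x5_def by (auto simp: sum_subtractf NU.emeasure_space_1 add_increasing add_increasing2)
      have L3r: "(\<Sum>i<n. l3 (\<tau> i) (S m i) (restrict (\<lambda>i. fp (\<tau> i) (?v i) (?s i) + z i) {..<n} i)) = L3 ?v ?s (S m) z" for m z
        unfolding L3_def by (intro sum.cong) auto
      have L2r: "(\<Sum>i<n. l2 (\<tau> i) (U m j i) (restrict (\<lambda>i. fc (\<tau> i) (?v i) (?s i) + z i) {..<n} i)) = L2 ?v ?s (U m j) z" for m j z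
        unfolding L2_def by (intro sum.cong) auto
      have P3: "emeasure (noise n) {z \<in> space (noise n). Dp (restrict (\<lambda>i. fp (\<tau> i) (?v i) (?s i) + z i) {..<n}) \<noteq> mp} \<le> ?b (x3 r3) ?v ?s + (\<Sum>m\<in>Mp - {mp}. k3 ?v ?s (S m))"
      proof -
        have "(\<lambda>z. L3 ?v ?s (S m) z) \<in> borel_measurable (noise n)" if "m \<in> Mp" for m
          using that SU sp by (intro L3_meas) auto
        from threshold_decoder_error[OF fin(1) m(1), of 0 1 "\<lambda>m j z. L3 ?v ?s (S m) z", OF _ this, of "n * r3"]
        show ?thesis unfolding Dp_def L3r k3_def block_prob_def x3_def by (simp add: L3_def sum_subtractf)
      qed
      have P2: "emeasure (noise n) {z \<in> space (noise n). Dc (restrict (\<lambda>i. fc (\<tau> i) (?v i) (?s i) + z i) {..<n}) \<noteq> mc} \<le> ?b (x2 r2) ?v ?s + (\<Sum>m\<in>Mc - {mc}. \<Sum>j<J. k2 ?v ?s (U m j))"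
      proof -
        have "(\<lambda>z. L2 ?v ?s (U m j) z) \<in> borel_measurable (noise n)" if "m \<in> Mc" "j < J" for m j
          using that SU sp by (intro L2_meas) auto
        from threshold_decoder_error[OF fin(2) m(2) SU(3), of "\<lambda>m j z. L2 ?v ?s (U m j) z" "noise n" "n * r2" mp mc, OF this]
        show ?thesis unfolding Dc_def L2r k2_def block_prob_def x2_def by (simp add: L2_def sum_subtractf)
      qed
      have "?c mp mc \<le> (?b (x4 Pp) ?v ?s + ?b (x5 Pc) ?v ?s) + (?b (x3 r3) ?v ?s + (\<Sum>m\<in>Mp - {mp}. k3 ?v ?s (S m)))
         + (?b (x2 r2) ?v ?s + (\<Sum>m\<in>Mc - {mc}. \<Sum>j<J. k2 ?v ?s (U m j)))"
        unfolding pair_cost_def by (intro add_mono B P2 P3)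
      also have "\<dots> = ennreal (c0 ?v ?s) + (\<Sum>m\<in>Mp - {mp}. k3 ?v ?s (S m)) + (\<Sum>m\<in>Mc - {mc}. \<Sum>j<J. k2 ?v ?s (U m j))"
        unfolding c0_enn by (simp only: add_ac)
      finally show "?c mp mc \<le> \<dots>" .
    qed
    also note bound
    also have "of_nat (card Mp * card Mc) *
        ((\<integral>\<^sup>+s. (\<integral>\<^sup>+u. ennreal (w u s * c0 u s) \<partial>noise n) \<partial>noise n)
         + ennreal 4 * (\<integral>\<^sup>+s. (\<integral>\<^sup>+u. ennreal (w u s * min 1 (w u s / J)) \<partial>noise n) \<partial>noise n)
         + of_nat (card Mp - 1) * ennreal (exp (- (n * r3))) + of_nat ((card Mc - 1) * J) * ennreal (exp (- (n * r2))))
       \<le> of_nat (card Mp * card Mc) *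
        (((\<Prod>i<n. tilt t (x2 r2) (\<tau> i)) + (\<Prod>i<n. tilt t (x3 r3) (\<tau> i)) + (\<Prod>i<n. tilt t (x4 Pp) (\<tau> i)) + (\<Prod>i<n. tilt t (x5 Pc) (\<tau> i)))
         + 4 * (\<Prod>i<n. tilt t (x1 r1) (\<tau> i))
         + of_nat (card Mp - 1) * ennreal (exp (- (n * r3))) + of_nat ((card Mc - 1) * J) * ennreal (exp (- (n * r2))))"
      by (intro mult_left_mono add_mono T0 T1 order_refl) auto
    finally show "(\<Sum>mp\<in>Mp. \<Sum>mc\<in>Mc. ?c mp mc)
     \<le> of_nat (card Mp * card Mc) *
        (4 * (\<Prod>i<n. tilt t (x1 r1) (\<tau> i)) + (\<Prod>i<n. tilt t (x2 r2) (\<tau> i)) + (\<Prod>i<n. tilt t (x3 r3) (\<tau> i))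
         + (\<Prod>i<n. tilt t (x4 Pp) (\<tau> i)) + (\<Prod>i<n. tilt t (x5 Pc) (\<tau> i))
         + of_nat (card Mp - 1) * ennreal (exp (- (n * r3))) + of_nat ((card Mc - 1) * J) * ennreal (exp (- (n * r2))))"
      by (simp only: add_ac)
  qed
qed

end

section \<open>Time sharing and growing block length\<close>

lemma weighted_average_witness:
  fixes f :: "'a \<Rightarrow> ennreal"
  assumes "finite A" "(\<Sum>x\<in>A. w x) = 1"
  shows "\<exists>x\<in>A. f x \<le> (\<Sum>x\<in>A. w x * f x)"
proof -
  have ne: "A \<noteq> {}" using assms by auto
  define c where "c = Min (f ` A)"
  have "c \<in> f ` A" unfolding c_def using assms ne by (intro Min_in) auto
  then obtain x where x: "x \<in> A" "c = f x" by auto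
  have "c = (\<Sum>x\<in>A. w x * c)" by (simp add: assms flip: sum_distrib_right)
  also have "\<dots> \<le> (\<Sum>x\<in>A. w x * f x)"
    using assms by (intro sum_mono mult_left_mono) (auto simp: c_def)
  finally show ?thesis using x by auto
qed

text \<open>Distributivity; this is what turns an average over all schedules with product weights
  into an n-th power.\<close>

lemma sum_PiE_prod_power:
  fixes f :: "'j \<Rightarrow> ennreal"
  assumes "finite I"
  shows "(\<Sum>\<tau>\<in>PiE {..<n} (\<lambda>_. I). \<Prod>i<n. f (\<tau> i)) = (\<Sum>j\<in>I. f j) ^ n"
proof -
  have "(\<Prod>i<n. \<Sum>j\<in>I. f j) = (\<Sum>\<tau>\<in>PiE {..<n} (\<lambda>_. I). \<Prod>i<n. f (\<tau> i))"
    using assms by (intro prod_sum_PiE) auto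
  then show ?thesis by simp
qed

lemma card_msgs: "card (msgs n R) = nat \<lceil>2 powr (real n * R)\<rceil>"
  by (simp add: msgs_def)

lemma card_msgs_pos: "0 < card (msgs n R)"
  by (simp add: card_msgs)

lemma finite_msgs: "finite (msgs n R)"
  by (simp add: msgs_def)

lemma msgs_zero_rate: "msgs n 0 = {1}"
  by (simp add: msgs_def)

text \<open>Leaving out the true message compensates for the rounding up in \<open>msgs\<close>, so
  the number of wrong messages obeys the unrounded bound.\<close>

lemma card_msgs_minus_1_le: "real (card (msgs n R) - 1) \<le> exp (real n * (R * ln 2))"
proof -
  have "real (card (msgs n R) - 1) = real (card (msgs n R)) - 1"
    using card_msgs_pos[of n R] by (simp add: of_nat_diff)
  also have "\<dots> = of_int \<lceil>2 powr (real n * R)\<rceil> - 1"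
    by (simp add: card_msgs)
  also have "\<dots> \<le> 2 powr (real n * R)" using ceiling_correct[of "2 powr (real n * R)"] by linarith
  also have "\<dots> = exp (real n * (R * ln 2))" by (simp add: powr_def)
  finally show ?thesis .
qed

lemma exp_mult_nat_tendsto_0:
  assumes "a < 0" shows "(\<lambda>n. exp (real n * a)) \<longlonglongrightarrow> 0"
proof -
  have "(\<lambda>n. exp a ^ n) \<longlonglongrightarrow> 0" using assms by (intro LIMSEQ_realpow_zero) auto
  then show ?thesis by (simp add: exp_of_nat_mult)
qed

context letter_scheme
begin

definition good_code :: "'j set \<Rightarrow> nat \<Rightarrow> real \<Rightarrow> real \<Rightarrow> real \<Rightarrow> real \<Rightarrow> real \<Rightarrow> bool" where
  "good_code I n Pp Pc Rp Rc eps \<longleftrightarrow> (\<exists>\<tau> S V Dp Dc. \<tau> \<in> PiE {..<n} (\<lambda>_. I) \<and>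
    Dp \<in> measurable (PiM {..<n} (\<lambda>_. borel)) (count_space UNIV) \<and>
    Dc \<in> measurable (PiM {..<n} (\<lambda>_. borel)) (count_space UNIV) \<and>
    (\<Sum>mp\<in>msgs n Rp. \<Sum>mc\<in>msgs n Rc. pair_cost n \<tau> Pp Pc S V Dp Dc mp mc)
     \<le> of_nat (card (msgs n Rp) * card (msgs n Rc)) * ennreal eps)"

text \<open>The bound of \<open>block_code_exists\<close> is averaged over schedules with
  independent slots of law \<open>l\<close>, and some schedule is at most average. The 8 is the
  factor 4 of \<open>x1\<close> plus 1 for each of the other four variables.\<close>

lemma time_shared_code_exists:
  fixes l :: "'j \<Rightarrow> real" and n J :: nat and t r1 r2 r3 Pp Pc :: real and Mp Mc :: "nat set"
  assumes I: "finite I" and l: "(\<Sum>j\<in>I. l j) = 1" "\<And>j. j \<in> I \<Longrightarrow> 0 \<le> l j"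
    and t: "0 < t" "t \<le> 1" and fin: "finite Mp" "finite Mc" and J: "exp (n * r1) \<le> real J" and \<rho>: "0 \<le> \<rho>"
    and b: "(\<Sum>j\<in>I. ennreal (l j) * tilt t (x1 r1) j) \<le> ennreal \<rho>" "(\<Sum>j\<in>I. ennreal (l j) * tilt t (x2 r2) j) \<le> ennreal \<rho>"
      "(\<Sum>j\<in>I. ennreal (l j) * tilt t (x3 r3) j) \<le> ennreal \<rho>" "(\<Sum>j\<in>I. ennreal (l j) * tilt t (x4 Pp) j) \<le> ennreal \<rho>"
      "(\<Sum>j\<in>I. ennreal (l j) * tilt t (x5 Pc) j) \<le> ennreal \<rho>"
  obtains \<tau> S V Dp Dc where "\<tau> \<in> PiE {..<n} (\<lambda>_. I)"
    "Dp \<in> measurable (PiM {..<n} (\<lambda>_. borel)) (count_space UNIV)"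
    "Dc \<in> measurable (PiM {..<n} (\<lambda>_. borel)) (count_space UNIV)"
    "(\<Sum>mp\<in>Mp. \<Sum>mc\<in>Mc. pair_cost n \<tau> Pp Pc S V Dp Dc mp mc)
     \<le> of_nat (card Mp * card Mc) *
        ennreal (8 * \<rho> ^ n + real (card Mp - 1) * exp (- (n * r3)) + real ((card Mc - 1) * J) * exp (- (n * r2)))"
proof -
  let ?T = "PiE {..<n} (\<lambda>_. I)"
  define wt where "wt \<tau> = (\<Prod>i<n. ennreal (l (\<tau> i)))" for \<tau>
  define K where "K = of_nat (card Mp - 1) * ennreal (exp (- (n * r3))) + of_nat ((card Mc - 1) * J) * ennreal (exp (- (n * r2)))"
  define Bd where "Bd \<tau> = 4 * (\<Prod>i<n. tilt t (x1 r1) (\<tau> i)) + (\<Prod>i<n. tilt t (x2 r2) (\<tau> i)) + (\<Prod>i<n. tilt t (x3 r3) (\<tau> i))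
         + (\<Prod>i<n. tilt t (x4 Pp) (\<tau> i)) + (\<Prod>i<n. tilt t (x5 Pc) (\<tau> i)) + K" for \<tau>
  have wt1: "(\<Sum>\<tau>\<in>?T. wt \<tau>) = 1"
    unfolding wt_def using l by (subst sum_PiE_prod_power[where f="\<lambda>j. ennreal (l j)", OF I]) (simp add: sum_ennreal)
  have avg: "(\<Sum>\<tau>\<in>?T. wt \<tau> * (\<Prod>i<n. g (\<tau> i))) \<le> ennreal (\<rho> ^ n)"
    if "(\<Sum>j\<in>I. ennreal (l j) * g j) \<le> ennreal \<rho>" for g
  proof -
    have "(\<Sum>\<tau>\<in>?T. wt \<tau> * (\<Prod>i<n. g (\<tau> i))) = (\<Sum>j\<in>I. ennreal (l j) * g j) ^ n"
      unfolding wt_def prod.distrib[symmetric] by (rule sum_PiE_prod_power[OF I])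
    also have "\<dots> \<le> ennreal \<rho> ^ n" using that by (intro power_mono) auto
    finally show ?thesis using \<rho> by (simp add: ennreal_power)
  qed
  have "finite ?T" using I by (intro finite_PiE) auto
  from weighted_average_witness[OF this wt1, of Bd]
  obtain \<tau> where \<tau>: "\<tau> \<in> ?T" "Bd \<tau> \<le> (\<Sum>\<tau>\<in>?T. wt \<tau> * Bd \<tau>)" by blast
  have "(\<Sum>\<tau>\<in>?T. wt \<tau> * Bd \<tau>) = 4 * (\<Sum>\<tau>\<in>?T. wt \<tau> * (\<Prod>i<n. tilt t (x1 r1) (\<tau> i))) + (\<Sum>\<tau>\<in>?T. wt \<tau> * (\<Prod>i<n. tilt t (x2 r2) (\<tau> i)))
      + (\<Sum>\<tau>\<in>?T. wt \<tau> * (\<Prod>i<n. tilt t (x3 r3) (\<tau> i))) + (\<Sum>\<tau>\<in>?T. wt \<tau> * (\<Prod>i<n. tilt t (x4 Pp) (\<tau> i)))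
      + (\<Sum>\<tau>\<in>?T. wt \<tau> * (\<Prod>i<n. tilt t (x5 Pc) (\<tau> i))) + (\<Sum>\<tau>\<in>?T. wt \<tau>) * K"
    unfolding Bd_def by (simp only: distrib_left sum.distrib sum_distrib_left sum_distrib_right) (simp only: mult_ac)
  also have "\<dots> \<le> 4 * ennreal (\<rho> ^ n) + ennreal (\<rho> ^ n) + ennreal (\<rho> ^ n) + ennreal (\<rho> ^ n) + ennreal (\<rho> ^ n) + (\<Sum>\<tau>\<in>?T. wt \<tau>) * K"
    by (intro add_mono mult_left_mono avg b order_refl) auto
  also have "\<dots> = ennreal (8 * \<rho> ^ n + real (card Mp - 1) * exp (- (n * r3)) + real ((card Mc - 1) * J) * exp (- (n * r2)))"
  proof -
    have "K = ennreal (real (card Mp - 1) * exp (- (n * r3)) + real ((card Mc - 1) * J) * exp (- (n * r2)))"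
      unfolding K_def ennreal_of_nat_eq_real_of_nat by (subst ennreal_mult[symmetric], simp, simp)+ (simp add: ennreal_plus)
    moreover have "4 * ennreal (\<rho> ^ n) + ennreal (\<rho> ^ n) + ennreal (\<rho> ^ n) + ennreal (\<rho> ^ n) + ennreal (\<rho> ^ n) = ennreal (8 * \<rho> ^ n)"
    proof -
      have "4 * ennreal (\<rho> ^ n) = ennreal (4 * \<rho> ^ n)" using \<rho> by (simp add: ennreal_mult)
      then show ?thesis using \<rho> by (simp flip: ennreal_plus)
    qed
    ultimately show ?thesis using \<rho> by (simp add: wt1 add.assoc flip: ennreal_plus)
  qed
  finally have Bd: "Bd \<tau> \<le> ennreal (8 * \<rho> ^ n + real (card Mp - 1) * exp (- (n * r3)) + real ((card Mc - 1) * J) * exp (- (n * r2)))"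
    using \<tau>(2) by (rule order_trans[rotated])
  show ?thesis
  proof (rule block_code_exists[where \<tau>=\<tau> and Pp=Pp and Pc=Pc and ?r2.0=r2 and ?r3.0=r3, OF t fin J])
    fix S V Dp Dc
    assume *: "Dp \<in> measurable (PiM {..<n} (\<lambda>_. borel)) (count_space UNIV)"
      "Dc \<in> measurable (PiM {..<n} (\<lambda>_. borel)) (count_space UNIV)"
      "(\<Sum>mp\<in>Mp. \<Sum>mc\<in>Mc. pair_cost n \<tau> Pp Pc S V Dp Dc mp mc)
     \<le> of_nat (card Mp * card Mc) *
        (4 * (\<Prod>i<n. tilt t (x1 r1) (\<tau> i)) + (\<Prod>i<n. tilt t (x2 r2) (\<tau> i)) + (\<Prod>i<n. tilt t (x3 r3) (\<tau> i))
         + (\<Prod>i<n. tilt t (x4 Pp) (\<tau> i)) + (\<Prod>i<n. tilt t (x5 Pc) (\<tau> i))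
         + of_nat (card Mp - 1) * ennreal (exp (- (n * r3))) + of_nat ((card Mc - 1) * J) * ennreal (exp (- (n * r2))))"
    have "of_nat (card Mp * card Mc) *
        (4 * (\<Prod>i<n. tilt t (x1 r1) (\<tau> i)) + (\<Prod>i<n. tilt t (x2 r2) (\<tau> i)) + (\<Prod>i<n. tilt t (x3 r3) (\<tau> i))
         + (\<Prod>i<n. tilt t (x4 Pp) (\<tau> i)) + (\<Prod>i<n. tilt t (x5 Pc) (\<tau> i))
         + of_nat (card Mp - 1) * ennreal (exp (- (n * r3))) + of_nat ((card Mc - 1) * J) * ennreal (exp (- (n * r2))))
      = of_nat (card Mp * card Mc) * Bd \<tau>"
      unfolding Bd_def K_def by (simp only: add.assoc)
    also have "\<dots> \<le> of_nat (card Mp * card Mc) *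
        ennreal (8 * \<rho> ^ n + real (card Mp - 1) * exp (- (n * r3)) + real ((card Mc - 1) * J) * exp (- (n * r2)))"
      using Bd by (intro mult_left_mono) auto
    finally show ?thesis using that[OF \<tau>(1) *(1,2)] order_trans[OF *(3)] by blast
  qed
qed

lemma asymptotic_code_exists:
  fixes l :: "'j \<Rightarrow> real" and t r1 r2 r3 Pp Pc Rp Rc eps :: real
  assumes I: "finite I" and l: "(\<Sum>j\<in>I. l j) = 1" "\<And>j. j \<in> I \<Longrightarrow> 0 \<le> l j"
    and t: "0 < t" "t \<le> 1" and eps: "0 < eps"
    and r1: "0 < r1" and r3: "Rp = 0 \<or> Rp * ln 2 < r3" and r2: "Rc = 0 \<or> Rc * ln 2 + r1 < r2"
    and b: "(\<Sum>j\<in>I. ennreal (l j) * tilt t (x1 r1) j) < 1" "(\<Sum>j\<in>I. ennreal (l j) * tilt t (x2 r2) j) < 1"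
      "(\<Sum>j\<in>I. ennreal (l j) * tilt t (x3 r3) j) < 1" "(\<Sum>j\<in>I. ennreal (l j) * tilt t (x4 Pp) j) < 1"
      "(\<Sum>j\<in>I. ennreal (l j) * tilt t (x5 Pc) j) < 1"
  shows "\<exists>N. \<forall>n\<ge>N. good_code I n Pp Pc Rp Rc eps"
proof -
  define F where "F = {(\<Sum>j\<in>I. ennreal (l j) * tilt t (x1 r1) j), (\<Sum>j\<in>I. ennreal (l j) * tilt t (x2 r2) j),
     (\<Sum>j\<in>I. ennreal (l j) * tilt t (x3 r3) j), (\<Sum>j\<in>I. ennreal (l j) * tilt t (x4 Pp) j), (\<Sum>j\<in>I. ennreal (l j) * tilt t (x5 Pc) j)}"
  \<comment> \<open>The largest of finitely many numbers below 1, hence a common base of geometric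
    decay.\<close>
  define \<rho> where "\<rho> = Max (enn2real ` F)"
  have F: "finite F" "F \<noteq> {}" "\<And>x. x \<in> F \<Longrightarrow> x < 1" using b by (auto simp: F_def)
  have er: "x < 1 \<Longrightarrow> enn2real x < 1" "x < 1 \<Longrightarrow> x = ennreal (enn2real x)" for x
  proof -
    assume x: "x < 1"
    then have "x < \<top>" by (metis less_trans ennreal_one_less_top)
    then show *: "x = ennreal (enn2real x)" by simp
    show "enn2real x < 1" using x by (metis * ennreal_1 ennreal_less_iff enn2real_nonneg)
  qed
  have \<rho>1: "\<rho> < 1" unfolding \<rho>_def using F by (subst Max_less_iff) (auto intro: er)
  have \<rho>0: "0 \<le> \<rho>" unfolding \<rho>_def using F by (subst Max_ge_iff) auto
  have le\<rho>: "x \<le> ennreal \<rho>" if "x \<in> F" for x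
    using er(2)[OF F(3)[OF that]] F(1) that unfolding \<rho>_def by (metis Max_ge ennreal_leI finite_imageI imageI)
  have b\<rho>: "(\<Sum>j\<in>I. ennreal (l j) * tilt t (x1 r1) j) \<le> ennreal \<rho>" "(\<Sum>j\<in>I. ennreal (l j) * tilt t (x2 r2) j) \<le> ennreal \<rho>"
      "(\<Sum>j\<in>I. ennreal (l j) * tilt t (x3 r3) j) \<le> ennreal \<rho>" "(\<Sum>j\<in>I. ennreal (l j) * tilt t (x4 Pp) j) \<le> ennreal \<rho>"
      "(\<Sum>j\<in>I. ennreal (l j) * tilt t (x5 Pc) j) \<le> ennreal \<rho>"
    by (intro le\<rho>; simp add: F_def)+
  \<comment> \<open>The least bin size that the covering condition allows; because
    \<open>r1 > 0\<close>, rounding up costs at most a factor 2.\<close>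
  define J where "J n = nat \<lceil>exp (real n * r1)\<rceil>" for n
  have J: "exp (real n * r1) \<le> real (J n)" "real (J n) \<le> 2 * exp (real n * r1)" for n
  proof -
    show "exp (real n * r1) \<le> real (J n)" unfolding J_def by (simp add: real_nat_ceiling_ge)
    have "1 \<le> exp (real n * r1)" using r1 by simp
    moreover have "real (J n) \<le> exp (real n * r1) + 1"
      unfolding J_def using ceiling_correct[of "exp (real n * r1)"] exp_gt_zero[of "real n * r1"] by (simp add: nat_ceiling_le_eq)
    ultimately show "real (J n) \<le> 2 * exp (real n * r1)" by linarith
  qed
  let ?e = "\<lambda>n. 8 * \<rho> ^ n + real (card (msgs n Rp) - 1) * exp (- (real n * r3)) + real ((card (msgs n Rc) - 1) * J n) * exp (- (real n * r2))"
  have lim1: "(\<lambda>n. 8 * \<rho> ^ n) \<longlonglongrightarrow> 0"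
    using tendsto_mult[OF tendsto_const LIMSEQ_realpow_zero[OF \<rho>0 \<rho>1], of 8] by simp
  \<comment> \<open>At rate 0 there is one message, so \<open>card (msgs n Rp) - 1\<close> vanishes
    and the term is 0 for every threshold \<open>r3\<close>, even a negative one. The same happens
    for \<open>Rc\<close> below.\<close>
  have lim2: "(\<lambda>n. real (card (msgs n Rp) - 1) * exp (- (real n * r3))) \<longlonglongrightarrow> 0"
  proof (cases "Rp = 0")
    case True
    then show ?thesis by (simp add: msgs_zero_rate)
  next
    case False
    then have "(\<lambda>n. exp (real n * (Rp * ln 2 - r3))) \<longlonglongrightarrow> 0" using r3 by (intro exp_mult_nat_tendsto_0) auto
    then show ?thesis
    proof (rule Lim_null_comparison[rotated], intro always_eventually allI)
      fix n
      have "real (card (msgs n Rp) - 1) * exp (- (real n * r3)) \<le> exp (real n * (Rp * ln 2)) * exp (- (real n * r3))"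
        by (intro mult_right_mono card_msgs_minus_1_le) auto
      also have "\<dots> = exp (real n * (Rp * ln 2 - r3))" by (simp add: right_diff_distrib flip: exp_add)
      finally show "norm (real (card (msgs n Rp) - 1) * exp (- (real n * r3))) \<le> exp (real n * (Rp * ln 2 - r3))" by simp
    qed
  qed
  have lim3: "(\<lambda>n. real ((card (msgs n Rc) - 1) * J n) * exp (- (real n * r2))) \<longlonglongrightarrow> 0"
  proof (cases "Rc = 0")
    case True
    then show ?thesis by (simp add: msgs_zero_rate)
  next
    case False
    then have "(\<lambda>n. 2 * exp (real n * (Rc * ln 2 + r1 - r2))) \<longlonglongrightarrow> 2 * 0"
      using r2 by (intro tendsto_mult tendsto_const exp_mult_nat_tendsto_0) auto
    then have "(\<lambda>n. 2 * exp (real n * (Rc * ln 2 + r1 - r2))) \<longlonglongrightarrow> 0" by simp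
    then show ?thesis
    proof (rule Lim_null_comparison[rotated], intro always_eventually allI)
      fix n
      have "real ((card (msgs n Rc) - 1) * J n) * exp (- (real n * r2)) \<le> (exp (real n * (Rc * ln 2)) * (2 * exp (real n * r1))) * exp (- (real n * r2))"
        unfolding of_nat_mult by (intro mult_right_mono mult_mono card_msgs_minus_1_le J(2)) auto
      also have "\<dots> = 2 * (exp (real n * (Rc * ln 2)) * exp (real n * r1) * exp (- (real n * r2)))" by simp
      also have "exp (real n * (Rc * ln 2)) * exp (real n * r1) * exp (- (real n * r2)) = exp (real n * (Rc * ln 2 + r1 - r2))"
        unfolding exp_add[symmetric] by (simp add: distrib_left right_diff_distrib)
      finally show "norm (real ((card (msgs n Rc) - 1) * J n) * exp (- (real n * r2))) \<le> 2 * exp (real n * (Rc * ln 2 + r1 - r2))" by simp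
    qed
  qed
  have "?e \<longlonglongrightarrow> 0 + 0 + 0" by (intro tendsto_add lim1 lim2 lim3)
  then have "\<forall>\<^sub>F n in sequentially. ?e n < eps" using eps by (intro order_tendstoD(2)[where y=0]) simp_all
  then obtain N where N: "\<And>n. n \<ge> N \<Longrightarrow> ?e n < eps" by (auto simp: eventually_sequentially)
  show ?thesis
  proof (intro exI[of _ N] allI impI)
    fix n assume n: "N \<le> n"
    show "good_code I n Pp Pc Rp Rc eps"
    proof (rule time_shared_code_exists[where l=l and n=n and J="J n" and Mp="msgs n Rp" and Mc="msgs n Rc", OF I l t finite_msgs finite_msgs J(1) \<rho>0 b\<rho>])
      fix \<tau> S V Dp Dc
      assume *: "\<tau> \<in> PiE {..<n} (\<lambda>_. I)" "Dp \<in> measurable (PiM {..<n} (\<lambda>_. borel)) (count_space UNIV)"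
        "Dc \<in> measurable (PiM {..<n} (\<lambda>_. borel)) (count_space UNIV)"
        "(\<Sum>mp\<in>msgs n Rp. \<Sum>mc\<in>msgs n Rc. pair_cost n \<tau> Pp Pc S V Dp Dc mp mc)
        \<le> of_nat (card (msgs n Rp) * card (msgs n Rc)) * ennreal (?e n)"
      have "of_nat (card (msgs n Rp) * card (msgs n Rc)) * ennreal (?e n) \<le> of_nat (card (msgs n Rp) * card (msgs n Rc)) * ennreal eps"
        using N[OF n] by (intro mult_left_mono ennreal_leI) auto
      from order_trans[OF *(4) this] *(1-3) show ?thesis unfolding good_code_def by blast
    qed
  qed
qed

end

section \<open>The dirty-paper scheme\<close>

text \<open>Unspecified unless \<open>N\<close> is positive definite.\<close>

definition pinv :: "complex^'n^'n \<Rightarrow> complex^'n^'n" where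
  "pinv N = (SOME L. posinv N L (Re (det N)))"

definition gdet :: "complex^'n^'m \<Rightarrow> real" where
  "gdet A = Re (det (mat 1 + A ** cadj A))"

lemma posinv_pinv:
  assumes "posinv N L d" shows "posinv N (pinv N) (Re (det N))" "Re (det N) = d"
proof -
  show d: "Re (det N) = d" using assms by (simp add: posinv_def)
  show "posinv N (pinv N) (Re (det N))"
    unfolding pinv_def by (rule someI[of _ L]) (use assms d in simp)
qed

lemma posinv_mat_1_plus: "posinv (mat 1 + A ** cadj A) (pinv (mat 1 + A ** cadj A)) (gdet A)"
  unfolding gdet_def using gaussian_integral[OF posinv_mat_1, of A] posinv_pinv(1) by metis

lemma gdet_ge_1: "1 \<le> gdet A"
proof -
  obtain L d where "posinv (mat 1 + A ** cadj A) L d" "1 \<le> d"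
    using gaussian_integral[OF posinv_mat_1, of A] by metis
  then show ?thesis unfolding gdet_def using posinv_pinv(2) by metis
qed

text \<open>\<open>gaussian_integral\<close> with its witnesses replaced by the functions
  \<open>pinv\<close> and \<open>det\<close>, which the metrics can mention; uniqueness of the
  inverse justifies this.\<close>

lemma posinv_plus:
  assumes "posinv N L d"
  shows "posinv (N + A ** cadj A) (pinv (N + A ** cadj A)) (Re (det (N + A ** cadj A)))"
    "d \<le> Re (det (N + A ** cadj A))"
    "(\<integral>\<^sup>+x. ennreal (exp (- ((y - A *v x) \<bullet> (L *v (y - A *v x))))) \<partial>cgauss)
      = ennreal (d / Re (det (N + A ** cadj A)) * exp (- (y \<bullet> (pinv (N + A ** cadj A) *v y))))"
proof -
  obtain L' d' where L': "posinv (N + A ** cadj A) L' d'" "d \<le> d'"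
    "\<And>y. (\<integral>\<^sup>+x. ennreal (exp (- ((y - A *v x) \<bullet> (L *v (y - A *v x))))) \<partial>cgauss) = ennreal (d / d' * exp (- (y \<bullet> (L' *v y))))"
    by (rule gaussian_integral[OF assms, where A=A]) blast
  note p = posinv_pinv[OF L'(1)]
  show "posinv (N + A ** cadj A) (pinv (N + A ** cadj A)) (Re (det (N + A ** cadj A)))" by (rule p)
  show "d \<le> Re (det (N + A ** cadj A))" using L'(2) p(2) by simp
  have "L' = pinv (N + A ** cadj A)" using posinv_unique(1)[OF L'(1) p(1)] .
  then show "(\<integral>\<^sup>+x. ennreal (exp (- ((y - A *v x) \<bullet> (L *v (y - A *v x))))) \<partial>cgauss)
      = ennreal (d / Re (det (N + A ** cadj A)) * exp (- (y \<bullet> (pinv (N + A ** cadj A) *v y))))"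
    using L'(3)[of y] p(2) by simp
qed

section \<open>Traces, and moments of quadratic functions of Gaussian vectors\<close>

lemma ctrace_commute: "ctrace (A ** B) = ctrace (B ** A)"
  unfolding ctrace_def matrix_matrix_mult_def by (simp, subst sum.swap) (simp add: mult.commute)

lemma matrix_add_rdist: "(A + B) ** C = A ** C + B ** C" for A B :: "complex^'n^'m"
  by (simp add: vec_eq_iff matrix_matrix_mult_def distrib_right sum.distrib)

lemma ctrace_add: "ctrace (A + B) = ctrace A + ctrace B"
  by (simp add: ctrace_def sum.distrib)

lemma norm_matrix_ctrace: "(norm A)\<^sup>2 = Re (ctrace (A ** cadj A))"
proof -
  have "(norm A)\<^sup>2 = (\<Sum>i\<in>UNIV. \<Sum>j\<in>UNIV. (cmod (A $ i $ j))\<^sup>2)"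
    by (simp add: norm_vec_def L2_set_def sum_nonneg)
  also have "\<dots> = Re (ctrace (A ** cadj A))"
    unfolding cmod_power2 by (simp add: ctrace_def matrix_matrix_mult_def cadj_def power2_eq_square)
  finally show ?thesis .
qed

lemma norm_mat_1: "(norm (mat 1 :: complex^'n^'n))\<^sup>2 = CARD('n)"
proof -
  have "(norm (mat 1 :: complex^'n^'n))\<^sup>2 = Re (ctrace (mat 1 :: complex^'n^'n))"
    by (simp add: norm_matrix_ctrace)
  also have "\<dots> = CARD('n)" by (simp add: ctrace_def mat_def)
  finally show ?thesis .
qed

text \<open>The joint law of the primary letter \<open>s\<close>, the fresh part
  \<open>v = u - C *v s\<close> of the auxiliary letter and the noise \<open>z\<close>, which are
  independent under the law behind \<open>tilt\<close>.\<close>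

definition gauss3 :: "((complex^'k) \<times> (complex^'c) \<times> (complex^'r)) measure" where
  "gauss3 = cgauss \<Otimes>\<^sub>M cgauss \<Otimes>\<^sub>M cgauss"

lemma sets_gauss3 [measurable_cong, simp]: "sets gauss3 = sets (borel \<Otimes>\<^sub>M borel \<Otimes>\<^sub>M borel)"
  unfolding gauss3_def by (intro sets_pair_measure_cong) auto

lemma prob_space_gauss3: "prob_space gauss3"
  unfolding gauss3_def by (intro prob_space_pair prob_space_cgauss)

lemma nn_integral_gauss3:
  fixes f :: "complex^'k \<Rightarrow> complex^'c \<Rightarrow> complex^'r \<Rightarrow> ennreal"
  assumes m: "(\<lambda>(s, v, z). f s v z) \<in> borel_measurable (borel \<Otimes>\<^sub>M borel \<Otimes>\<^sub>M borel)"
  shows "(\<integral>\<^sup>+(s, v, z). f s v z \<partial>gauss3) = (\<integral>\<^sup>+s. (\<integral>\<^sup>+v. (\<integral>\<^sup>+z. f s v z \<partial>cgauss) \<partial>cgauss) \<partial>cgauss)"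
proof -
  interpret S: prob_space "cgauss :: (complex^'k) measure" by (rule prob_space_cgauss)
  interpret V: prob_space "cgauss :: (complex^'c) measure" by (rule prob_space_cgauss)
  interpret Z: prob_space "cgauss :: (complex^'r) measure" by (rule prob_space_cgauss)
  interpret VZ: pair_prob_space "cgauss :: (complex^'c) measure" "cgauss :: (complex^'r) measure" ..
  note [measurable] = measurable_case_prod3[OF m]
  have "(\<integral>\<^sup>+(s, v, z). f s v z \<partial>gauss3) = (\<integral>\<^sup>+s. (\<integral>\<^sup>+vz. f s (fst vz) (snd vz) \<partial>(cgauss \<Otimes>\<^sub>M cgauss)) \<partial>cgauss)"
    unfolding gauss3_def by (subst VZ.nn_integral_fst[symmetric]) (auto simp: split_def)
  also have "\<dots> = (\<integral>\<^sup>+s. (\<integral>\<^sup>+v. (\<integral>\<^sup>+z. f s v z \<partial>cgauss) \<partial>cgauss) \<partial>cgauss)"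
  proof (intro nn_integral_cong)
    fix s :: "complex^'k"
    show "(\<integral>\<^sup>+vz. f s (fst vz) (snd vz) \<partial>(cgauss \<Otimes>\<^sub>M cgauss)) = (\<integral>\<^sup>+v. (\<integral>\<^sup>+z. f s v z \<partial>cgauss) \<partial>cgauss)"
      by (subst Z.nn_integral_fst[symmetric]) auto
  qed
  finally show ?thesis .
qed

definition qlin :: "(complex^'k \<Rightarrow> complex^'c \<Rightarrow> complex^'r \<Rightarrow> complex^'d) \<Rightarrow> bool" where
  "qlin f \<longleftrightarrow> (\<exists>c\<ge>0. \<forall>s v z. norm (f s v z) \<le> c * (norm s + norm v + norm z))"

text \<open>Quadratic growth is what Gaussian tails tolerate: it yields an exponential moment for
  some small \<open>t\<close>.\<close>

definition qgrow :: "(complex^'k \<Rightarrow> complex^'c \<Rightarrow> complex^'r \<Rightarrow> real) \<Rightarrow> bool" where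
  "qgrow X \<longleftrightarrow> (\<exists>c\<ge>0. \<forall>s v z. \<bar>X s v z\<bar> \<le> c * (1 + (norm s)\<^sup>2 + (norm v)\<^sup>2 + (norm z)\<^sup>2))"

lemma qlin_proj: "qlin (\<lambda>s v z. s)" "qlin (\<lambda>s v z. v)" "qlin (\<lambda>s v z. z)"
  unfolding qlin_def by (auto intro!: exI[of _ 1])

lemma qlin_add: assumes "qlin f" "qlin g" shows "qlin (\<lambda>s v z. f s v z + g s v z)"
proof -
  obtain c d where "c \<ge> 0" "d \<ge> 0" and *: "\<And>s v z. norm (f s v z) \<le> c * (norm s + norm v + norm z)"
    "\<And>s v z. norm (g s v z) \<le> d * (norm s + norm v + norm z)"
    using assms unfolding qlin_def by metis
  then show ?thesis unfolding qlin_def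
    by (intro exI[of _ "c + d"] conjI allI) (auto simp: distrib_right intro!: order_trans[OF norm_triangle_ineq] add_mono)
qed

lemma qlin_mult: fixes A :: "complex^'d^'e" assumes "qlin f" shows "qlin (\<lambda>s v z. A *v f s v z)"
proof -
  obtain c where c: "c \<ge> 0" "\<And>s v z. norm (f s v z) \<le> c * (norm s + norm v + norm z)"
    using assms unfolding qlin_def by metis
  let ?k = "onorm ((*v) A)"
  have k: "0 \<le> ?k" "norm (A *v x) \<le> ?k * norm x" for x
    by (auto intro!: onorm_pos_le onorm matrix_vector_mul_bounded_linear)
  have "norm (A *v f s v z) \<le> (?k * c) * (norm s + norm v + norm z)" for s v z
    using order_trans[OF k(2) mult_left_mono[OF c(2) k(1)]] by (simp add: mult.assoc)
  then show ?thesis unfolding qlin_def using c k by (intro exI[of _ "?k * c"]) auto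
qed

lemma qgrow_const: "qgrow (\<lambda>s v z. c)"
  unfolding qgrow_def by (intro exI[of _ "\<bar>c\<bar>"]) (auto simp: distrib_left)

lemma qgrow_add: assumes "qgrow X" "qgrow Y" shows "qgrow (\<lambda>s v z. X s v z + Y s v z)"
proof -
  obtain c d where "c \<ge> 0" "d \<ge> 0" and *: "\<And>s v z. \<bar>X s v z\<bar> \<le> c * (1 + (norm s)\<^sup>2 + (norm v)\<^sup>2 + (norm z)\<^sup>2)"
    "\<And>s v z. \<bar>Y s v z\<bar> \<le> d * (1 + (norm s)\<^sup>2 + (norm v)\<^sup>2 + (norm z)\<^sup>2)"
    using assms unfolding qgrow_def by metis
  then show ?thesis unfolding qgrow_def
    by (intro exI[of _ "c + d"] conjI allI) (auto simp: distrib_right[of c d] intro!: order_trans[OF abs_triangle_ineq] add_mono)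
qed

lemma qgrow_minus: assumes "qgrow X" shows "qgrow (\<lambda>s v z. - X s v z)"
  using assms by (simp add: qgrow_def)

lemma qgrow_diff: assumes "qgrow X" "qgrow Y" shows "qgrow (\<lambda>s v z. X s v z - Y s v z)"
  using qgrow_add[OF assms(1) qgrow_minus[OF assms(2)]] by simp

lemma qgrow_inner: assumes "qlin f" "qlin g" shows "qgrow (\<lambda>s v z. f s v z \<bullet> g s v z)"
proof -
  obtain c d where c: "c \<ge> 0" "d \<ge> 0" and *: "\<And>s v z. norm (f s v z) \<le> c * (norm s + norm v + norm z)"
    "\<And>s v z. norm (g s v z) \<le> d * (norm s + norm v + norm z)"
    using assms unfolding qlin_def by metis
  have "\<bar>f s v z \<bullet> g s v z\<bar> \<le> (3 * (c * d)) * (1 + (norm s)\<^sup>2 + (norm v)\<^sup>2 + (norm z)\<^sup>2)" for s v z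
  proof -
    have "\<bar>f s v z \<bullet> g s v z\<bar> \<le> norm (f s v z) * norm (g s v z)" by (rule Cauchy_Schwarz_ineq2)
    also have "\<dots> \<le> (c * (norm s + norm v + norm z)) * (d * (norm s + norm v + norm z))"
      using c by (intro mult_mono * mult_nonneg_nonneg) auto
    also have "\<dots> = (c * d) * (norm s + norm v + norm z)\<^sup>2" by (simp add: power2_eq_square mult_ac)
    also have "\<dots> \<le> (c * d) * (3 * (1 + (norm s)\<^sup>2 + (norm v)\<^sup>2 + (norm z)\<^sup>2))"
    proof (rule mult_left_mono)
      have sq: "(a + b + e)\<^sup>2 \<le> 3 * (1 + a\<^sup>2 + b\<^sup>2 + e\<^sup>2)" for a b e :: real
      proof -
        have "0 \<le> (a - b)\<^sup>2 + (b - e)\<^sup>2 + (a - e)\<^sup>2" by simp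
        then show ?thesis by (simp add: power2_eq_square algebra_simps)
      qed
      show "(norm s + norm v + norm z)\<^sup>2 \<le> 3 * (1 + (norm s)\<^sup>2 + (norm v)\<^sup>2 + (norm z)\<^sup>2)" by (rule sq)
    qed (use c in simp)
    finally show ?thesis by (simp add: mult_ac)
  qed
  then show ?thesis unfolding qgrow_def using c by (intro exI[of _ "3 * (c * d)"]) auto
qed

lemma qgrow_norm: assumes "qlin f" shows "qgrow (\<lambda>s v z. (norm (f s v z))\<^sup>2)"
  using qgrow_inner[OF assms assms] by (simp add: power2_norm_eq_inner)

lemma qgrow_exp_integrable:
  fixes X :: "complex^'k \<Rightarrow> complex^'c \<Rightarrow> complex^'r \<Rightarrow> real"
  assumes X: "qgrow X" and m: "(\<lambda>(s, v, z). X s v z) \<in> borel_measurable (borel \<Otimes>\<^sub>M borel \<Otimes>\<^sub>M borel)"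
  shows "\<exists>t0>0. integrable gauss3 (\<lambda>(s, v, z). exp (t0 * X s v z))"
proof -
  obtain c where c: "c \<ge> 0" "\<And>s v z. \<bar>X s v z\<bar> \<le> c * (1 + (norm s)\<^sup>2 + (norm v)\<^sup>2 + (norm z)\<^sup>2)"
    using X unfolding qgrow_def by metis
  \<comment> \<open>Makes \<open>t * c \<le> 1 / 2\<close>, which is below the value 1 at which the
    Gaussian tail stops compensating; the added 1 allows \<open>c = 0\<close>.\<close>
  define t where "t = 1 / (2 * (c + 1))"
  have t: "0 < t" "t * c \<le> 1 / 2" using c by (auto simp: t_def field_simps)
  let ?f = "\<lambda>(s :: complex^'k) (v :: complex^'c) (z :: complex^'r). ennreal (exp (1 / 2)) * (ennreal (exp (1 / 2 * (norm s)\<^sup>2)) * (ennreal (exp (1 / 2 * (norm v)\<^sup>2)) * ennreal (exp (1 / 2 * (norm z)\<^sup>2))))"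
  have "(\<integral>\<^sup>+(s, v, z). ennreal (exp (t * X s v z)) \<partial>gauss3) \<le> (\<integral>\<^sup>+(s, v, z). ?f s v z \<partial>gauss3)"
  proof (intro nn_integral_mono, clarsimp)
    fix s :: "complex^'k" and v :: "complex^'c" and z :: "complex^'r"
    let ?q = "1 + (norm s)\<^sup>2 + (norm v)\<^sup>2 + (norm z)\<^sup>2"
    have "t * X s v z \<le> t * (c * ?q)" using c(2)[of s v z] t by (intro mult_left_mono) auto
    also have "\<dots> = (t * c) * ?q" by simp
    also have "\<dots> \<le> 1 / 2 * ?q" using t(2) by (intro mult_right_mono) auto
    finally have "exp (t * X s v z) \<le> exp (1 / 2 + (1 / 2 * (norm s)\<^sup>2 + (1 / 2 * (norm v)\<^sup>2 + 1 / 2 * (norm z)\<^sup>2)))"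
      by (simp add: algebra_simps)
    then show "ennreal (exp (t * X s v z)) \<le> ennreal (exp (1 / 2)) * (ennreal (exp ((norm s)\<^sup>2 / 2)) * (ennreal (exp ((norm v)\<^sup>2 / 2)) * ennreal (exp ((norm z)\<^sup>2 / 2))))"
      by (simp add: exp_add ennreal_leI flip: ennreal_mult)
  qed
  also have "\<dots> = (\<integral>\<^sup>+s. (\<integral>\<^sup>+v. (\<integral>\<^sup>+z. ?f s v z \<partial>cgauss) \<partial>cgauss) \<partial>cgauss)"
    by (rule nn_integral_gauss3) measurable
  also have "\<dots> = ennreal (exp (1 / 2)) * ((\<integral>\<^sup>+s. ennreal (exp (1 / 2 * (norm s)\<^sup>2)) \<partial>(cgauss :: (complex^'k) measure)) *
     ((\<integral>\<^sup>+v. ennreal (exp (1 / 2 * (norm v)\<^sup>2)) \<partial>(cgauss :: (complex^'c) measure)) * (\<integral>\<^sup>+z. ennreal (exp (1 / 2 * (norm z)\<^sup>2)) \<partial>(cgauss :: (complex^'r) measure))))"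
    by (simp add: nn_integral_cmult nn_integral_multc)
  also have "\<dots> < \<infinity>"
    using nn_integral_cgauss_exp_norm[of "1 / 2", where 'n='k] nn_integral_cgauss_exp_norm[of "1 / 2", where 'n='c] nn_integral_cgauss_exp_norm[of "1 / 2", where 'n='r]
    by (simp add: ennreal_mult_less_top)
  finally have "(\<integral>\<^sup>+(s, v, z). ennreal (exp (t * X s v z)) \<partial>gauss3) < \<infinity>" .
  moreover have "(\<lambda>(s, v, z). exp (t * X s v z)) \<in> borel_measurable gauss3"
  proof -
    have "(\<lambda>x. exp (t * (case x of (s, v, z) \<Rightarrow> X s v z))) \<in> borel_measurable (borel \<Otimes>\<^sub>M borel \<Otimes>\<^sub>M borel)"
      using m by measurable
    then show ?thesis by (simp add: split_def cong: measurable_cong_sets)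
  qed
  ultimately have "integrable gauss3 (\<lambda>(s, v, z). exp (t * X s v z))"
    by (intro integrableI_nonneg) (auto simp: split_def)
  then show ?thesis using t by blast
qed

lemma gauss3_norm_mean:
  fixes A :: "complex^'k^'d" and B :: "complex^'c^'d" and D :: "complex^'r^'d"
  shows "has_bochner_integral gauss3 (\<lambda>(s, v, z). (norm (A *v s + B *v v + D *v z))\<^sup>2) ((norm A)\<^sup>2 + (norm B)\<^sup>2 + (norm D)\<^sup>2)"
proof (rule has_bochner_integral_nn_integral)
  interpret S: prob_space "cgauss :: (complex^'k) measure" by (rule prob_space_cgauss)
  interpret V: prob_space "cgauss :: (complex^'c) measure" by (rule prob_space_cgauss)
  have "(\<integral>\<^sup>+x. ennreal ((\<lambda>(s, v, z). (norm (A *v s + B *v v + D *v z))\<^sup>2) x) \<partial>gauss3) = (\<integral>\<^sup>+(s, v, z). ennreal ((norm (A *v s + B *v v + D *v z))\<^sup>2) \<partial>gauss3)"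
    by (simp add: split_def)
  also have "\<dots> = (\<integral>\<^sup>+s. (\<integral>\<^sup>+v. (\<integral>\<^sup>+z. ennreal ((norm (A *v s + B *v v + D *v z))\<^sup>2) \<partial>cgauss) \<partial>cgauss) \<partial>cgauss)"
    by (rule nn_integral_gauss3) measurable
  also have "\<dots> = (\<integral>\<^sup>+s. (\<integral>\<^sup>+v. ennreal ((norm (A *v s + B *v v))\<^sup>2) + ennreal ((norm D)\<^sup>2) \<partial>cgauss) \<partial>cgauss)"
    by (simp add: nn_integral_cgauss_norm_affine ennreal_plus)
  also have "\<dots> = (\<integral>\<^sup>+s. ennreal ((norm (0 + A *v s))\<^sup>2) + (ennreal ((norm B)\<^sup>2) + ennreal ((norm D)\<^sup>2)) \<partial>cgauss)"
    by (simp add: nn_integral_add nn_integral_cgauss_norm_affine ennreal_plus V.emeasure_space_1[unfolded space_cgauss] add.assoc)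
  also have "\<dots> = ennreal ((norm A)\<^sup>2) + (ennreal ((norm B)\<^sup>2) + ennreal ((norm D)\<^sup>2))"
    unfolding add.assoc by (subst nn_integral_add) (auto simp only: nn_integral_cgauss_norm_affine, auto simp: S.emeasure_space_1[unfolded space_cgauss])
  finally show "(\<integral>\<^sup>+x. ennreal ((\<lambda>(s, v, z). (norm (A *v s + B *v v + D *v z))\<^sup>2) x) \<partial>gauss3) = ennreal ((norm A)\<^sup>2 + (norm B)\<^sup>2 + (norm D)\<^sup>2)"
    by (simp add: add.assoc)
qed (auto simp: split_def)

text \<open>The vector has the covariance whose inverse is \<open>L\<close>, so the mean of the form
  is the trace of the identity. It does not depend on \<open>A\<close> and \<open>B\<close>, which
  is why such terms cancel in the means of the metrics.\<close>

lemma gauss3_form_mean: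
  fixes A :: "complex^'k^'r" and B :: "complex^'c^'r"
  assumes L: "posinv (mat 1 + B ** cadj B + A ** cadj A) L d"
  shows "has_bochner_integral gauss3 (\<lambda>(s, v, z). (A *v s + B *v v + z) \<bullet> (L *v (A *v s + B *v v + z))) (real CARD('r))"
proof -
  have "psd L" using L by (simp add: posinv_def psd_iff_inner)
  then obtain T :: "complex^'r^'r" where T: "L = T ** cadj T" by (rule psd_factor)
  let ?T = "cadj T"
  have form: "x \<bullet> (L *v x) = (norm (?T *v x))\<^sup>2" for x
    unfolding T by (simp add: matrix_vector_mul_assoc[symmetric] inner_cadj power2_norm_eq_inner)
  have "(norm (?T ** A))\<^sup>2 + (norm (?T ** B))\<^sup>2 + (norm ?T)\<^sup>2 = Re (ctrace (?T ** (mat 1 + B ** cadj B + A ** cadj A) ** T))"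
    by (simp add: norm_matrix_ctrace cadj_mult matrix_add_ldistrib matrix_add_rdist ctrace_add matrix_mul_assoc)
  also have "ctrace (?T ** (mat 1 + B ** cadj B + A ** cadj A) ** T) = ctrace (((mat 1 + B ** cadj B + A ** cadj A) ** T) ** ?T)"
    by (subst ctrace_commute) (simp add: matrix_mul_assoc)
  also have "((mat 1 + B ** cadj B + A ** cadj A) ** T) ** ?T = mat 1"
    using L T by (simp add: posinv_def matrix_mul_assoc)
  also have "Re (ctrace (mat 1 :: complex^'r^'r)) = real CARD('r)"
    using norm_mat_1[where 'n='r] by (simp add: norm_matrix_ctrace)
  finally have m: "(norm (?T ** A))\<^sup>2 + (norm (?T ** B))\<^sup>2 + (norm ?T)\<^sup>2 = real CARD('r)" .
  show ?thesis
    using gauss3_norm_mean[of "?T ** A" "?T ** B" ?T] unfolding m form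
    by (simp add: matrix_vector_mul_assoc[symmetric] matrix_vector_right_distrib)
qed

section \<open>The filter and the three metrics\<close>

definition mmse :: "complex^'c^'r \<Rightarrow> complex^'r^'c" where
  "mmse H = cadj H ** pinv (mat 1 + H ** cadj H)"

text \<open>The log-density at \<open>u\<close>, relative to \<open>cgauss\<close>, of the Gaussian
  centred at \<open>C *v s\<close>.\<close>

definition ll1 :: "complex^'k^'c \<Rightarrow> complex^'c \<Rightarrow> complex^'k \<Rightarrow> real" where
  "ll1 C u s = (norm u)\<^sup>2 - (norm (u - C *v s))\<^sup>2"

text \<open>The log-density at \<open>u\<close>, relative to \<open>cgauss\<close>, of the law of
  \<open>u\<close> given \<open>y\<close>: Gaussian with mean \<open>mmse H *v y\<close> and
  covariance the inverse of \<open>mat 1 + cadj H ** H\<close>, because the estimation error of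
  \<open>v\<close> is independent of \<open>y\<close>. The determinant of that matrix is again
  \<open>gdet H\<close>.\<close>

definition ll2 :: "complex^'c^'r \<Rightarrow> complex^'c \<Rightarrow> complex^'r \<Rightarrow> real" where
  "ll2 H u y = ln (gdet H) + (norm u)\<^sup>2 - (norm (u - mmse H *v y))\<^sup>2 - (norm (H *v (u - mmse H *v y)))\<^sup>2"

definition gdet2 :: "complex^'c^'p \<Rightarrow> complex^'k^'p \<Rightarrow> real" where
  "gdet2 H A = Re (det (mat 1 + H ** cadj H + A ** cadj A))"

text \<open>The log-ratio of the density of \<open>y\<close> given \<open>s\<close> to that of
  \<open>y\<close>, where the cognitive signal \<open>H *v v\<close> counts as noise at the primary
  receiver.\<close>

definition ll3 :: "complex^'k^'p \<Rightarrow> complex^'c^'p \<Rightarrow> complex^'k \<Rightarrow> complex^'p \<Rightarrow> real" where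
  "ll3 A H s y = ln (gdet2 H A) - ln (gdet H) + y \<bullet> (pinv (mat 1 + H ** cadj H + A ** cadj A) *v y)
     - (y - A *v s) \<bullet> (pinv (mat 1 + H ** cadj H) *v (y - A *v s))"

lemma gdet2_ge: "gdet H \<le> gdet2 H A"
  unfolding gdet2_def by (rule posinv_plus(2)[OF posinv_mat_1_plus])

lemma posinv_gdet2: "posinv (mat 1 + H ** cadj H + A ** cadj A) (pinv (mat 1 + H ** cadj H + A ** cadj A)) (gdet2 H A)"
  unfolding gdet2_def by (rule posinv_plus(1)[OF posinv_mat_1_plus])

lemma ll1_shift:
  assumes [measurable]: "f \<in> borel_measurable borel"
  shows "(\<integral>\<^sup>+u. ennreal (exp (ll1 C u s)) * f u \<partial>cgauss) = (\<integral>\<^sup>+v. f (C *v s + v) \<partial>cgauss)"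
  unfolding ll1_def by (rule nn_integral_cgauss_shift) measurable

lemma emeasure_cgauss_UNIV [simp]: "emeasure cgauss UNIV = 1"
  using prob_space.emeasure_space_1[OF prob_space_cgauss] by simp

lemma ll1_int: "(\<integral>\<^sup>+u. ennreal (exp (ll1 C u s)) \<partial>cgauss) = 1"
  using ll1_shift[of "\<lambda>_. 1" C s] by simp

text \<open>The shift by \<open>mmse H *v y\<close> disposes of the output, and what remains is the
  Gaussian integral at \<open>y = 0\<close>, the reciprocal of \<open>gdet H\<close>.\<close>

lemma ll2_int: "(\<integral>\<^sup>+u. ennreal (exp (ll2 H u y)) \<partial>cgauss) = 1"
proof -
  let ?m = "mmse H *v y"
  have g: "0 < gdet H" using gdet_ge_1[of H] by simp
  have split: "ennreal (exp (ll2 H u y)) = ennreal (exp ((norm u)\<^sup>2 - (norm (u - ?m))\<^sup>2)) * ennreal (gdet H * exp (- (norm (H *v (u - ?m)))\<^sup>2))" for u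
  proof -
    have "exp (ll2 H u y) = exp (ln (gdet H)) * exp ((norm u)\<^sup>2 - (norm (u - ?m))\<^sup>2) * exp (- (norm (H *v (u - ?m)))\<^sup>2)"
      unfolding ll2_def exp_add[symmetric] by (simp add: algebra_simps)
    then show ?thesis using g by (simp add: mult_ac flip: ennreal_mult)
  qed
  have "(\<integral>\<^sup>+u. ennreal (exp (ll2 H u y)) \<partial>cgauss) = (\<integral>\<^sup>+v. ennreal (gdet H * exp (- (norm (H *v (?m + v - ?m)))\<^sup>2)) \<partial>cgauss)"
    unfolding split by (rule nn_integral_cgauss_shift) measurable
  also have "\<dots> = (\<integral>\<^sup>+v. ennreal (gdet H) * ennreal (exp (- ((0 - H *v v) \<bullet> (mat 1 *v (0 - H *v v))))) \<partial>cgauss)"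
    using g by (intro nn_integral_cong) (simp add: power2_norm_eq_inner flip: ennreal_mult)
  also have "\<dots> = ennreal (gdet H) * (\<integral>\<^sup>+v. ennreal (exp (- ((0 - H *v v) \<bullet> (mat 1 *v (0 - H *v v))))) \<partial>cgauss)"
    by (rule nn_integral_cmult) measurable
  also have "\<dots> = 1"
    using g unfolding posinv_plus(3)[OF posinv_mat_1] gdet_def[symmetric] by (simp flip: ennreal_mult)
  finally show ?thesis .
qed

text \<open>The likelihood of \<open>y\<close> given \<open>s\<close>, averaged over
  \<open>s\<close>, is the marginal likelihood in the denominator of the ratio.\<close>

lemma ll3_int: "(\<integral>\<^sup>+s. ennreal (exp (ll3 A H s y)) \<partial>cgauss) = 1"
proof -
  have g: "0 < gdet H" "0 < gdet2 H A" using gdet_ge_1[of H] gdet2_ge[of H A] by auto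
  let ?q = "y \<bullet> (pinv (mat 1 + H ** cadj H + A ** cadj A) *v y)"
  let ?L = "pinv (mat 1 + H ** cadj H)"
  have "ennreal (exp (ll3 A H s y)) = ennreal (gdet2 H A / gdet H * exp ?q) * ennreal (exp (- ((y - A *v s) \<bullet> (?L *v (y - A *v s)))))" for s
    unfolding ll3_def using g by (simp add: exp_add exp_diff exp_minus divide_inverse flip: ennreal_mult)
  then have "(\<integral>\<^sup>+s. ennreal (exp (ll3 A H s y)) \<partial>cgauss) = ennreal (gdet2 H A / gdet H * exp ?q) * (\<integral>\<^sup>+s. ennreal (exp (- ((y - A *v s) \<bullet> (?L *v (y - A *v s))))) \<partial>cgauss)"
    by (simp only:) (rule nn_integral_cmult, measurable)
  also have "\<dots> = ennreal (gdet2 H A / gdet H * exp ?q) * ennreal (gdet H / gdet2 H A * exp (- ?q))"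
    unfolding posinv_plus(3)[OF posinv_mat_1_plus] gdet2_def ..
  also have "\<dots> = ennreal ((gdet2 H A / gdet H * (gdet H / gdet2 H A)) * (exp ?q * exp (- ?q)))"
    using g by (subst ennreal_mult[symmetric]) (auto simp: mult_ac)
  also have "\<dots> = 1" using g by (simp flip: exp_add)
  finally show ?thesis .
qed

text \<open>The heart of dirty-paper coding: because \<open>C = mmse H ** B\<close>, the error
  \<open>u - mmse H *v y\<close> equals \<open>v - mmse H *v (H *v v + z)\<close>, free of the
  interference \<open>B *v s\<close>. Only the norm of \<open>u\<close> still depends on
  \<open>s\<close>, and this excess is the one that binning pays for through
  \<open>ll1\<close>.\<close>

lemma mmse_identity:
  fixes H :: "complex^'c^'r" and B :: "complex^'k^'r"
  defines "C \<equiv> mmse H ** B"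
  shows "ll2 H (C *v s + v) (B *v s + H *v v + z)
    = ln (gdet H) + (norm (C *v s + v))\<^sup>2 - (norm v)\<^sup>2 - (norm z)\<^sup>2
      + (H *v v + z) \<bullet> (pinv (mat 1 + H ** cadj H) *v (H *v v + z))"
proof -
  let ?L = "pinv (mat 1 + H ** cadj H)"
  define w where "w = H *v v + z"
  define g where "g = ?L *v w"
  define h where "h = cadj H *v g"
  have NL: "(mat 1 + H ** cadj H) ** ?L = mat 1" using posinv_mat_1_plus[of H] by (simp add: posinv_def)
  have "(mat 1 + H ** cadj H) *v g = w"
    unfolding g_def by (simp add: matrix_vector_mul_assoc NL)
  then have wg: "w = g + H *v h"
    by (simp add: h_def matrix_vector_mult_add_rdistrib matrix_vector_mul_assoc)
  have Ww: "mmse H *v w = h" by (simp add: mmse_def h_def g_def matrix_vector_mul_assoc)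
  have e: "C *v s + v - mmse H *v (B *v s + H *v v + z) = v - h"
  proof -
    have "mmse H *v (B *v s + H *v v + z) = C *v s + mmse H *v w"
      by (simp add: C_def w_def matrix_vector_mul_assoc[symmetric] matrix_vector_right_distrib add.assoc)
    then show ?thesis by (simp add: Ww)
  qed
  have He: "H *v (v - h) = g - z"
    using wg by (simp add: matrix_vector_mult_diff_distrib w_def algebra_simps)
  have 1: "v \<bullet> h = (H *v v) \<bullet> g" unfolding h_def using inner_cadj[of v "cadj H" g] by simp
  have 2: "h \<bullet> h = g \<bullet> (H *v h)" unfolding h_def[symmetric] inner_cadj[of g H h] by (simp add: h_def)
  have 3: "H *v h = w - g" using wg by simp
  have "(norm (v - h))\<^sup>2 + (norm (g - z))\<^sup>2 = (norm v)\<^sup>2 + (norm z)\<^sup>2 - 2 * ((H *v v + z) \<bullet> g) + g \<bullet> w"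
    using 1 2 by (simp add: power2_norm_eq_inner inner_diff_left inner_diff_right inner_add_left inner_add_right inner_commute 3)
  also have "\<dots> = (norm v)\<^sup>2 + (norm z)\<^sup>2 - w \<bullet> g"
    unfolding w_def[symmetric] by (simp add: inner_commute)
  finally show ?thesis
    unfolding ll2_def e He w_def[symmetric] g_def[symmetric] by simp
qed

section \<open>Operating points of the cognitive channel as letter schemes\<close>

lemma sum_UNIV_Plus: "(\<Sum>j\<in>UNIV. g j) = (\<Sum>j\<in>UNIV. g (Inl j)) + (\<Sum>j\<in>UNIV. g (Inr j))"
  for g :: "'a::finite + 'b::finite \<Rightarrow> 'c::comm_monoid_add"
  by (subst UNIV_Plus_UNIV[symmetric], subst sum.Plus) auto

lemma hcat_mult_vec: "hcat A B *v x = A *v (\<chi> i. x $ Inl i) + B *v (\<chi> i. x $ Inr i)"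
  by (simp add: vec_eq_iff matrix_vector_mult_def sum_UNIV_Plus hcat_def)

definition top_rows :: "complex^'k^('a::finite + 'b::finite) \<Rightarrow> complex^'k^'a" where "top_rows K = (\<chi> i. K $ Inl i)"
definition bot_rows :: "complex^'k^('a::finite + 'b::finite) \<Rightarrow> complex^'k^'b" where "bot_rows K = (\<chi> i. K $ Inr i)"

lemma hcat_mult_rows: "(hcat A B ** K) *v s = A *v (top_rows K *v s) + B *v (bot_rows K *v s)"
proof -
  have "(\<chi> i. (K *v s) $ Inl i) = top_rows K *v s" "(\<chi> i. (K *v s) $ Inr i) = bot_rows K *v s"
    by (simp_all add: vec_eq_iff matrix_vector_mult_def top_rows_def bot_rows_def)
  then show ?thesis by (simp add: matrix_vector_mul_assoc[symmetric] hcat_mult_vec)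
qed

text \<open>A primary letter has as many coordinates as both transmitters have antennas together,
  because \<open>K j\<close> is a square root of the joint covariance. The primary transmitter uses
  its top rows and the cognitive transmitter its bottom rows.\<close>

locale mcc_family =
  fixes Hpp :: "complex^'pt^'pr" and Hcp :: "complex^'ct^'pr" and Hpc :: "complex^'pt^'cr" and Hcc :: "complex^'ct^'cr"
    and K :: "'j \<Rightarrow> complex^('pt + 'ct)^('pt + 'ct)" and T :: "'j \<Rightarrow> complex^'ct^'ct"
begin

text \<open>The digit 3 marks the primary receiver, whose metric is \<open>ll3\<close>, and 2 the
  cognitive receiver with \<open>ll2\<close>.\<close>

definition "A3 j = hcat Hpp Hcp ** K j"
definition "H3 j = Hcp ** T j"
definition "B2 j = hcat Hpc Hcc ** K j"
definition "H2 j = Hcc ** T j"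
definition "C j = mmse (H2 j) ** B2 j"
definition "xp j s = top_rows (K j) *v s"
definition "xc j u s = bot_rows (K j) *v s + T j *v (u - C j *v s)"
definition "fp j u s = A3 j *v s + H3 j *v (u - C j *v s)"
definition "fc j u s = B2 j *v s + H2 j *v (u - C j *v s)"
definition "ep j s = (norm (xp j s))\<^sup>2"
definition "ec j u s = (norm (xc j u s))\<^sup>2"

lemma fp_eq: "fp j u s = Hpp *v xp j s + Hcp *v xc j u s"
  by (simp add: fp_def A3_def H3_def xp_def xc_def hcat_mult_rows matrix_vector_right_distrib matrix_vector_mul_assoc)

lemma fc_eq: "fc j u s = Hpc *v xp j s + Hcc *v xc j u s"
  by (simp add: fc_def B2_def H2_def xp_def xc_def hcat_mult_rows matrix_vector_right_distrib matrix_vector_mul_assoc)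

sublocale letter_scheme "\<lambda>j. ll1 (C j)" "\<lambda>j. ll2 (H2 j)" "\<lambda>j. ll3 (A3 j) (H3 j)" fp fc ep ec
proof
  show "(\<lambda>(u, s). ll1 (C j) u s) \<in> borel_measurable (borel \<Otimes>\<^sub>M borel)" for j unfolding ll1_def by measurable
  show "(\<lambda>(u, y). ll2 (H2 j) u y) \<in> borel_measurable (borel \<Otimes>\<^sub>M borel)" for j unfolding ll2_def by measurable
  show "(\<lambda>(s, y). ll3 (A3 j) (H3 j) s y) \<in> borel_measurable (borel \<Otimes>\<^sub>M borel)" for j unfolding ll3_def by measurable
  show "(\<lambda>(u, s). fp j u s) \<in> borel_measurable (borel \<Otimes>\<^sub>M borel)" for j unfolding fp_def by measurable
  show "(\<lambda>(u, s). fc j u s) \<in> borel_measurable (borel \<Otimes>\<^sub>M borel)" for j unfolding fc_def by measurable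
  show "ep j \<in> borel_measurable borel" for j unfolding ep_def[abs_def] xp_def by measurable
  show "(\<lambda>(u, s). ec j u s) \<in> borel_measurable (borel \<Otimes>\<^sub>M borel)" for j unfolding ec_def xc_def by measurable
qed (simp_all add: ll1_int ll2_int ll3_int)

text \<open>Weighting by \<open>exp (ll1 (C j) u s)\<close> replaces \<open>u\<close> by
  \<open>C j *v s + v\<close> with \<open>v\<close> standard Gaussian, so that three independent
  Gaussians remain.\<close>

lemma tilt_eq_gauss3:
  fixes X :: "'j \<Rightarrow> complex^'ct \<Rightarrow> complex^('pt + 'ct) \<Rightarrow> complex^'z \<Rightarrow> real"
  assumes X: "\<And>j. (\<lambda>(u, s, z). X j u s z) \<in> borel_measurable (borel \<Otimes>\<^sub>M borel \<Otimes>\<^sub>M borel)"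
  shows "tilt t X j = (\<integral>\<^sup>+x. ennreal (exp (t * (case x of (s, v, z) \<Rightarrow> X j (C j *v s + v) s z))) \<partial>gauss3)"
proof -
  interpret Z: prob_space "cgauss :: (complex^'z) measure" by (rule prob_space_cgauss)
  note [measurable] = measurable_case_prod3[OF X]
  have "tilt t X j = (\<integral>\<^sup>+s. (\<integral>\<^sup>+u. ennreal (exp (ll1 (C j) u s)) * (\<integral>\<^sup>+z. ennreal (exp (t * X j u s z)) \<partial>cgauss) \<partial>cgauss) \<partial>cgauss)"
    unfolding tilt_def by (intro nn_integral_cong) (simp add: exp_add ennreal_mult nn_integral_cmult)
  also have "\<dots> = (\<integral>\<^sup>+s. (\<integral>\<^sup>+v. (\<integral>\<^sup>+z. ennreal (exp (t * X j (C j *v s + v) s z)) \<partial>cgauss) \<partial>cgauss) \<partial>cgauss)"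
    by (intro nn_integral_cong ll1_shift) measurable
  also have "\<dots> = (\<integral>\<^sup>+(s, v, z). ennreal (exp (t * X j (C j *v s + v) s z)) \<partial>gauss3)"
    by (rule nn_integral_gauss3[symmetric]) measurable
  finally show ?thesis by (simp add: split_def)
qed

text \<open>After the substitution the variable has quadratic growth, hence exponential moments. Its
  mean has to be negative only on average with the weights \<open>l\<close>, so rates and powers may
  be met on average over the operating points.\<close>

lemma eventually_tilt_lt_1:
  fixes X :: "'j \<Rightarrow> complex^'ct \<Rightarrow> complex^('pt + 'ct) \<Rightarrow> complex^'z \<Rightarrow> real"
  assumes I: "finite I" and l: "(\<Sum>j\<in>I. l j) = 1" "\<And>j. j \<in> I \<Longrightarrow> 0 \<le> l j"
    and X: "\<And>j. (\<lambda>(u, s, z). X j u s z) \<in> borel_measurable (borel \<Otimes>\<^sub>M borel \<Otimes>\<^sub>M borel)"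
    and Y: "\<And>j. (\<lambda>s v z. X j (C j *v s + v) s z) = Y j" "\<And>j. qgrow (Y j)"
    and mean: "\<And>j. has_bochner_integral gauss3 (\<lambda>(s, v, z). Y j s v z) (m j)" and neg: "(\<Sum>j\<in>I. l j * m j) < 0"
  shows "\<forall>\<^sub>F t in at_right 0. (\<Sum>j\<in>I. ennreal (l j) * tilt t X j) < 1"
proof -
  note [measurable] = measurable_case_prod3[OF X]
  have Yeq: "Y j s v z = X j (C j *v s + v) s z" for j s v z using Y(1)[of j] by (auto simp: fun_eq_iff)
  have "(\<lambda>(s, v, z). Y j s v z) \<in> borel_measurable (borel \<Otimes>\<^sub>M borel \<Otimes>\<^sub>M borel)" for j unfolding Yeq by measurable
  from qgrow_exp_integrable[OF Y(2) this]
  have "\<exists>t0>0. integrable gauss3 (\<lambda>x. exp (t0 * (case x of (s, v, z) \<Rightarrow> Y j s v z)))" for j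
    by (simp add: split_def)
  from eventually_exp_moment_lt[where M="\<lambda>_. gauss3" and X="\<lambda>j (s, v, z). Y j s v z" and r=0, OF I l prob_space_gauss3 mean this neg]
  show ?thesis by (simp add: tilt_eq_gauss3[OF X] Yeq)
qed

text \<open>The mean of \<open>ll1\<close> is the squared norm of \<open>C j\<close>, and that of
  \<open>ll2\<close> is \<open>ln (gdet (H2 j))\<close> plus the same squared norm. With the bin
  rate \<open>r1\<close> slightly above \<open>a\<close> and the threshold \<open>r2\<close>
  slightly below \<open>g + a\<close>, every cognitive rate below \<open>g\<close> fits in
  between.\<close>

theorem family_code:
  fixes l :: "'j \<Rightarrow> real" and Pp Pc Rp Rc eps :: real
  assumes I: "finite I" and l: "(\<Sum>j\<in>I. l j) = 1" "\<And>j. j \<in> I \<Longrightarrow> 0 \<le> l j" and eps: "0 < eps"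
    and Rp: "Rp = 0 \<or> Rp * ln 2 < (\<Sum>j\<in>I. l j * (ln (gdet2 (H3 j) (A3 j)) - ln (gdet (H3 j))))"
    and Rc: "Rc = 0 \<or> Rc * ln 2 < (\<Sum>j\<in>I. l j * ln (gdet (H2 j)))"
    and Pp: "(\<Sum>j\<in>I. l j * (norm (top_rows (K j)))\<^sup>2) < Pp"
    and Pc: "(\<Sum>j\<in>I. l j * ((norm (bot_rows (K j)))\<^sup>2 + (norm (T j))\<^sup>2)) < Pc"
  shows "\<exists>N. \<forall>n\<ge>N. good_code I n Pp Pc Rp Rc eps"
proof -
  define a where "a = (\<Sum>j\<in>I. l j * (norm (C j))\<^sup>2)"
  define g where "g = (\<Sum>j\<in>I. l j * ln (gdet (H2 j)))"
  define f where "f = (\<Sum>j\<in>I. l j * (ln (gdet2 (H3 j) (A3 j)) - ln (gdet (H3 j))))"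
  have a0: "0 \<le> a" unfolding a_def using l by (intro sum_nonneg) auto
  \<comment> \<open>A third of the gap \<open>g - Rc * ln 2\<close> is the margin of
    \<open>r1\<close>, a third that of \<open>r2\<close>, and the last third separates
    \<open>Rc * ln 2 + r1\<close> from \<open>r2\<close>.\<close>
  obtain r1 r2 where r: "a < r1" "r2 < g + a" "0 < r1" "Rc = 0 \<or> Rc * ln 2 + r1 < r2"
  proof (cases "Rc = 0")
    case True
    then show ?thesis using a0 by (intro that[of "a + 1" "g + a - 1"]) auto
  next
    case False
    then have "Rc * ln 2 < g" using Rc by (simp add: g_def)
    then show ?thesis using a0 by (intro that[of "a + (g - Rc * ln 2) / 3" "g + a - (g - Rc * ln 2) / 3"]) (auto simp: field_simps)
  qed
  obtain r3 where r3: "r3 < f" "Rp = 0 \<or> Rp * ln 2 < r3"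
  proof (cases "Rp = 0")
    case True
    then show ?thesis by (intro that[of "f - 1"]) auto
  next
    case False
    then have "Rp * ln 2 < f" using Rp by (simp add: f_def)
    then show ?thesis using that dense by blast
  qed
  note qs = qgrow_const qgrow_add qgrow_diff qgrow_norm qgrow_inner qlin_add qlin_mult qlin_proj
  have mC: "has_bochner_integral gauss3 (\<lambda>(s, v, z::complex^'x). (norm (C j *v s + v))\<^sup>2) ((norm (C j))\<^sup>2 + CARD('ct))" for j
    using gauss3_norm_mean[of "C j" "mat 1" "0 :: complex^'x^'ct"] by (simp add: norm_mat_1)
  have mv: "has_bochner_integral gauss3 (\<lambda>(s::complex^('pt + 'ct), v::complex^'ct, z::complex^'x). (norm v)\<^sup>2) (real CARD('ct))"
    using gauss3_norm_mean[of "0 :: complex^('pt + 'ct)^'ct" "mat 1" "0 :: complex^'x^'ct"] by (simp add: norm_mat_1)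
  have mz: "has_bochner_integral gauss3 (\<lambda>(s::complex^('pt + 'ct), v::complex^'ct, z::complex^'x). (norm z)\<^sup>2) (real CARD('x))"
    using gauss3_norm_mean[of "0 :: complex^('pt + 'ct)^'x" "0 :: complex^'ct^'x" "mat 1"] by (simp add: norm_mat_1)
  have bc: "has_bochner_integral gauss3 (\<lambda>(s::complex^('pt + 'ct), v::complex^'ct, z::complex^'x). c) c" for c :: real
  proof -
    interpret prob_space "gauss3 :: ((complex^('pt + 'ct)) \<times> (complex^'ct) \<times> (complex^'x)) measure" by (rule prob_space_gauss3)
    show ?thesis by (simp add: split_def prob_space has_bochner_integral_iff)
  qed
  have sum_l: "(\<Sum>j\<in>I. l j * (x j - r)) = (\<Sum>j\<in>I. l j * x j) - r" for x and r :: real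
    using l(1) by (simp add: right_diff_distrib sum_subtractf flip: sum_distrib_right)
  have E1: "\<forall>\<^sub>F t in at_right 0. (\<Sum>j\<in>I. ennreal (l j) * tilt t (x1 r1) j) < 1"
  proof (rule eventually_tilt_lt_1[where Y="\<lambda>j s v z. (norm (C j *v s + v))\<^sup>2 - (norm v)\<^sup>2 - r1" and m="\<lambda>j. (norm (C j))\<^sup>2 - r1", OF I l x_meas(1)])
    show "has_bochner_integral gauss3 (\<lambda>(s, v, z::complex^'ct). (norm (C j *v s + v))\<^sup>2 - (norm v)\<^sup>2 - r1) ((norm (C j))\<^sup>2 - r1)" for j
      using has_bochner_integral_diff[OF has_bochner_integral_diff[OF mC mv] bc, of j r1] by (simp add: split_def)
    show "(\<Sum>j\<in>I. l j * ((norm (C j))\<^sup>2 - r1)) < 0" using r(1) by (simp add: sum_l a_def)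
  qed (auto simp: x1_def ll1_def intro!: qs)
  \<comment> \<open>The squared norm of \<open>C j *v s + v\<close> contributes
    \<open>CARD('ct)\<close> to the mean, which cancels against that of \<open>v\<close>; the
    quadratic form has the same mean \<open>CARD('cr)\<close> as the squared norm of the
    noise.\<close>
  have E2: "\<forall>\<^sub>F t in at_right 0. (\<Sum>j\<in>I. ennreal (l j) * tilt t (x2 r2) j) < 1"
  proof -
    let ?L = "\<lambda>j. pinv (mat 1 + H2 j ** cadj (H2 j))"
    let ?Y = "\<lambda>j s v z. r2 - (ln (gdet (H2 j)) + (norm (C j *v s + v))\<^sup>2 - (norm v)\<^sup>2 - (norm z)\<^sup>2 + (H2 j *v v + z) \<bullet> (?L j *v (H2 j *v v + z)))"
    have mq: "has_bochner_integral gauss3 (\<lambda>(s::complex^('pt + 'ct), v, z). (H2 j *v v + z) \<bullet> (?L j *v (H2 j *v v + z))) (real CARD('cr))" for j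
      using gauss3_form_mean[of "H2 j" "0 :: complex^('pt + 'ct)^'cr" "?L j" "gdet (H2 j)"] posinv_mat_1_plus[of "H2 j"] by simp
    show ?thesis
    proof (rule eventually_tilt_lt_1[where Y="?Y" and m="\<lambda>j. r2 - (ln (gdet (H2 j)) + (norm (C j))\<^sup>2)", OF I l x_meas(2)])
      show "(\<lambda>s v z. x2 r2 j (C j *v s + v) s z) = ?Y j" for j
        unfolding x2_def fc_def C_def using mmse_identity[of "H2 j" "B2 j"] by (simp add: fun_eq_iff)
      show "has_bochner_integral gauss3 (\<lambda>(s, v, z). ?Y j s v z) (r2 - (ln (gdet (H2 j)) + (norm (C j))\<^sup>2))" for j
        using has_bochner_integral_diff[OF bc[of r2] has_bochner_integral_add[OF has_bochner_integral_diff[OF has_bochner_integral_diff[OF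
            has_bochner_integral_add[OF bc[of "ln (gdet (H2 j))"] mC[of j]] mv] mz] mq[of j]]] by (simp add: split_def)
      show "(\<Sum>j\<in>I. l j * (r2 - (ln (gdet (H2 j)) + (norm (C j))\<^sup>2))) < 0"
        using r(2) sum_l[of "\<lambda>j. ln (gdet (H2 j)) + (norm (C j))\<^sup>2" r2]
        by (simp add: right_diff_distrib sum_subtractf distrib_left sum.distrib g_def a_def)
    qed (assumption | intro qs)+
  qed
  \<comment> \<open>Both quadratic forms have mean \<open>CARD('pr)\<close>, so only the
    log-determinants remain.\<close>
  have E3: "\<forall>\<^sub>F t in at_right 0. (\<Sum>j\<in>I. ennreal (l j) * tilt t (x3 r3) j) < 1"
  proof -
    let ?L1 = "\<lambda>j. pinv (mat 1 + H3 j ** cadj (H3 j))"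
    let ?L2 = "\<lambda>j. pinv (mat 1 + H3 j ** cadj (H3 j) + A3 j ** cadj (A3 j))"
    let ?f = "\<lambda>j. ln (gdet2 (H3 j) (A3 j)) - ln (gdet (H3 j))"
    let ?Y = "\<lambda>j s v z. r3 - (?f j + (A3 j *v s + H3 j *v v + z) \<bullet> (?L2 j *v (A3 j *v s + H3 j *v v + z)) - (H3 j *v v + z) \<bullet> (?L1 j *v (H3 j *v v + z)))"
    have mq: "has_bochner_integral gauss3 (\<lambda>(s::complex^('pt + 'ct), v, z). (H3 j *v v + z) \<bullet> (?L1 j *v (H3 j *v v + z))) (real CARD('pr))" for j
      using gauss3_form_mean[of "H3 j" "0 :: complex^('pt + 'ct)^'pr" "?L1 j" "gdet (H3 j)"] posinv_mat_1_plus[of "H3 j"] by simp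
    show ?thesis
    proof (rule eventually_tilt_lt_1[where Y="?Y" and m="\<lambda>j. r3 - ?f j", OF I l x_meas(3)])
      show "(\<lambda>s v z. x3 r3 j (C j *v s + v) s z) = ?Y j" for j
      proof (intro ext)
        fix s v z
        have 1: "fp j (C j *v s + v) s + z = A3 j *v s + H3 j *v v + z" by (simp add: fp_def)
        have 2: "A3 j *v s + H3 j *v v + z - A3 j *v s = H3 j *v v + z" by simp
        show "x3 r3 j (C j *v s + v) s z = ?Y j s v z" unfolding x3_def 1 ll3_def 2 ..
      qed
      show "has_bochner_integral gauss3 (\<lambda>(s, v, z). ?Y j s v z) (r3 - ?f j)" for j
        using has_bochner_integral_diff[OF bc[of r3] has_bochner_integral_diff[OF has_bochner_integral_add[OF bc[of "?f j"] gauss3_form_mean[OF posinv_gdet2]] mq[of j]]]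
        by (simp add: split_def)
      show "(\<Sum>j\<in>I. l j * (r3 - ?f j)) < 0"
        using r3(1) sum_l[of ?f r3] by (simp add: right_diff_distrib sum_subtractf f_def)
    qed (assumption | intro qs)+
  qed
  have E4: "\<forall>\<^sub>F t in at_right 0. (\<Sum>j\<in>I. ennreal (l j) * tilt t (x4 Pp) j) < 1"
  proof (rule eventually_tilt_lt_1[where Y="\<lambda>j s v z. (norm (top_rows (K j) *v s))\<^sup>2 - Pp" and m="\<lambda>j. (norm (top_rows (K j)))\<^sup>2 - Pp", OF I l x_meas(4)])
    show "has_bochner_integral gauss3 (\<lambda>(s, v::complex^'ct, z::complex^'ct). (norm (top_rows (K j) *v s))\<^sup>2 - Pp) ((norm (top_rows (K j)))\<^sup>2 - Pp)" for j
      using has_bochner_integral_diff[OF gauss3_norm_mean[of "top_rows (K j)" "0 :: complex^'ct^'pt" "0 :: complex^'ct^'pt"] bc[of Pp]] by (simp add: split_def)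
    show "(\<Sum>j\<in>I. l j * ((norm (top_rows (K j)))\<^sup>2 - Pp)) < 0" using Pp by (simp add: sum_l)
  qed (auto simp: x4_def ep_def xp_def intro!: qs)
  have E5: "\<forall>\<^sub>F t in at_right 0. (\<Sum>j\<in>I. ennreal (l j) * tilt t (x5 Pc) j) < 1"
  proof (rule eventually_tilt_lt_1[where Y="\<lambda>j s v z. (norm (bot_rows (K j) *v s + T j *v v))\<^sup>2 - Pc" and m="\<lambda>j. (norm (bot_rows (K j)))\<^sup>2 + (norm (T j))\<^sup>2 - Pc", OF I l x_meas(5)])
    show "has_bochner_integral gauss3 (\<lambda>(s, v, z::complex^'ct). (norm (bot_rows (K j) *v s + T j *v v))\<^sup>2 - Pc) ((norm (bot_rows (K j)))\<^sup>2 + (norm (T j))\<^sup>2 - Pc)" for j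
      using has_bochner_integral_diff[OF gauss3_norm_mean[of "bot_rows (K j)" "T j" "0 :: complex^'ct^'ct"] bc[of Pc]] by (simp add: split_def)
    show "(\<Sum>j\<in>I. l j * ((norm (bot_rows (K j)))\<^sup>2 + (norm (T j))\<^sup>2 - Pc)) < 0" using Pc by (simp add: sum_l)
  qed (auto simp: x5_def ec_def xc_def intro!: qs)
  have E6: "\<forall>\<^sub>F t in at_right (0::real). 0 < t \<and> t \<le> 1"
    unfolding eventually_at_right_field by (intro exI[of _ 1]) auto
  \<comment> \<open>Each condition holds for all sufficiently small \<open>t > 0\<close>, so one
    \<open>t\<close> serves the five bad events together.\<close>
  have "\<forall>\<^sub>F t in at_right 0. (0 < t \<and> t \<le> 1) \<and> (\<Sum>j\<in>I. ennreal (l j) * tilt t (x1 r1) j) < 1 \<and> (\<Sum>j\<in>I. ennreal (l j) * tilt t (x2 r2) j) < 1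
     \<and> (\<Sum>j\<in>I. ennreal (l j) * tilt t (x3 r3) j) < 1 \<and> (\<Sum>j\<in>I. ennreal (l j) * tilt t (x4 Pp) j) < 1 \<and> (\<Sum>j\<in>I. ennreal (l j) * tilt t (x5 Pc) j) < 1"
    using E1 E2 E3 E4 E5 E6 by eventually_elim blast
  then obtain t where t: "0 < t" "t \<le> 1" "(\<Sum>j\<in>I. ennreal (l j) * tilt t (x1 r1) j) < 1" "(\<Sum>j\<in>I. ennreal (l j) * tilt t (x2 r2) j) < 1"
     "(\<Sum>j\<in>I. ennreal (l j) * tilt t (x3 r3) j) < 1" "(\<Sum>j\<in>I. ennreal (l j) * tilt t (x4 Pp) j) < 1" "(\<Sum>j\<in>I. ennreal (l j) * tilt t (x5 Pc) j) < 1"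
    using eventually_happens'[of "at_right (0::real)"] by auto
  show ?thesis
    by (rule asymptotic_code_exists[OF I l t(1,2) eps r(3) r3(2) r(4) t(3-7)])
qed

end

section \<open>Power constraints\<close>

text \<open>The trace of a covariance is the mean square minus the square of the mean. A sole
  codeword is its own mean, so its covariance vanishes.\<close>

lemma cov_unif_trace_le:
  fixes f :: "'m \<Rightarrow> complex^'n"
  assumes "finite S" "S \<noteq> {}"
  shows "Re (ctrace (cov_unif S f)) \<le> (1 / real (card S)) * (\<Sum>m\<in>S. (norm (f m))\<^sup>2)"
    and "card S = 1 \<Longrightarrow> Re (ctrace (cov_unif S f)) = 0"
proof -
  define c where "c = real (card S)"
  have c: "0 < c" using assms by (simp add: c_def card_gt_0_iff)
  define mu where "mu = (1 / c) *\<^sub>R (\<Sum>m\<in>S. f m)"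
  have tr: "Re (ctrace (outer x x)) = (norm x)\<^sup>2" for x :: "complex^'n"
    by (simp add: ctrace_def outer_def norm_vec_def L2_set_def sum_nonneg cmod_power2 power2_eq_square)
       (simp add: cmod_power2 flip: power2_eq_square)
  have trs: "Re (ctrace (a *\<^sub>R (\<Sum>m\<in>S. outer (g m) (g m)))) = a * (\<Sum>m\<in>S. (norm (g m))\<^sup>2)" for a and g :: "'m \<Rightarrow> complex^'n"
  proof -
    have "Re (ctrace (a *\<^sub>R (\<Sum>m\<in>S. outer (g m) (g m)))) = a * (\<Sum>m\<in>S. Re (ctrace (outer (g m) (g m))))"
      unfolding ctrace_def by (simp add: sum_distrib_left sum.swap[of _ UNIV S])
    then show ?thesis by (simp add: tr)
  qed
  have cov: "Re (ctrace (cov_unif S f)) = (1 / c) * (\<Sum>m\<in>S. (norm (f m - mu))\<^sup>2)"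
    unfolding cov_unif_def Let_def c_def[symmetric] mu_def[symmetric] by (rule trs)
  have sumf: "(\<Sum>m\<in>S. f m) = c *\<^sub>R mu" using c by (simp add: mu_def)
  have "(\<Sum>m\<in>S. (norm (f m - mu))\<^sup>2) = (\<Sum>m\<in>S. (norm (f m))\<^sup>2 - 2 * (f m \<bullet> mu) + mu \<bullet> mu)"
    by (intro sum.cong refl) (simp add: power2_norm_eq_inner inner_diff_left inner_diff_right inner_commute)
  also have "\<dots> = (\<Sum>m\<in>S. (norm (f m))\<^sup>2) - 2 * ((\<Sum>m\<in>S. f m) \<bullet> mu) + c * (mu \<bullet> mu)"
    by (simp add: sum.distrib sum_subtractf inner_sum_left sum_distrib_left c_def)
  also have "\<dots> = (\<Sum>m\<in>S. (norm (f m))\<^sup>2) - c * (mu \<bullet> mu)" by (simp add: sumf)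
  also have "\<dots> \<le> (\<Sum>m\<in>S. (norm (f m))\<^sup>2)" using c by simp
  finally show "Re (ctrace (cov_unif S f)) \<le> (1 / real (card S)) * (\<Sum>m\<in>S. (norm (f m))\<^sup>2)"
    unfolding cov c_def[symmetric] using c by (intro mult_left_mono) auto
  show "Re (ctrace (cov_unif S f)) = 0" if S1: "card S = 1"
  proof -
    obtain x where "S = {x}" using S1 by (rule card_1_singletonE)
    then show ?thesis unfolding cov by (simp add: mu_def c_def)
  qed
qed

text \<open>Silent messages stay in the average but contribute nothing, so a budget \<open>B\<close>
  on the messages in \<open>A\<close> is reduced by the factor \<open>\<theta>\<close>.\<close>

lemma cov_unif_power_le:
  fixes f :: "'m \<Rightarrow> nat \<Rightarrow> complex^'n"
  assumes S: "finite S" "S \<noteq> {}" and A: "A \<subseteq> S" "real (card A) \<le> \<theta> * real (card S)"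
    and f: "\<And>m. m \<in> A \<Longrightarrow> (\<Sum>i<n. (norm (f m i))\<^sup>2) \<le> B" "\<And>m i. m \<in> S - A \<Longrightarrow> f m i = 0" and B: "0 \<le> B"
  shows "(\<Sum>i<n. Re (ctrace (cov_unif S (\<lambda>m. f m i)))) \<le> \<theta> * B"
proof -
  have c: "0 < real (card S)" using S by (simp add: card_gt_0_iff)
  have "(\<Sum>i<n. Re (ctrace (cov_unif S (\<lambda>m. f m i)))) \<le> (\<Sum>i<n. (1 / real (card S)) * (\<Sum>m\<in>S. (norm (f m i))\<^sup>2))"
    by (intro sum_mono cov_unif_trace_le S)
  also have "\<dots> = (1 / real (card S)) * (\<Sum>m\<in>S. \<Sum>i<n. (norm (f m i))\<^sup>2)"
    by (simp only: sum_distrib_left[symmetric], subst sum.swap, rule refl)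
  also have "(\<Sum>m\<in>S. \<Sum>i<n. (norm (f m i))\<^sup>2) = (\<Sum>m\<in>A. \<Sum>i<n. (norm (f m i))\<^sup>2)"
    using S A f by (intro sum.mono_neutral_right) auto
  also have "(1 / real (card S)) * (\<Sum>m\<in>A. \<Sum>i<n. (norm (f m i))\<^sup>2) \<le> (1 / real (card S)) * (real (card A) * B)"
    using f(1) sum_bounded_above[of A "\<lambda>m. \<Sum>i<n. (norm (f m i))\<^sup>2" B] by (intro mult_left_mono) auto
  also have "\<dots> \<le> (1 / real (card S)) * ((\<theta> * real (card S)) * B)"
    using A B by (intro mult_left_mono mult_right_mono) auto
  also have "\<dots> = \<theta> * B" using c by simp
  finally show ?thesis .
qed

lemma card_msgs_at_top:
  assumes "0 < R" shows "filterlim (\<lambda>n. real (card (msgs n R))) at_top sequentially"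
proof (rule filterlim_at_top_mono)
  have "filterlim (\<lambda>n. exp (real n * (R * ln 2))) at_top sequentially"
    using assms by (intro filterlim_compose[OF exp_at_top] filterlim_at_top_mult_tendsto_pos[OF tendsto_const _ filterlim_real_sequentially]) auto
  then show "filterlim (\<lambda>n. 2 powr (real n * R)) at_top sequentially"
    by (simp add: powr_def mult_ac)
  show "\<forall>\<^sub>F n in sequentially. 2 powr (real n * R) \<le> real (card (msgs n R))"
    by (intro always_eventually) (simp add: card_msgs real_nat_ceiling_ge)
qed

lemma keep_fraction:
  assumes \<theta>: "0 < \<theta>" "\<theta> < 1" and M: "1 / (1 - \<theta>) \<le> real M"
  obtains A where "A \<subseteq> {1..M}" "real (card A) \<le> \<theta> * real M" "(1 - 2 * (1 - \<theta>)) * real M \<le> real (card A)"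
proof
  \<comment> \<open>Rounding down loses at most one message, which by the hypothesis is at most the
    fraction \<open>1 - \<theta>\<close> of all; this doubles the total loss to
    \<open>2 * (1 - \<theta>)\<close>.\<close>
  let ?k = "nat \<lfloor>\<theta> * real M\<rfloor>"
  have k: "real ?k \<le> \<theta> * real M" "\<theta> * real M - 1 \<le> real ?k" using \<theta> by (auto simp: of_nat_nat)
  have "\<theta> * real M \<le> 1 * real M" using \<theta> by (intro mult_right_mono) auto
  then have "real ?k \<le> real M" using k by linarith
  then have "?k \<le> M" by simp
  then show "{1..?k} \<subseteq> {1..M}" by auto
  show "real (card {1..?k}) \<le> \<theta> * real M" using k by simp
  have "1 \<le> (1 - \<theta>) * real M" using M \<theta> by (simp add: field_simps)
  then show "(1 - 2 * (1 - \<theta>)) * real M \<le> real (card {1..?k})" using k by (simp add: algebra_simps)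
qed

text \<open>
  The fraction of messages that are not silenced. A sole message cannot be silenced, but then the covariance vanishes.
\<close>

definition kept_messages :: "real \<Rightarrow> nat \<Rightarrow> real \<Rightarrow> real \<Rightarrow> bool" where
  "kept_messages \<theta> n Rp Rc \<longleftrightarrow> (\<exists>A B. A \<subseteq> msgs n Rp \<and> B \<subseteq> msgs n Rc \<and>
    (1 - 2 * (1 - \<theta>)) * real (card (msgs n Rp) * card (msgs n Rc)) \<le> real (card A * card B) \<and>
    (real (card A) \<le> \<theta> * real (card (msgs n Rp)) \<or> card (msgs n Rp) = 1) \<and>
    (real (card A * card B) \<le> \<theta> * real (card (msgs n Rp) * card (msgs n Rc)) \<or> card (msgs n Rp) * card (msgs n Rc) = 1))"

text \<open>If \<open>Rp > 0\<close>, thinning the primary messages thins the pairs by the same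
  factor. If \<open>Rp = 0\<close>, the sole primary message stays and the cognitive messages are
  thinned. A positive rate makes the message set grow, so \<open>keep_fraction\<close> applies for
  large \<open>n\<close>.\<close>

lemma keep_messages:
  assumes \<theta>: "0 < \<theta>" "\<theta> < 1" and R: "0 \<le> Rp" "0 \<le> Rc"
  shows "\<exists>N. \<forall>n\<ge>N. kept_messages \<theta> n Rp Rc"
proof -
  have ev: "\<exists>N. \<forall>n\<ge>N. 1 / (1 - \<theta>) \<le> real (card (msgs n R))" if "0 < R" for R
    using card_msgs_at_top[OF that] by (auto simp: filterlim_at_top eventually_sequentially)
  have M: "msgs n R = {1..card (msgs n R)}" for n R by (simp add: card_msgs) (simp add: msgs_def)
  have frac: "(1 - 2 * (1 - \<theta>)) * x \<le> x" if "0 \<le> x" for x :: real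
    using mult_right_mono[of "1 - 2 * (1 - \<theta>)" 1 x] \<theta> that by simp
  consider "0 < Rp" | "Rp = 0" "0 < Rc" | "Rp = 0" "Rc = 0" using R by linarith
  then show ?thesis
  proof cases
    case 1
    obtain N where N: "\<And>n. n \<ge> N \<Longrightarrow> 1 / (1 - \<theta>) \<le> real (card (msgs n Rp))" using ev[OF 1] by blast
    show ?thesis
    proof (intro exI[of _ N] allI impI)
      fix n assume n: "N \<le> n"
      obtain A where A: "A \<subseteq> {1..card (msgs n Rp)}" "real (card A) \<le> \<theta> * real (card (msgs n Rp))" "(1 - 2 * (1 - \<theta>)) * real (card (msgs n Rp)) \<le> real (card A)"
        by (rule keep_fraction[OF \<theta> N[OF n]])
      then show "kept_messages \<theta> n Rp Rc"
        using M[of n Rp] mult_right_mono[OF A(2), of "real (card (msgs n Rc))"] mult_right_mono[OF A(3), of "real (card (msgs n Rc))"]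
        unfolding kept_messages_def by (intro exI[of _ A] exI[of _ "msgs n Rc"]) (auto simp: mult.assoc)
    qed
  next
    case 2
    obtain N where N: "\<And>n. n \<ge> N \<Longrightarrow> 1 / (1 - \<theta>) \<le> real (card (msgs n Rc))" using ev[OF 2(2)] by blast
    show ?thesis
    proof (intro exI[of _ N] allI impI)
      fix n assume n: "N \<le> n"
      obtain B where B: "B \<subseteq> {1..card (msgs n Rc)}" "real (card B) \<le> \<theta> * real (card (msgs n Rc))" "(1 - 2 * (1 - \<theta>)) * real (card (msgs n Rc)) \<le> real (card B)"
        by (rule keep_fraction[OF \<theta> N[OF n]])
      then show "kept_messages \<theta> n Rp Rc"
        using M[of n Rc] 2(1) unfolding kept_messages_def by (intro exI[of _ "{1}"] exI[of _ B]) (auto simp: msgs_zero_rate)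
    qed
  next
    case 3
    then show ?thesis using frac[of 1] unfolding kept_messages_def by (intro exI[of _ 0] allI impI exI[of _ "{1}"]) (auto simp: msgs_zero_rate)
  qed
qed

context mcc_family
begin

text \<open>For nonzero powers the code is built with budgets larger by the factor
  \<open>1 / \<theta>\<close>, where \<open>\<theta> = 1 - eps / 4\<close>. They strictly exceed the
  signal powers because \<open>\<kappa> * \<theta> < 1\<close>, and silencing brings them back to
  \<open>Pp\<close> and \<open>Pc\<close>. The error is shared equally:
  \<open>2 * (1 - \<theta>) = eps / 2\<close> for silenced pairs and \<open>eps / 2\<close> for the
  code.\<close>

theorem family_MCC_code:
  fixes l :: "'j \<Rightarrow> real" and Pp Pc Rp Rc eps \<kappa> :: real
  assumes I: "finite I" and l: "(\<Sum>j\<in>I. l j) = 1" "\<And>j. j \<in> I \<Longrightarrow> 0 \<le> l j" and eps: "0 < eps" "eps \<le> 1"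
    and R: "0 \<le> Rp" "0 \<le> Rc"
    and Rp: "Rp = 0 \<or> Rp * ln 2 < (\<Sum>j\<in>I. l j * (ln (gdet2 (H3 j) (A3 j)) - ln (gdet (H3 j))))"
    and Rc: "Rc = 0 \<or> Rc * ln 2 < (\<Sum>j\<in>I. l j * ln (gdet (H2 j)))"
    and P0: "0 \<le> Pp" "0 \<le> Pc" and \<kappa>: "0 \<le> \<kappa>" "\<kappa> * (1 - eps / 4) < 1"
    and Pp: "\<And>j. j \<in> I \<Longrightarrow> (norm (top_rows (K j)))\<^sup>2 \<le> \<kappa> * Pp"
    and Pc: "\<And>j. j \<in> I \<Longrightarrow> (norm (bot_rows (K j)))\<^sup>2 + (norm (T j))\<^sup>2 \<le> \<kappa> * Pc"
  shows "\<exists>N. \<forall>n\<ge>N. \<exists>Ep Ec Dp Dc. MCC_code Hpp Hcp Hpc Hcc Pp Pc n Rp Rc eps Ep Ec Dp Dc"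
proof -
  define \<theta> where "\<theta> = 1 - eps / 4"
  have \<theta>: "0 < \<theta>" "\<theta> < 1" "1 - \<theta> = eps / 4" "\<kappa> * \<theta> < 1" using eps \<kappa> by (auto simp: \<theta>_def)
  \<comment> \<open>If \<open>Pp = 0\<close> then the signal itself vanishes, and any positive budget will do.\<close>
  define Qp where "Qp = (if Pp = 0 then 1 else Pp / \<theta>)"
  define Qc where "Qc = (if Pc = 0 then 1 else Pc / \<theta>)"
  have Q: "0 < Qp" "0 < Qc" "Pp \<noteq> 0 \<Longrightarrow> \<theta> * Qp = Pp" "Pc \<noteq> 0 \<Longrightarrow> \<theta> * Qc = Pc"
    using P0 \<theta> by (auto simp: Qp_def Qc_def)
  have lt: "\<kappa> * P < (if P = 0 then 1 else P / \<theta>)" if "0 \<le> P" for P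
    using that \<theta> mult_strict_right_mono[of "\<kappa> * \<theta>" 1 P] by (auto simp: field_simps)
  have lsum: "(\<Sum>j\<in>I. l j * x j) \<le> y" if "\<And>j. j \<in> I \<Longrightarrow> x j \<le> y" for x y
  proof -
    have "(\<Sum>j\<in>I. l j * x j) \<le> (\<Sum>j\<in>I. l j * y)" using that l by (intro sum_mono mult_left_mono) auto
    then show ?thesis using l by (simp flip: sum_distrib_right)
  qed
  have "(\<Sum>j\<in>I. l j * (norm (top_rows (K j)))\<^sup>2) < Qp"
    using lsum[of "\<lambda>j. (norm (top_rows (K j)))\<^sup>2", OF Pp] lt[OF P0(1)] by (simp add: Qp_def)
  moreover have "(\<Sum>j\<in>I. l j * ((norm (bot_rows (K j)))\<^sup>2 + (norm (T j))\<^sup>2)) < Qc"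
    using lsum[of "\<lambda>j. (norm (bot_rows (K j)))\<^sup>2 + (norm (T j))\<^sup>2", OF Pc] lt[OF P0(2)] by (simp add: Qc_def)
  moreover have "0 < eps / 2" using eps by simp
  ultimately obtain N1 where N1: "\<And>n. n \<ge> N1 \<Longrightarrow> good_code I n Qp Qc Rp Rc (eps / 2)"
    using family_code[OF I l _ Rp Rc] by meson
  obtain N2 where N2: "\<And>n. n \<ge> N2 \<Longrightarrow> kept_messages \<theta> n Rp Rc"
    using keep_messages[OF \<theta>(1,2) R] by meson
  show ?thesis
  proof (intro exI[of _ "max N1 N2"] allI impI)
    fix n assume "max N1 N2 \<le> n"
    then have n: "N1 \<le> n" "N2 \<le> n" by auto
    define Mp where "Mp = msgs n Rp"
    define Mc where "Mc = msgs n Rc"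
    have M: "finite Mp" "finite Mc" "Mp \<noteq> {}" "Mc \<noteq> {}" "0 < card Mp" "0 < card Mc"
      using card_msgs_pos[of n Rp] card_msgs_pos[of n Rc] by (auto simp: Mp_def Mc_def finite_msgs card_gt_0_iff)
    obtain \<tau> S V Dp Dc where \<tau>: "\<tau> \<in> PiE {..<n} (\<lambda>_. I)"
      and Dp: "Dp \<in> measurable (PiM {..<n} (\<lambda>_. borel)) (count_space UNIV)"
      and Dc: "Dc \<in> measurable (PiM {..<n} (\<lambda>_. borel)) (count_space UNIV)"
      and bound: "(\<Sum>mp\<in>Mp. \<Sum>mc\<in>Mc. pair_cost n \<tau> Qp Qc S V Dp Dc mp mc)
       \<le> of_nat (card Mp * card Mc) * ennreal (eps / 2)"
      using N1[OF n(1), unfolded good_code_def, folded Mp_def Mc_def] by (elim exE conjE) (rule that)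
    obtain A B where AB: "A \<subseteq> Mp" "B \<subseteq> Mc" and keep: "(1 - 2 * (1 - \<theta>)) * real (card Mp * card Mc) \<le> real (card A * card B)"
      and Ap: "real (card A) \<le> \<theta> * real (card Mp) \<or> card Mp = 1"
      and ABp: "real (card A * card B) \<le> \<theta> * real (card Mp * card Mc) \<or> card Mp * card Mc = 1"
      using N2[OF n(2), unfolded kept_messages_def, folded Mp_def Mc_def] by (elim exE conjE) (rule that)
    \<comment> \<open>The primary transmitter must not use \<open>mc\<close>, so \<open>mp\<close>
      alone decides whether it is silenced. The cognitive transmitter is silenced by its own
      criterion, and pairs for which either is silent fall under \<open>bad\<close>.\<close>
    define gp where "gp mp \<longleftrightarrow> mp \<in> A \<and> (\<Sum>i<n. ep (\<tau> i) (S mp i)) \<le> n * Qp" for mp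
    define gc where "gc mp mc \<longleftrightarrow> mp \<in> A \<and> mc \<in> B \<and> (\<Sum>i<n. ec (\<tau> i) (V mp mc i) (S mp i)) \<le> n * Qc" for mp mc
    define Ep where "Ep mp i = (if gp mp \<and> i < n then xp (\<tau> i) (S mp i) else 0)" for mp i
    define Ec where "Ec mp mc i = (if gc mp mc \<and> i < n then xc (\<tau> i) (V mp mc i) (S mp i) else 0)" for mp mc i
    have \<tau>I: "i < n \<Longrightarrow> \<tau> i \<in> I" for i using \<tau> by auto
    have powp: "(\<Sum>i<n. Re (ctrace (cov_unif Mp (\<lambda>mp. Ep mp i)))) \<le> real n * Pp"
    proof (cases "card Mp = 1")
      case True
      have "Re (ctrace (cov_unif Mp (\<lambda>mp. Ep mp i))) = 0" for i
        by (rule cov_unif_trace_le(2)[OF M(1,3) True])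
      then show ?thesis using P0 by simp
    next
      case False
      then have A: "real (card A) \<le> \<theta> * real (card Mp)" using Ap by blast
      have nz: "Ep mp i = 0" if "Pp = 0" for mp i
      proof (cases "gp mp \<and> i < n")
        case True
        then have "(norm (top_rows (K (\<tau> i))))\<^sup>2 \<le> 0" using Pp[OF \<tau>I[of i]] that by simp
        then show ?thesis by (simp add: Ep_def xp_def)
      qed (auto simp: Ep_def)
      show ?thesis
      proof (cases "Pp = 0")
        case True
        have "(\<Sum>i<n. Re (ctrace (cov_unif Mp (\<lambda>mp. Ep mp i)))) \<le> \<theta> * 0"
          by (rule cov_unif_power_le[OF M(1,3) AB(1) A]) (auto simp: nz[OF True])
        then show ?thesis using True by simp
      next
        case False
        have "(\<Sum>i<n. Re (ctrace (cov_unif Mp (\<lambda>mp. Ep mp i)))) \<le> \<theta> * (n * Qp)"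
        proof (rule cov_unif_power_le[OF M(1,3) AB(1) A])
          show "(\<Sum>i<n. (norm (Ep m i))\<^sup>2) \<le> n * Qp" for m
            using Q by (cases "gp m") (auto simp: Ep_def gp_def ep_def)
        qed (use Q in \<open>auto simp: Ep_def gp_def\<close>)
        also have "\<theta> * (n * Qp) = n * Pp" using Q(3)[OF False] by (simp add: mult.left_commute)
        finally show ?thesis .
      qed
    qed
    have powc: "(\<Sum>i<n. Re (ctrace (cov_unif (Mp \<times> Mc) (\<lambda>(mp, mc). Ec mp mc i)))) \<le> real n * Pc"
    proof (cases "card Mp * card Mc = 1")
      case True
      have "Re (ctrace (cov_unif (Mp \<times> Mc) (\<lambda>(mp, mc). Ec mp mc i))) = 0" for i
        using M True by (intro cov_unif_trace_le(2)) (auto simp: card_cartesian_product)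
      then show ?thesis using P0 by simp
    next
      case False
      then have A: "real (card (A \<times> B)) \<le> \<theta> * real (card (Mp \<times> Mc))" using ABp unfolding card_cartesian_product by blast
      have nz: "Ec mp mc i = 0" if "Pc = 0" for mp mc i
      proof (cases "gc mp mc \<and> i < n")
        case True
        then have "(norm (bot_rows (K (\<tau> i))))\<^sup>2 + (norm (T (\<tau> i)))\<^sup>2 \<le> 0" using Pc[OF \<tau>I[of i]] that by simp
        then have "bot_rows (K (\<tau> i)) = 0" "T (\<tau> i) = 0"
          by (simp_all add: sum_power2_le_zero_iff)
        then show ?thesis by (simp add: Ec_def xc_def)
      qed (auto simp: Ec_def)
      have M2: "finite (Mp \<times> Mc)" "Mp \<times> Mc \<noteq> {}" "A \<times> B \<subseteq> Mp \<times> Mc" using M AB by auto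
      show ?thesis
      proof (cases "Pc = 0")
        case True
        have "(\<Sum>i<n. Re (ctrace (cov_unif (Mp \<times> Mc) (\<lambda>m. (case m of (mp, mc) \<Rightarrow> Ec mp mc) i)))) \<le> \<theta> * 0"
          by (rule cov_unif_power_le[OF M2 A]) (auto simp: nz[OF True])
        then show ?thesis using True by (simp add: split_def)
      next
        case False
        have "(\<Sum>i<n. Re (ctrace (cov_unif (Mp \<times> Mc) (\<lambda>m. (case m of (mp, mc) \<Rightarrow> Ec mp mc) i)))) \<le> \<theta> * (n * Qc)"
        proof (rule cov_unif_power_le[OF M2 A])
          have "(\<Sum>i<n. (norm (Ec mp mc i))\<^sup>2) \<le> n * Qc" for mp mc
            using Q by (cases "gc mp mc") (auto simp: Ec_def gc_def ec_def)
          then show "(\<Sum>i<n. (norm ((case m of (mp, mc) \<Rightarrow> Ec mp mc) i))\<^sup>2) \<le> n * Qc" for m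
            by (cases m) auto
        qed (use Q in \<open>auto simp: Ec_def gc_def split: if_splits\<close>)
        also have "\<theta> * (n * Qc) = n * Pc" using Q(4)[OF False] by (simp add: mult.left_commute)
        finally show ?thesis by (simp add: split_def)
      qed
    qed
    define cost where "cost = pair_cost n \<tau> Qp Qc S V Dp Dc"
    define bad where "bad mp mc \<longleftrightarrow> (mp, mc) \<notin> A \<times> B \<or> n * Qp < (\<Sum>i<n. ep (\<tau> i) (S mp i)) \<or> n * Qc < (\<Sum>i<n. ec (\<tau> i) (V mp mc i) (S mp i))" for mp mc
    \<comment> \<open>Pairs over budget are already charged 1 in \<open>pair_cost\<close>; the
      indicator charges the pairs outside \<open>A \<times> B\<close>.\<close>
    let ?D = "\<lambda>mp mc. indicator (Mp \<times> Mc - A \<times> B) (mp, mc) + cost mp mc :: ennreal"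
    interpret NP: prob_space "noise n :: (nat \<Rightarrow> complex^'pr) measure" by (rule prob_space_noise)
    interpret NR: prob_space "noise n :: (nat \<Rightarrow> complex^'cr) measure" by (rule prob_space_noise)
    have good: "Ep mp i = xp (\<tau> i) (S mp i)" "Ec mp mc i = xc (\<tau> i) (V mp mc i) (S mp i)"
      if "\<not> bad mp mc" "i < n" for mp mc i
      using that by (auto simp: Ep_def Ec_def gp_def gc_def bad_def not_less)
    have badD: "ennreal x \<le> ?D mp mc" if "bad mp mc" "mp \<in> Mp" "mc \<in> Mc" "x \<le> 1" for x mp mc
    proof -
      have "ennreal x \<le> 1" using that(4) by (simp add: ennreal_le_1)
      also have "1 \<le> ?D mp mc"
        using that(1-3) by (cases "(mp, mc) \<in> A \<times> B") (auto simp: bad_def cost_def pair_cost_def add_increasing add_increasing2)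
      finally show ?thesis .
    qed
    have errp: "ennreal (err_prob n Hpp Hcp (Ep mp) (Ec mp mc) Dp mp) \<le> ?D mp mc"
      if m: "mp \<in> Mp" "mc \<in> Mc" for mp mc
    proof (cases "bad mp mc")
      case False
      then have "restrict (\<lambda>i. Hpp *v Ep mp i + Hcp *v Ec mp mc i + z i) {..<n} = restrict (\<lambda>i. fp (\<tau> i) (V mp mc i) (S mp i) + z i) {..<n}" for z
        using good by (intro restrict_ext) (auto simp: fp_eq)
      then show ?thesis
        unfolding err_prob_def cost_def pair_cost_def by (simp add: NP.emeasure_eq_measure[symmetric] add_increasing add_increasing2)
    qed (use m in \<open>auto intro!: badD simp: err_prob_def\<close>)
    have errc: "ennreal (err_prob n Hpc Hcc (Ep mp) (Ec mp mc) Dc mc) \<le> ?D mp mc"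
      if m: "mp \<in> Mp" "mc \<in> Mc" for mp mc
    proof (cases "bad mp mc")
      case False
      then have "restrict (\<lambda>i. Hpc *v Ep mp i + Hcc *v Ec mp mc i + z i) {..<n} = restrict (\<lambda>i. fc (\<tau> i) (V mp mc i) (S mp i) + z i) {..<n}" for z
        using good by (intro restrict_ext) (auto simp: fc_eq)
      then show ?thesis
        unfolding err_prob_def cost_def pair_cost_def by (simp add: NR.emeasure_eq_measure[symmetric] add_increasing add_increasing2)
    qed (use m in \<open>auto intro!: badD simp: err_prob_def\<close>)
    \<comment> \<open>Formulated for any error function below \<open>?D\<close>, so that it serves
      both receivers.\<close>
    have avg: "(1 / real (card Mp * card Mc)) * (\<Sum>mp\<in>Mp. \<Sum>mc\<in>Mc. e mp mc) \<le> eps"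
      if e: "\<And>mp mc. mp \<in> Mp \<Longrightarrow> mc \<in> Mc \<Longrightarrow> ennreal (e mp mc) \<le> ?D mp mc"
        and e0: "\<And>mp mc. 0 \<le> e mp mc" for e :: "nat \<Rightarrow> nat \<Rightarrow> real"
    proof -
      let ?M = "real (card Mp * card Mc)"
      have Mpos: "0 < ?M" using M by simp
      have "ennreal (\<Sum>mp\<in>Mp. \<Sum>mc\<in>Mc. e mp mc) = (\<Sum>mp\<in>Mp. \<Sum>mc\<in>Mc. ennreal (e mp mc))"
        using e0 by (simp add: sum_ennreal sum_nonneg)
      also have "\<dots> \<le> (\<Sum>mp\<in>Mp. \<Sum>mc\<in>Mc. ?D mp mc)"
        by (intro sum_mono e)
      also have "\<dots> = (\<Sum>mp\<in>Mp. \<Sum>mc\<in>Mc. indicator (Mp \<times> Mc - A \<times> B) (mp, mc)) + (\<Sum>mp\<in>Mp. \<Sum>mc\<in>Mc. cost mp mc)"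
        by (simp only: sum.distrib)
      also have "\<dots> \<le> ennreal (eps / 2 * ?M) + of_nat (card Mp * card Mc) * ennreal (eps / 2)"
      proof (rule add_mono[OF _ bound[folded cost_def]])
        have "(\<Sum>mp\<in>Mp. \<Sum>mc\<in>Mc. indicator (Mp \<times> Mc - A \<times> B) (mp, mc) :: ennreal) = (\<Sum>p\<in>Mp \<times> Mc. indicator (Mp \<times> Mc - A \<times> B) p)"
          by (simp add: sum.cartesian_product split_def)
        also have "\<dots> = (\<Sum>p\<in>Mp \<times> Mc - A \<times> B. 1)"
          using M by (intro sum.mono_neutral_cong_right) auto
        also have "\<dots> = of_nat (card (Mp \<times> Mc - A \<times> B))" by simp
        also have "card (Mp \<times> Mc - A \<times> B) = card Mp * card Mc - card A * card B"
          using M AB by (subst card_Diff_subset) (auto simp: card_cartesian_product intro: finite_subset)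
        also have "of_nat (card Mp * card Mc - card A * card B) \<le> ennreal (eps / 2 * ?M)"
        proof -
          have "card A * card B \<le> card Mp * card Mc" using M AB by (intro mult_le_mono card_mono) auto
          then have "real (card Mp * card Mc - card A * card B) = ?M - real (card A * card B)" by (simp add: of_nat_diff)
          also have "\<dots> \<le> eps / 2 * ?M" using keep \<theta>(3) by (simp add: algebra_simps)
          finally show ?thesis unfolding ennreal_of_nat_eq_real_of_nat by (rule ennreal_leI)
        qed
        finally show "(\<Sum>mp\<in>Mp. \<Sum>mc\<in>Mc. indicator (Mp \<times> Mc - A \<times> B) (mp, mc)) \<le> ennreal (eps / 2 * ?M)" .
      qed
      also have "\<dots> = ennreal (eps * ?M)"
        unfolding ennreal_of_nat_eq_real_of_nat using eps by (simp flip: ennreal_mult ennreal_plus)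
      finally have "(\<Sum>mp\<in>Mp. \<Sum>mc\<in>Mc. e mp mc) \<le> eps * ?M" using eps by (simp add: ennreal_le_iff)
      then show ?thesis using Mpos by (simp add: field_simps)
    qed
    have e0: "0 \<le> err_prob n G G' x x' D m" for G :: "complex^'a^'r" and G' :: "complex^'b^'r" and x x' D m
      by (simp add: err_prob_def)
    have "MCC_code Hpp Hcp Hpc Hcc Pp Pc n Rp Rc eps Ep Ec Dp Dc"
      unfolding MCC_code_def Let_def Mp_def[symmetric] Mc_def[symmetric]
      by (intro conjI Dp Dc powp powc avg errp errc e0)
    then show "\<exists>Ep Ec Dp Dc. MCC_code Hpp Hcp Hpc Hcc Pp Pc n Rp Rc eps Ep Ec Dp Dc" by blast
  qed
qed

end

section \<open>The rate region\<close>

lemma continuous_on_matrix_mult: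
  fixes A :: "'a::topological_space \<Rightarrow> complex^'n^'m" and B :: "'a \<Rightarrow> complex^'k^'n"
  assumes "continuous_on S A" "continuous_on S B" shows "continuous_on S (\<lambda>x. A x ** B x)"
  unfolding matrix_matrix_mult_def
  by (intro continuous_on_vec_lambda continuous_on_sum continuous_on_mult continuous_on_component assms)

lemma continuous_on_cadj:
  fixes A :: "'a::topological_space \<Rightarrow> complex^'n^'m"
  assumes "continuous_on S A" shows "continuous_on S (\<lambda>x. cadj (A x))"
  unfolding cadj_def by (intro continuous_on_vec_lambda continuous_on_cnj continuous_on_component assms)

lemma continuous_on_cdet:
  fixes A :: "'a::topological_space \<Rightarrow> complex^'n^'n"
  assumes "continuous_on S A" shows "continuous_on S (\<lambda>x. det (A x))"
  unfolding det_def
  by (intro continuous_on_sum continuous_on_mult continuous_on_prod continuous_on_component assms continuous_on_const)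

lemma continuous_on_gdet:
  fixes A :: "'a::topological_space \<Rightarrow> complex^'n^'m"
  assumes "continuous_on S A" shows "continuous_on S (\<lambda>x. gdet (A x))"
  unfolding gdet_def
  by (intro continuous_on_Re continuous_on_cdet continuous_on_add continuous_on_const continuous_on_matrix_mult continuous_on_cadj assms)

lemma continuous_on_gdet2:
  fixes A :: "'a::topological_space \<Rightarrow> complex^'n^'m" and H :: "'a \<Rightarrow> complex^'k^'m"
  assumes "continuous_on S A" "continuous_on S H" shows "continuous_on S (\<lambda>x. gdet2 (H x) (A x))"
  unfolding gdet2_def
  by (intro continuous_on_Re continuous_on_cdet continuous_on_add continuous_on_const continuous_on_matrix_mult continuous_on_cadj assms)

lemma gdet_pos: "0 < gdet A" using gdet_ge_1[of A] by simp

lemma gdet2_pos: "0 < gdet2 H A" using gdet2_ge[of H A] gdet_pos[of H] by linarith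

text \<open>The ratio \<open>gdet H / gdet2 H A\<close> is the Gaussian mean of \<open>exp\<close>
  of a negated nonnegative form in \<open>A *v x\<close>. Scaling \<open>A\<close> by
  \<open>c\<close> multiplies the form by the square of \<open>c\<close> and so lowers the mean,
  strictly unless the form vanishes almost everywhere; but then the ratio would be 1.\<close>

lemma gdet2_strict_mono:
  fixes H :: "complex^'a^'c" and A :: "complex^'b^'c"
  assumes c: "1 < c" and less: "gdet H < gdet2 H A"
  shows "gdet2 H A < gdet2 H (c *\<^sub>R A)"
proof -
  let ?L = "pinv (mat 1 + H ** cadj H)"
  let ?X = "\<lambda>x. (A *v x) \<bullet> (?L *v (A *v x))"
  interpret prob_space "cgauss :: (complex^'b) measure" by (rule prob_space_cgauss)
  have int: "(\<integral>\<^sup>+x. ennreal (exp (- ((G *v x) \<bullet> (?L *v (G *v x))))) \<partial>cgauss) = ennreal (gdet H / gdet2 H G)" for G :: "complex^'b^'c"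
  proof -
    have "M *v (- y) = - (M *v y)" for M :: "complex^'c^'c" and y
      using matrix_vector_mult_diff_distrib[of M 0 y] by simp
    then show ?thesis using posinv_plus(3)[OF posinv_mat_1_plus[of H], of 0 G] by (simp add: gdet2_def)
  qed
  have X0: "0 \<le> ?X x" for x using posinv_mat_1_plus[of H] by (simp add: posinv_def)
  have Xc: "((c *\<^sub>R A) *v x) \<bullet> (?L *v ((c *\<^sub>R A) *v x)) = c\<^sup>2 * ?X x" for x
  proof -
    have "M *v (c *\<^sub>R y) = c *\<^sub>R (M *v y)" for M :: "complex^'c^'c" and y
      by (rule linear_cmul) simp
    then show ?thesis by (simp add: scaleR_mult_vec power2_eq_square)
  qed
  have c2: "1 < c\<^sup>2" using c by (simp add: one_less_power)
  have "(\<integral>\<^sup>+x. ennreal (exp (- (c\<^sup>2 * ?X x))) \<partial>cgauss) < (\<integral>\<^sup>+x. ennreal (exp (- ?X x)) \<partial>cgauss)"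
  proof (rule nn_integral_less)
    show "(\<integral>\<^sup>+x. ennreal (exp (- (c\<^sup>2 * ?X x))) \<partial>cgauss) \<noteq> \<infinity>"
      using int[of "c *\<^sub>R A"] unfolding Xc by simp
    show "AE x in cgauss. ennreal (exp (- (c\<^sup>2 * ?X x))) \<le> ennreal (exp (- ?X x))"
      using X0 c2 by (intro AE_I2 ennreal_leI) (simp add: mult_le_cancel_right1 not_less)
    show "\<not> (AE x in cgauss. ennreal (exp (- ?X x)) \<le> ennreal (exp (- (c\<^sup>2 * ?X x))))"
    proof
      assume "AE x in cgauss. ennreal (exp (- ?X x)) \<le> ennreal (exp (- (c\<^sup>2 * ?X x)))"
      then have "AE x in cgauss. ennreal (exp (- ?X x)) = 1"
      proof eventually_elim
        fix x assume "ennreal (exp (- ?X x)) \<le> ennreal (exp (- (c\<^sup>2 * ?X x)))"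
        then have "(c\<^sup>2 - 1) * ?X x \<le> 0" by (simp add: algebra_simps)
        then have "?X x = 0" using X0[of x] c2 by (simp add: mult_le_0_iff)
        then show "ennreal (exp (- ?X x)) = 1" by simp
      qed
      then have "(\<integral>\<^sup>+x. ennreal (exp (- ?X x)) \<partial>cgauss) = (\<integral>\<^sup>+x. 1 \<partial>(cgauss :: (complex^'b) measure))"
        by (rule nn_integral_cong_AE)
      then have "ennreal (gdet H / gdet2 H A) = 1" unfolding int by simp
      then have "gdet H = gdet2 H A" using gdet2_pos[of H A] by simp
      then show False using less by simp
    qed
  qed measurable
  then have "ennreal (gdet H / gdet2 H (c *\<^sub>R A)) < ennreal (gdet H / gdet2 H A)"
    using int[of "c *\<^sub>R A"] int[of A] unfolding Xc by simp
  then have "gdet H / gdet2 H (c *\<^sub>R A) < gdet H / gdet2 H A"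
    using gdet_pos[of H] gdet2_pos[of H A] by (simp add: ennreal_less_iff gdet2_pos less_imp_le)
  then show ?thesis using gdet_pos[of H] gdet2_pos[of H A] gdet2_pos[of H "c *\<^sub>R A"]
    by (simp add: divide_less_cancel frac_less_eq zero_less_mult_iff divide_simps)
qed

text \<open>The special case of a zero interference matrix.\<close>

lemma gdet_strict_mono:
  fixes A :: "complex^'a^'b"
  assumes c: "1 < c" and less: "1 < gdet A"
  shows "gdet A < gdet (c *\<^sub>R A)"
proof -
  have *: "gdet2 (0 :: complex^'b^'b) G = gdet G" for G :: "complex^'a^'b"
    by (simp add: gdet2_def gdet_def)
  have "gdet (0 :: complex^'b^'b) = 1" by (simp add: gdet_def)
  then show ?thesis using gdet2_strict_mono[OF c, of "0 :: complex^'b^'b" A] less by (simp add: *)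
qed

lemma scaleR_matrix_mult: "G ** (c *\<^sub>R A) = c *\<^sub>R (G ** A)" for A :: "complex^'n^'m"
  by (simp add: vec_eq_iff matrix_matrix_mult_def scaleR_sum_right)

lemma norm_top_rows: "(norm (top_rows K))\<^sup>2 = Re (\<Sum>a\<in>UNIV. (K ** cadj K) $ Inl a $ Inl a)"
  for K :: "complex^'k^('a::finite + 'b::finite)"
proof -
  have "(norm (top_rows K))\<^sup>2 = Re (ctrace (top_rows K ** cadj (top_rows K)))" by (rule norm_matrix_ctrace)
  also have "\<dots> = Re (\<Sum>a\<in>UNIV. (K ** cadj K) $ Inl a $ Inl a)"
    by (simp add: ctrace_def matrix_matrix_mult_def cadj_def top_rows_def)
  finally show ?thesis .
qed

lemma norm_bot_rows: "(norm (bot_rows K))\<^sup>2 = Re (\<Sum>a\<in>UNIV. (K ** cadj K) $ Inr a $ Inr a)"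
  for K :: "complex^'k^('a::finite + 'b::finite)"
proof -
  have "(norm (bot_rows K))\<^sup>2 = Re (ctrace (bot_rows K ** cadj (bot_rows K)))" by (rule norm_matrix_ctrace)
  also have "\<dots> = Re (\<Sum>a\<in>UNIV. (K ** cadj K) $ Inr a $ Inr a)"
    by (simp add: ctrace_def matrix_matrix_mult_def cadj_def bot_rows_def)
  finally show ?thesis .
qed

lemma norm_rows: "(norm K)\<^sup>2 = (norm (top_rows K))\<^sup>2 + (norm (bot_rows K))\<^sup>2"
  for K :: "complex^'k^('a::finite + 'b::finite)"
  unfolding norm_top_rows norm_bot_rows norm_matrix_ctrace[of K] by (simp add: ctrace_def sum_UNIV_Plus)

lemma top_rows_scaleR: "top_rows (c *\<^sub>R K) = c *\<^sub>R top_rows K"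
  by (simp add: top_rows_def vec_eq_iff)

lemma bot_rows_scaleR: "bot_rows (c *\<^sub>R K) = c *\<^sub>R bot_rows K"
  by (simp add: bot_rows_def vec_eq_iff)

text \<open>In nats, whereas \<open>R_ach\<close> counts bits; hence the factors \<open>ln 2\<close>
  below.\<close>

definition rate_p :: "complex^'pt^'pr \<Rightarrow> complex^'ct^'pr \<Rightarrow> complex^('pt + 'ct)^('pt + 'ct) \<Rightarrow> complex^'ct^'ct \<Rightarrow> real" where
  "rate_p Hpp Hcp K T = ln (gdet2 (Hcp ** T) (hcat Hpp Hcp ** K)) - ln (gdet (Hcp ** T))"

definition rate_c :: "complex^'ct^'cr \<Rightarrow> complex^'ct^'ct \<Rightarrow> real" where
  "rate_c Hcc T = ln (gdet (Hcc ** T))"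

lemma rate_p_nonneg: "0 \<le> rate_p Hpp Hcp K T"
  unfolding rate_p_def by (simp add: gdet2_ge gdet_pos gdet2_pos)

lemma rate_c_nonneg: "0 \<le> rate_c Hcc T"
  unfolding rate_c_def by (simp add: gdet_ge_1)

lemma continuous_on_rate_p:
  assumes "continuous_on S K" "continuous_on S T"
  shows "continuous_on S (\<lambda>x. rate_p Hpp Hcp (K x) (T x))"
  unfolding rate_p_def
  by (intro continuous_on_diff continuous_on_ln continuous_on_gdet2 continuous_on_gdet continuous_on_matrix_mult continuous_on_const assms)
     (auto simp: gdet2_pos[THEN less_imp_neq, THEN not_sym] gdet_pos[THEN less_imp_neq, THEN not_sym])

lemma continuous_on_rate_c:
  assumes "continuous_on S T" shows "continuous_on S (\<lambda>x. rate_c Hcc (T x))"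
  unfolding rate_c_def
  by (intro continuous_on_ln continuous_on_gdet continuous_on_matrix_mult continuous_on_const assms)
     (auto simp: gdet_pos[THEN less_imp_neq, THEN not_sym])

definition power_ok :: "real \<Rightarrow> real \<Rightarrow> complex^('pt::finite + 'ct::finite)^('pt + 'ct) \<Rightarrow> complex^'ct^'ct \<Rightarrow> bool" where
  "power_ok Pp Pc K T \<longleftrightarrow> (norm (top_rows K))\<^sup>2 \<le> Pp \<and> (norm (bot_rows K))\<^sup>2 + (norm T)\<^sup>2 \<le> Pc"

definition rate_region :: "complex^'pt^'pr \<Rightarrow> complex^'ct^'pr \<Rightarrow> complex^'ct^'cr \<Rightarrow> real \<Rightarrow> real \<Rightarrow> (real \<times> real) set" where
  "rate_region Hpp Hcp Hcc Pp Pc = {(Rp, Rc). \<exists>K T. power_ok Pp Pc K T \<and>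
     0 \<le> Rp \<and> Rp * ln 2 \<le> rate_p Hpp Hcp K T \<and> 0 \<le> Rc \<and> Rc * ln 2 \<le> rate_c Hcc T}"

text \<open>Square roots \<open>K\<close> and \<open>T\<close> of the joint covariance and of
  \<open>Scc\<close> turn traces into squared norms and the determinants into \<open>gdet2\<close>
  and \<open>gdet\<close>.\<close>

lemma R_ach_subset_rate_region:
  fixes Hpp :: "complex^'a^'p" and Hcp :: "complex^'b^'p"
  assumes "(R, Sp, Scp, Scc, Q) \<in> R_ach Hpp Hcp Hpc Hcc Pp Pc"
  shows "R \<in> rate_region Hpp Hcp Hcc Pp Pc"
proof -
  obtain Rp Rc where R: "R = (Rp, Rc)" by (cases R)
  let ?B = "block2 Sp Q (cadj Q) Scp" and ?G = "hcat Hpp Hcp"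
  have a: "0 \<le> Rp" "0 \<le> Rc" "psd Scc" "psd ?B" "Re (ctrace Sp) \<le> Pp" "Re (ctrace (Scp + Scc)) \<le> Pc"
    and Rp: "Rp \<le> log 2 (Re (det (mat 1 + ?G ** ?B ** cadj ?G + Hcp ** Scc ** cadj Hcp))) - log 2 (Re (det (mat 1 + Hcp ** Scc ** cadj Hcp)))"
    and Rc: "Rc \<le> log 2 (Re (det (mat 1 + Hcc ** Scc ** cadj Hcc)))"
    using assms unfolding R by (simp_all add: R_ach_def)
  obtain K :: "complex^('a + 'b)^('a + 'b)" where K: "?B = K ** cadj K" using a(4) by (rule psd_factor)
  obtain T :: "complex^'b^'b" where T: "Scc = T ** cadj T" using a(3) by (rule psd_factor)
  have "(norm (top_rows K))\<^sup>2 = Re (ctrace Sp)"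
    unfolding norm_top_rows K[symmetric] by (simp add: ctrace_def block2_def)
  moreover have "(norm (bot_rows K))\<^sup>2 = Re (ctrace Scp)"
    unfolding norm_bot_rows K[symmetric] by (simp add: ctrace_def block2_def)
  moreover have "(norm T)\<^sup>2 = Re (ctrace Scc)" unfolding T by (rule norm_matrix_ctrace)
  ultimately have pow: "power_ok Pp Pc K T" using a(5,6) by (simp add: power_ok_def ctrace_add)
  have g1: "Re (det (mat 1 + H ** Scc ** cadj H)) = gdet (H ** T)" for H :: "complex^'b^'x"
    by (simp add: gdet_def T cadj_mult matrix_mul_assoc)
  have g2: "Re (det (mat 1 + ?G ** ?B ** cadj ?G + Hcp ** Scc ** cadj Hcp)) = gdet2 (Hcp ** T) (?G ** K)"
    unfolding gdet2_def K T cadj_mult by (simp add: matrix_mul_assoc add_ac)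
  have ln2: "log 2 x * ln 2 = ln x" for x :: real by (simp add: log_def)
  have "Rp * ln 2 \<le> (log 2 (gdet2 (Hcp ** T) (?G ** K)) - log 2 (gdet (Hcp ** T))) * ln 2"
    using Rp unfolding g1 g2 by (intro mult_right_mono) auto
  then have "Rp * ln 2 \<le> rate_p Hpp Hcp K T" by (simp add: rate_p_def left_diff_distrib ln2)
  moreover have "Rc * ln 2 \<le> log 2 (gdet (Hcc ** T)) * ln 2"
    using Rc unfolding g1 by (intro mult_right_mono) auto
  then have "Rc * ln 2 \<le> rate_c Hcc T" by (simp add: rate_c_def ln2)
  ultimately show ?thesis using a pow unfolding rate_region_def R by blast
qed

lemma continuous_on_rows:
  assumes "continuous_on S K"
  shows "continuous_on S (\<lambda>x. top_rows (K x))" "continuous_on S (\<lambda>x. bot_rows (K x))"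
  unfolding top_rows_def bot_rows_def by (intro continuous_on_vec_lambda continuous_on_component assms)+

lemma compact_rate_region: "compact (rate_region Hpp Hcp Hcc Pp Pc)"
  for Hpp :: "complex^'pt^'pr" and Hcp :: "complex^'ct^'pr" and Hcc :: "complex^'ct^'cr"
proof -
  let ?X = "{p :: (complex^('pt + 'ct)^('pt + 'ct)) \<times> (complex^'ct^'ct). power_ok Pp Pc (fst p) (snd p)}"
  have cf: "continuous_on S (\<lambda>p. fst p)" "continuous_on S (\<lambda>p. snd p)" for S :: "((complex^('pt + 'ct)^('pt + 'ct)) \<times> (complex^'ct^'ct)) set"
    by (auto intro!: continuous_intros)
  have "closed ?X"
    unfolding power_ok_def
    by (intro closed_Collect_conj closed_Collect_le continuous_on_add continuous_on_power continuous_on_norm continuous_on_rows cf continuous_on_const)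
  moreover have "bounded ?X"
    unfolding bounded_iff
  proof (intro exI[of _ "sqrt (Pp + Pc)"] ballI)
    fix p assume "p \<in> ?X"
    then have "(norm (fst p))\<^sup>2 + (norm (snd p))\<^sup>2 \<le> Pp + Pc"
      using norm_rows[of "fst p"] by (simp add: power_ok_def)
    then show "norm p \<le> sqrt (Pp + Pc)" by (simp add: norm_prod_def)
  qed
  ultimately have X: "compact ?X" by (simp add: compact_eq_bounded_closed)
  \<comment> \<open>The two parameters in \<open>{0..1}\<close> scale the maximal rates down, so
    that the region with all its smaller nonnegative rates becomes a continuous image of a compact
    set.\<close>
  let ?f = "\<lambda>q :: ((complex^('pt + 'ct)^('pt + 'ct)) \<times> (complex^'ct^'ct)) \<times> (real \<times> real).
     (fst (snd q) * (rate_p Hpp Hcp (fst (fst q)) (snd (fst q)) / ln 2), snd (snd q) * (rate_c Hcc (snd (fst q)) / ln 2))"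
  have "compact (?f ` (?X \<times> ({0..1} \<times> {0..1})))"
  proof (rule compact_continuous_image)
    show "compact (?X \<times> ({0..1::real} \<times> {0..1::real}))" by (intro compact_Times X compact_Icc)
    show "continuous_on (?X \<times> ({0..1} \<times> {0..1})) ?f"
      by (intro continuous_on_Pair continuous_on_mult continuous_on_divide continuous_on_rate_p continuous_on_rate_c continuous_on_fst continuous_on_snd continuous_on_id continuous_on_const) auto
  qed
  also have "?f ` (?X \<times> ({0..1} \<times> {0..1})) = rate_region Hpp Hcp Hcc Pp Pc"
  proof (intro equalityI subsetI)
    fix R assume "R \<in> ?f ` (?X \<times> ({0..1} \<times> {0..1}))"
    then obtain K T a b where *: "power_ok Pp Pc K T" "0 \<le> a" "a \<le> 1" "0 \<le> b" "b \<le> 1"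
      and R: "R = (a * (rate_p Hpp Hcp K T / ln 2), b * (rate_c Hcc T / ln 2))" by force
    have "a * rate_p Hpp Hcp K T \<le> rate_p Hpp Hcp K T" "b * rate_c Hcc T \<le> rate_c Hcc T"
      using * rate_p_nonneg[of Hpp Hcp K T] rate_c_nonneg[of Hcc T] by (auto intro: mult_left_le_one_le)
    then show "R \<in> rate_region Hpp Hcp Hcc Pp Pc"
      unfolding rate_region_def R using * rate_p_nonneg[of Hpp Hcp K T] rate_c_nonneg[of Hcc T] by auto
  next
    fix R assume "R \<in> rate_region Hpp Hcp Hcc Pp Pc"
    then obtain Rp Rc K T where R: "R = (Rp, Rc)" and *: "power_ok Pp Pc K T" "0 \<le> Rp" "Rp * ln 2 \<le> rate_p Hpp Hcp K T"
      "0 \<le> Rc" "Rc * ln 2 \<le> rate_c Hcc T" unfolding rate_region_def by auto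
    have ex: "\<exists>a. 0 \<le> a \<and> a \<le> 1 \<and> r = a * (x / ln 2)" if "0 \<le> r" "r * ln 2 \<le> x" for r x :: real
    proof (cases "x = 0")
      case True
      then have "r = 0" using that by (simp add: mult_le_0_iff)
      then show ?thesis by (intro exI[of _ 0]) auto
    next
      case False
      have "0 \<le> r * ln 2" using that by simp
      then have "0 < x" using False that by linarith
      then show ?thesis using that by (intro exI[of _ "r * ln 2 / x"]) (auto simp: field_simps)
    qed
    obtain a where a: "0 \<le> a" "a \<le> 1" "Rp = a * (rate_p Hpp Hcp K T / ln 2)" using ex *(2,3) by blast
    obtain b where b: "0 \<le> b" "b \<le> 1" "Rc = b * (rate_c Hcc T / ln 2)" using ex *(4,5) by blast
    show "R \<in> ?f ` (?X \<times> ({0..1} \<times> {0..1}))"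
      using *(1) a b unfolding R by (intro image_eqI[of _ _ "((K, T), (a, b))"]) auto
  qed
  finally show ?thesis .
qed

text \<open>A larger \<open>T\<close> raises the cognitive rate but is interference to the primary
  receiver. So \<open>K\<close> is scaled by the full factor, which raises the primary rate
  strictly, and \<open>T\<close> by a factor \<open>e\<close> so little above 1 that, by continuity,
  this gain is not lost.\<close>

lemma rate_strict_improvement:
  fixes Hpp :: "complex^'pt^'pr" and Hcp :: "complex^'ct^'pr" and Hcc :: "complex^'ct^'cr"
  assumes \<kappa>: "1 < \<kappa>" and pow: "power_ok Pp Pc K T" 
  obtains K' T' where "power_ok (\<kappa> * Pp) (\<kappa> * Pc) K' T'"
    "rate_p Hpp Hcp K T = 0 \<or> rate_p Hpp Hcp K T < rate_p Hpp Hcp K' T'"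
    "rate_c Hcc T = 0 \<or> rate_c Hcc T < rate_c Hcc T'"
proof -
  define c where "c = sqrt \<kappa>"
  have c: "1 < c" "c\<^sup>2 = \<kappa>" using \<kappa> by (auto simp: c_def)
  let ?K = "c *\<^sub>R K"
  have "\<exists>e>1. e \<le> c \<and> (rate_p Hpp Hcp K T = 0 \<or> rate_p Hpp Hcp K T < rate_p Hpp Hcp ?K (e *\<^sub>R T))"
  proof (cases "rate_p Hpp Hcp K T = 0")
    case True
    then show ?thesis using c by (intro exI[of _ c]) auto
  next
    case False
    then have "0 < rate_p Hpp Hcp K T" using rate_p_nonneg[of Hpp Hcp K T] by simp
    then have "gdet (Hcp ** T) < gdet2 (Hcp ** T) (hcat Hpp Hcp ** K)"
      unfolding rate_p_def by (simp add: gdet_pos gdet2_pos)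
    then have "gdet2 (Hcp ** T) (hcat Hpp Hcp ** K) < gdet2 (Hcp ** T) (hcat Hpp Hcp ** ?K)"
      unfolding scaleR_matrix_mult using gdet2_strict_mono[OF c(1)] by blast
    then have less: "rate_p Hpp Hcp K T < rate_p Hpp Hcp ?K T"
      unfolding rate_p_def by (simp add: gdet2_pos)
    have "continuous_on UNIV (\<lambda>e. rate_p Hpp Hcp ?K (e *\<^sub>R T))"
      by (intro continuous_on_rate_p continuous_intros)
    then have "isCont (\<lambda>e. rate_p Hpp Hcp ?K (e *\<^sub>R T)) 1" by (simp add: continuous_on_eq_continuous_at)
    then have "(\<lambda>e. rate_p Hpp Hcp ?K (e *\<^sub>R T)) \<midarrow>1\<rightarrow> rate_p Hpp Hcp ?K (1 *\<^sub>R T)" by (simp add: isCont_def)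
    then have "((\<lambda>e. rate_p Hpp Hcp ?K (e *\<^sub>R T)) \<longlongrightarrow> rate_p Hpp Hcp ?K T) (at_right 1)"
      by (simp add: tendsto_within_subset[where S=UNIV])
    then have "\<forall>\<^sub>F e in at_right 1. rate_p Hpp Hcp K T < rate_p Hpp Hcp ?K (e *\<^sub>R T)"
      using less by (rule order_tendstoD)
    moreover have "\<forall>\<^sub>F e in at_right 1. 1 < e \<and> e \<le> c"
      unfolding eventually_at_right_field using c by (intro exI[of _ c]) auto
    ultimately have "\<forall>\<^sub>F e in at_right 1. 1 < e \<and> e \<le> c \<and> rate_p Hpp Hcp K T < rate_p Hpp Hcp ?K (e *\<^sub>R T)"
      by eventually_elim blast
    then show ?thesis using eventually_happens'[of "at_right (1::real)"] by auto
  qed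
  then obtain e where e: "1 < e" "e \<le> c" "rate_p Hpp Hcp K T = 0 \<or> rate_p Hpp Hcp K T < rate_p Hpp Hcp ?K (e *\<^sub>R T)" by blast
  show ?thesis
  proof (rule that[of ?K "e *\<^sub>R T"])
    have e2: "e\<^sup>2 \<le> \<kappa>" using e c by (metis less_imp_le order_trans power_mono zero_le_one)
    have "(norm (top_rows ?K))\<^sup>2 = \<kappa> * (norm (top_rows K))\<^sup>2" "(norm (bot_rows ?K))\<^sup>2 = \<kappa> * (norm (bot_rows K))\<^sup>2"
      using c by (simp_all add: top_rows_scaleR bot_rows_scaleR power_mult_distrib)
    moreover have "(norm (e *\<^sub>R T))\<^sup>2 \<le> \<kappa> * (norm T)\<^sup>2"
      using e2 by (simp add: power_mult_distrib mult_right_mono)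
    moreover have "\<kappa> * (norm (top_rows K))\<^sup>2 \<le> \<kappa> * Pp" "\<kappa> * ((norm (bot_rows K))\<^sup>2 + (norm T)\<^sup>2) \<le> \<kappa> * Pc"
      using pow \<kappa> by (auto simp: power_ok_def)
    ultimately show "power_ok (\<kappa> * Pp) (\<kappa> * Pc) ?K (e *\<^sub>R T)"
      unfolding power_ok_def distrib_left by linarith
    show "rate_p Hpp Hcp K T = 0 \<or> rate_p Hpp Hcp K T < rate_p Hpp Hcp ?K (e *\<^sub>R T)" by (rule e)
    show "rate_c Hcc T = 0 \<or> rate_c Hcc T < rate_c Hcc (e *\<^sub>R T)"
    proof (cases "rate_c Hcc T = 0")
      case False
      then have "1 < gdet (Hcc ** T)" using gdet_ge_1[of "Hcc ** T"] by (cases "gdet (Hcc ** T) = 1") (auto simp: rate_c_def)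
      then have "gdet (Hcc ** T) < gdet (Hcc ** (e *\<^sub>R T))" unfolding scaleR_matrix_mult by (rule gdet_strict_mono[OF e(1)])
      then show ?thesis unfolding rate_c_def by (simp add: gdet_pos)
    qed simp
  qed
qed

lemma MCC_code_mono:
  assumes "MCC_code Hpp Hcp Hpc Hcc Pp Pc n Rp Rc e Ep Ec Dp Dc" "e \<le> eps"
  shows "MCC_code Hpp Hcp Hpc Hcc Pp Pc n Rp Rc eps Ep Ec Dp Dc"
  using assms unfolding MCC_code_def Let_def by (blast intro: order_trans)

text \<open>The increase is strict only where \<open>x p\<close> is positive; a nonzero sum supplies
  such a point with positive weight.\<close>

lemma weighted_sum_strict_mono:
  fixes u x y :: "'a \<Rightarrow> real"
  assumes S: "finite S" "\<And>p. p \<in> S \<Longrightarrow> 0 \<le> u p" and x: "\<And>p. p \<in> S \<Longrightarrow> 0 \<le> x p"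
    and y: "\<And>p. p \<in> S \<Longrightarrow> x p \<le> y p" "\<And>p. p \<in> S \<Longrightarrow> 0 < x p \<Longrightarrow> x p < y p" and pos: "(\<Sum>p\<in>S. u p * x p) \<noteq> 0"
  shows "(\<Sum>p\<in>S. u p * x p) < (\<Sum>p\<in>S. u p * y p)"
proof -
  obtain p where p: "p \<in> S" "u p * x p \<noteq> 0" using pos sum.not_neutral_contains_not_neutral by blast
  then have "0 < u p" "0 < x p" using S(2)[OF p(1)] x[OF p(1)] by (auto simp: less_le)
  then have "u p * x p < u p * y p" using y(2)[OF p(1)] by simp
  then show ?thesis using S y(1) p(1) by (intro sum_strict_mono_ex1) (auto intro: mult_left_mono)
qed

theorem theorem1:
  fixes Hpp :: "complex^'pt::finite^'pr::finite" and Hcp :: "complex^'ct::finite^'pr"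
    and Hpc :: "complex^'pt^'cr::finite" and Hcc :: "complex^'ct^'cr"
    and Pp Pc :: real
  shows "R_in Hpp Hcp Hpc Hcc Pp Pc \<subseteq> C_MCC Hpp Hcp Hpc Hcc Pp Pc"
proof
  fix R assume R: "R \<in> R_in Hpp Hcp Hpc Hcc Pp Pc"
  let ?A = "rate_region Hpp Hcp Hcc Pp Pc"
  have "R_in Hpp Hcp Hpc Hcc Pp Pc \<subseteq> closure (convex hull ?A)"
    unfolding R_in_def using R_ach_subset_rate_region by (intro closure_mono hull_mono) blast
  also have "\<dots> = convex hull ?A"
    by (intro closure_closed compact_imp_closed compact_convex_hull compact_rate_region)
  finally have "R \<in> convex hull ?A" using R by blast
  then obtain S u where S: "finite S" "S \<subseteq> ?A" "\<And>p. p \<in> S \<Longrightarrow> 0 \<le> u p" "sum u S = 1" and Rsum: "(\<Sum>p\<in>S. u p *\<^sub>R p) = R"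
    unfolding convex_hull_explicit by blast
  obtain Rp Rc where RR: "R = (Rp, Rc)" by (cases R)
  have Rp: "Rp = (\<Sum>p\<in>S. u p * fst p)" and Rc: "Rc = (\<Sum>p\<in>S. u p * snd p)"
    using Rsum unfolding RR by (auto simp: fst_sum snd_sum dest: arg_cong[where f=fst] arg_cong[where f=snd])
  have "\<forall>p\<in>S. \<exists>K T. power_ok Pp Pc K T \<and> 0 \<le> fst p \<and> fst p * ln 2 \<le> rate_p Hpp Hcp K T \<and> 0 \<le> snd p \<and> snd p * ln 2 \<le> rate_c Hcc T"
    using S(2) unfolding rate_region_def by fastforce
  then obtain K T where KT: "\<And>p. p \<in> S \<Longrightarrow> power_ok Pp Pc (K p) (T p)" "\<And>p. p \<in> S \<Longrightarrow> 0 \<le> fst p" "\<And>p. p \<in> S \<Longrightarrow> 0 \<le> snd p"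
    "\<And>p. p \<in> S \<Longrightarrow> fst p * ln 2 \<le> rate_p Hpp Hcp (K p) (T p)" "\<And>p. p \<in> S \<Longrightarrow> snd p * ln 2 \<le> rate_c Hcc (T p)"
    by metis
  have R0: "0 \<le> Rp" "0 \<le> Rc" unfolding Rp Rc using S KT by (auto intro!: sum_nonneg)
  have "S \<noteq> {}" using S(4) by auto
  then obtain p0 where p0: "p0 \<in> S" by blast
  \<comment> \<open>A feasible operating point exists, and its squared norms are
    nonnegative.\<close>
  have P0: "0 \<le> Pp" "0 \<le> Pc"
    using KT(1)[OF p0] zero_le_power2[of "norm (top_rows (K p0))"] zero_le_power2[of "norm (bot_rows (K p0))"] zero_le_power2[of "norm (T p0)"]
    unfolding power_ok_def by linarith+
  have "\<exists>N. \<forall>n\<ge>N. \<exists>Ep Ec Dp Dc. MCC_code Hpp Hcp Hpc Hcc Pp Pc n Rp Rc eps Ep Ec Dp Dc" if eps: "0 < eps" for eps :: real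
  proof -
    define e where "e = min eps 1"
    have e: "0 < e" "e \<le> 1" "e \<le> eps" using eps by (auto simp: e_def)
    \<comment> \<open>Any value strictly between 1 and \<open>1 / (1 - e / 4)\<close> would do:
      above 1 to gain rate, and below that bound so that silencing the fraction \<open>e / 4\<close>
      of the messages can make up for it.\<close>
    define \<kappa> where "\<kappa> = 1 + e / 8"
    have "\<kappa> * (1 - e / 4) = 1 - e / 8 - e\<^sup>2 / 32" by (simp add: \<kappa>_def power2_eq_square algebra_simps)
    then have \<kappa>: "1 < \<kappa>" "0 \<le> \<kappa>" "\<kappa> * (1 - e / 4) < 1"
      using e zero_le_power2[of e] unfolding \<kappa>_def by linarith+
    have "\<forall>p\<in>S. \<exists>K' T'. power_ok (\<kappa> * Pp) (\<kappa> * Pc) K' T' \<and>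
       (rate_p Hpp Hcp (K p) (T p) = 0 \<or> rate_p Hpp Hcp (K p) (T p) < rate_p Hpp Hcp K' T') \<and> (rate_c Hcc (T p) = 0 \<or> rate_c Hcc (T p) < rate_c Hcc T')"
      using rate_strict_improvement[OF \<kappa>(1) KT(1)] by metis
    then obtain K' T' where K': "\<And>p. p \<in> S \<Longrightarrow> power_ok (\<kappa> * Pp) (\<kappa> * Pc) (K' p) (T' p)"
       "\<And>p. p \<in> S \<Longrightarrow> rate_p Hpp Hcp (K p) (T p) = 0 \<or> rate_p Hpp Hcp (K p) (T p) < rate_p Hpp Hcp (K' p) (T' p)"
       "\<And>p. p \<in> S \<Longrightarrow> rate_c Hcc (T p) = 0 \<or> rate_c Hcc (T p) < rate_c Hcc (T' p)"
      by metis
    \<comment> \<open>The points of \<open>S\<close> themselves index the operating points, and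
      their convex weights \<open>u\<close> are the time-sharing fractions.\<close>
    interpret mcc_family Hpp Hcp Hpc Hcc K' T' .
    have rp: "fst p * ln 2 \<le> rate_p Hpp Hcp (K' p) (T' p)" "0 < fst p * ln 2 \<Longrightarrow> fst p * ln 2 < rate_p Hpp Hcp (K' p) (T' p)"
      and rc: "snd p * ln 2 \<le> rate_c Hcc (T' p)" "0 < snd p * ln 2 \<Longrightarrow> snd p * ln 2 < rate_c Hcc (T' p)" if "p \<in> S" for p
      using KT(4,5)[OF that] K'(2,3)[OF that] rate_p_nonneg[of Hpp Hcp "K' p" "T' p"] rate_c_nonneg[of Hcc "T' p"] by linarith+
    have Rp': "Rp = 0 \<or> Rp * ln 2 < (\<Sum>p\<in>S. u p * rate_p Hpp Hcp (K' p) (T' p))"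
    proof (cases "Rp = 0")
      case False
      have *: "Rp * ln 2 = (\<Sum>p\<in>S. u p * (fst p * ln 2))" unfolding Rp by (simp add: sum_distrib_right mult.assoc)
      have "(\<Sum>p\<in>S. u p * (fst p * ln 2)) < (\<Sum>p\<in>S. u p * rate_p Hpp Hcp (K' p) (T' p))"
        using False * by (intro weighted_sum_strict_mono S rp) (auto simp: KT)
      then show ?thesis using * by simp
    qed simp
    have Rc': "Rc = 0 \<or> Rc * ln 2 < (\<Sum>p\<in>S. u p * rate_c Hcc (T' p))"
    proof (cases "Rc = 0")
      case False
      have *: "Rc * ln 2 = (\<Sum>p\<in>S. u p * (snd p * ln 2))" unfolding Rc by (simp add: sum_distrib_right mult.assoc)
      have "(\<Sum>p\<in>S. u p * (snd p * ln 2)) < (\<Sum>p\<in>S. u p * rate_c Hcc (T' p))"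
        using False * by (intro weighted_sum_strict_mono S rc) (auto simp: KT)
      then show ?thesis using * by simp
    qed simp
    have "\<exists>N. \<forall>n\<ge>N. \<exists>Ep Ec Dp Dc. MCC_code Hpp Hcp Hpc Hcc Pp Pc n Rp Rc e Ep Ec Dp Dc"
    proof (rule family_MCC_code[OF S(1) S(4) S(3) e(1,2) R0 _ _ P0 \<kappa>(2,3)])
      show "Rp = 0 \<or> Rp * ln 2 < (\<Sum>p\<in>S. u p * (ln (gdet2 (H3 p) (A3 p)) - ln (gdet (H3 p))))"
        using Rp' unfolding rate_p_def H3_def A3_def .
      show "Rc = 0 \<or> Rc * ln 2 < (\<Sum>p\<in>S. u p * ln (gdet (H2 p)))"
        using Rc' unfolding rate_c_def H2_def .
    qed (use K'(1) in \<open>auto simp: power_ok_def\<close>)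
    then show ?thesis using MCC_code_mono[OF _ e(3)] by meson
  qed
  then show "R \<in> C_MCC Hpp Hcp Hpc Hcc Pp Pc" unfolding C_MCC_def RR by blast
qed

end
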